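(* In the setting described in the context, assume the non-degeneracy condition (for every $i\neq i'$ there exists $n$ with $\Lambda_{ni}\neq\Lambda_{ni'}$) and $\|W_n\|\le1$ for all $n$. Let $U\in\mathbb O(d)$ be any feasible point of $\min_{U\in\mathbb O(d)}\mathcal L(U)$. Then there exists an exact joint triangularizer $U_\circ$ of $\{M_n\}$ such that $U=U_\circ e^{\alpha X}$ with $X=-X^T$, $\|X\|=1$, $\alpha>0$, and, for $\beta=[\beta_1,\dots,\beta_N]\in\mathbb R^N$ such that $\hat T_\beta$ is invertible, $$\alpha\le\sqrt2\,\|\beta\|\,\|\hat T_\beta^{-1}\|_2\big(\sqrt{\mathcal L(U)}+\sigma\sqrt N\big)+O((\sigma+\alpha)^2),$$ where $\hat T_\beta=\sum_{n=1}^N\beta_nP_{\rm low}\big(1\otimes U^T\hat M_n^TU-U^T\hat M_nU\otimes1\big)P_{\rm low}^T$.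
   Context: All matrices are real; $\|\cdot\|$ is the Frobenius norm (Euclidean norm for vectors), $\|\cdot\|_2$ the spectral norm. ${\rm low}(A)$ is the strictly lower-triangular part of $A$ ($[{\rm low}(A)]_{ij}=A_{ij}$ if $i>j$, else $0$). $\otimes$ is the Kronecker product, $1$ the identity, ${\rm vec}$ column-wise vectorization. $P_{\rm low}\in\{0,1\}^{\frac{d(d-1)}2\times d^2}$ has as rows the standard basis row vectors of $\mathbb R^{d^2}$ selecting (in increasing order) the entries of ${\rm vec}(A)$ corresponding to strictly lower-triangular entries of $A$. Model: $\hat M_n=M_n+\sigma W_n$, $M_n=V\,{\rm diag}(\Lambda_{n1},\dots,\Lambda_{nd})V^{-1}$, $n=1,\dots,N$, with $V$ real invertible, $\Lambda_{ni}$ real, $\sigma>0$, $W_n$ real. $\mathcal L(U)=\sum_{n=1}^N\|{\rm low}(U^T\hat M_nU)\|^2$. An exact joint triangularizer of $\{M_n\}$ is an orthogonal $U_\circ$ with ${\rm low}(U_\circ^TM_nU_\circ)=0$ for all $n$. The inequality is first-order, valid up to $O((\sigma+\alpha)^2)$ terms. *)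

theory Defs
  imports "Jordan_Normal_Form.Matrix"
begin

definition is_orthogonal :: "nat \<Rightarrow> real mat \<Rightarrow> bool" where
  "is_orthogonal d U \<longleftrightarrow> U \<in> carrier_mat d d \<and> transpose_mat U * U = 1\<^sub>m d"

definition low :: "real mat \<Rightarrow> real mat" where
  "low A = mat (dim_row A) (dim_col A) (\<lambda>(i,j). if i > j then A $$ (i,j) else 0)"

definition fro_norm :: "real mat \<Rightarrow> real" where
  "fro_norm A = sqrt (\<Sum>i<dim_row A. \<Sum>j<dim_col A. (A $$ (i,j))\<^sup>2)"

definition euc_norm :: "real vec \<Rightarrow> real" where
  "euc_norm v = sqrt (\<Sum>i<dim_vec v. (v $ i)\<^sup>2)"

definition spec_norm :: "real mat \<Rightarrow> real" where
  "spec_norm A = Sup {euc_norm (A *\<^sub>v v) | v. v \<in> carrier_vec (dim_col A) \<and> euc_norm v = 1}"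

definition mat_inv :: "real mat \<Rightarrow> real mat" where
  "mat_inv A = (SOME B. inverts_mat A B \<and> inverts_mat B A)"

definition kron :: "real mat \<Rightarrow> real mat \<Rightarrow> real mat" where
  "kron A B = mat (dim_row A * dim_row B) (dim_col A * dim_col B)
     (\<lambda>(i,j). A $$ (i div dim_row B, j div dim_col B) * B $$ (i mod dim_row B, j mod dim_col B))"

text \<open>Positions (0-based, column-wise vectorization: entry (i,j) of a d x d matrix sits at
  position j*d+i of vec) of the strictly lower-triangular entries, in increasing order.\<close>
definition low_positions :: "nat \<Rightarrow> nat list" where
  "low_positions d = sorted_list_of_set {j * d + i | i j. j < i \<and> i < d}"

definition P_low :: "nat \<Rightarrow> real mat" where
  "P_low d = mat (d * (d - 1) div 2) (d * d) (\<lambda>(k,p). if p = low_positions d ! k then 1 else 0)"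

definition mat_exp :: "real mat \<Rightarrow> real mat" where
  "mat_exp A = mat (dim_row A) (dim_col A) (\<lambda>(i,j). \<Sum>k. (A ^\<^sub>m k) $$ (i,j) / fact k)"

definition model_M :: "nat \<Rightarrow> real mat \<Rightarrow> real mat \<Rightarrow> (nat \<Rightarrow> nat \<Rightarrow> real) \<Rightarrow> nat \<Rightarrow> real mat" where
  "model_M d V Vinv \<Lambda> n = V * mat_diag d (\<lambda>i. \<Lambda> n i) * Vinv"

definition loss :: "nat \<Rightarrow> (nat \<Rightarrow> real mat) \<Rightarrow> real mat \<Rightarrow> real" where
  "loss N Mh U = (\<Sum>n\<in>{1..N}. (fro_norm (low (transpose_mat U * Mh n * U)))\<^sup>2)"

definition exact_joint_triangularizer :: "nat \<Rightarrow> nat \<Rightarrow> (nat \<Rightarrow> real mat) \<Rightarrow> real mat \<Rightarrow> bool" where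
  "exact_joint_triangularizer d N M U0 \<longleftrightarrow> is_orthogonal d U0 \<and>
     (\<forall>n\<in>{1..N}. low (transpose_mat U0 * M n * U0) = 0\<^sub>m d d)"

definition T_hat :: "nat \<Rightarrow> nat \<Rightarrow> (nat \<Rightarrow> real) \<Rightarrow> (nat \<Rightarrow> real mat) \<Rightarrow> real mat \<Rightarrow> real mat" where
  "T_hat d N \<beta> Mh U = (let m = d * (d - 1) div 2 in
     foldr (\<lambda>n acc. acc + ( \<beta> n \<cdot>\<^sub>m (P_low d *
        (kron (1\<^sub>m d) (transpose_mat U * transpose_mat (Mh n) * U)
         - kron (transpose_mat U * Mh n * U) (1\<^sub>m d)) * transpose_mat (P_low d)))) [1..<N+1]
     (0\<^sub>m m m))"

end

theory Submission
  imports Defs "Jordan_Normal_Form.Spectral_Radius" "HOL-Analysis.L2_Norm"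
begin

text \<open>Write \<open>U = U0 E\<close> with \<open>E = exp (\<alpha> X)\<close>, \<open>A n = U0\<^sup>T M n U0\<close> (upper triangular) and \<open>L = low X\<close>. To first
  order the strictly lower part of \<open>U\<^sup>T Mh n U\<close> is \<open>\<alpha> low (A n L - L A n)\<close> plus noise of size \<open>\<sigma>\<close>, and the
  \<open>\<beta>\<close>-combination of the maps \<open>L \<mapsto> low (Ah n L - L Ah n)\<close>, with \<open>Ah n = U\<^sup>T Mh n U\<close>, is represented by the
  transpose of \<open>T_hat\<close>. Inverting it bounds \<open>\<alpha> = sqrt 2 * \<alpha> * fro_norm L\<close> up to an error
  \<open>s * O((\<sigma> + \<alpha>)\<^sup>2)\<close>, where \<open>s\<close> is the spectral norm of the inverse of \<open>T_hat\<close>.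

  The constant in the error term must not depend on \<open>s\<close>, which is unbounded when \<open>\<beta>\<close> does not separate
  the joint eigenvalues. For that, some other combination \<open>\<gamma>\<close> does separate them, which gives a uniform
  bound \<open>\<alpha> \<le> c (sqrt loss + \<sigma> sqrt N)\<close>; it proves the claim outright when \<open>s\<close> exceeds a
  fixed threshold.

  For the existence of \<open>U0\<close> and \<open>X\<close>: a QR decomposition of \<open>V\<close> gives a triangularizer, a sign change
  adjusts its determinant, and \<open>exp\<close> maps the skew-symmetric matrices onto the special orthogonal group.\<close>

section \<open>Frobenius norm and matrix exponential\<close>

text \<open>The constants of the error term are chosen before the noise, \<open>U\<close> and its
  decomposition, so each estimate has to be uniform over all exact joint triangularizers
  \<open>U0\<close>. Two facts give this: orthogonal conjugation preserves the Frobenius norms of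
  the matrices \<open>M n\<close>, and a combination with separated eigenvalues has the same set of
  diagonal entries in every triangular form. Norm and gap alone control the inverse of the
  commutator operator.

  The threshold for \<open>s\<close> is the value at which the leading term of the claim, which
  grows with \<open>s\<close>, overtakes the uniform bound. Below it, the factor \<open>s\<close> of
  the error is absorbed in the constant.

  The sign change is forced: the exponential of a skew-symmetric matrix has determinant 1, so
  \<open>U0\<close> and \<open>U\<close> need equal determinants. Surjectivity of the exponential is
  obtained by splitting off invariant lines and planes one at a time; a real eigenvector of the
  symmetric matrix \<open>Q + transpose_mat Q\<close> is the starting point.\<close>

lemma mult_mat_entry:
  assumes "A \<in> carrier_mat r n" "B \<in> carrier_mat n c" "i < r" "j < c"
  shows "(A * B) $$ (i,j) = (\<Sum>k<n. A $$ (i,k) * B $$ (k,j))"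
  using assms by (auto simp: scalar_prod_def atLeast0LessThan)

lemma low_carrier [simp]: "A \<in> carrier_mat r c \<Longrightarrow> low A \<in> carrier_mat r c"
  by (auto simp: low_def)

lemma low_dim [simp]: "dim_row (low A) = dim_row A" "dim_col (low A) = dim_col A"
  by (auto simp: low_def)

lemma low_index [simp]:
  "i < dim_row A \<Longrightarrow> j < dim_col A \<Longrightarrow> low A $$ (i,j) = (if i > j then A $$ (i,j) else 0)"
  by (auto simp: low_def)

lemma low_eq_0_iff:
  assumes "A \<in> carrier_mat d d"
  shows "low A = 0\<^sub>m d d \<longleftrightarrow> upper_triangular A"
proof
  assume h: "low A = 0\<^sub>m d d"
  show "upper_triangular A"
  proof (rule upper_triangularI)
    fix i j assume ij: "j < i" "i < dim_row A"
    have "low A $$ (i,j) = 0" using h ij assms by auto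
    then show "A $$ (i,j) = 0" using ij assms by auto
  qed
next
  assume "upper_triangular A"
  then show "low A = 0\<^sub>m d d"
    by (intro eq_matI) (use assms in \<open>auto simp: upper_triangularD\<close>)
qed

lemma fro_norm_L2_set:
  "fro_norm A = L2_set (\<lambda>p. A $$ p) ({..<dim_row A} \<times> {..<dim_col A})"
  by (simp add: fro_norm_def L2_set_def sum.cartesian_product case_prod_unfold)

lemma fro_norm_nonneg [simp]: "0 \<le> fro_norm A"
  by (simp add: fro_norm_L2_set L2_set_nonneg)

lemma fro_norm_sq:
  "(fro_norm A)\<^sup>2 = (\<Sum>i<dim_row A. \<Sum>j<dim_col A. (A $$ (i,j))\<^sup>2)"
  unfolding fro_norm_def by (intro real_sqrt_pow2 sum_nonneg) auto

text \<open>Written as a trace, the norm no longer sees an orthogonal factor on the left, since that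
  factor cancels inside \<open>transpose_mat A * A\<close>; \<open>fro_norm_orthogonal_left\<close>
  rests on this.\<close>

lemma fro_norm_sq_transpose_mult:
  assumes "A \<in> carrier_mat r c"
  shows "(fro_norm A)\<^sup>2 = (\<Sum>j<c. (transpose_mat A * A) $$ (j,j))"
proof -
  have "(fro_norm A)\<^sup>2 = (\<Sum>j<c. \<Sum>i<r. (A $$ (i,j))\<^sup>2)"
    using assms by (subst sum.swap) (simp add: fro_norm_sq)
  also have "\<dots> = (\<Sum>j<c. (transpose_mat A * A) $$ (j,j))"
    using assms by (intro sum.cong refl)
      (auto simp: scalar_prod_def atLeast0LessThan power2_eq_square)
  finally show ?thesis .
qed

lemma fro_norm_transpose [simp]: "fro_norm (transpose_mat A) = fro_norm A"
  unfolding fro_norm_def index_transpose_mat by (subst sum.swap) simp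

lemma fro_norm_add:
  assumes "A \<in> carrier_mat r c" "B \<in> carrier_mat r c"
  shows "fro_norm (A + B) \<le> fro_norm A + fro_norm B"
proof -
  let ?S = "{..<r} \<times> {..<c}"
  have "fro_norm (A + B) = L2_set (\<lambda>p. A $$ p + B $$ p) ?S"
    using assms by (auto simp: fro_norm_L2_set intro!: L2_set_cong)
  also have "\<dots> \<le> L2_set (\<lambda>p. A $$ p) ?S + L2_set (\<lambda>p. B $$ p) ?S"
    by (rule L2_set_triangle_ineq)
  finally show ?thesis using assms by (simp add: fro_norm_L2_set)
qed

lemma fro_norm_smult [simp]: "fro_norm (a \<cdot>\<^sub>m A) = \<bar>a\<bar> * fro_norm A"
proof -
  have "fro_norm (a \<cdot>\<^sub>m A) = sqrt (a\<^sup>2 * (\<Sum>i<dim_row A. \<Sum>j<dim_col A. (A $$ (i,j))\<^sup>2))"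
    by (simp add: fro_norm_def power_mult_distrib sum_distrib_left)
  then show ?thesis by (simp add: fro_norm_def real_sqrt_mult)
qed

lemma fro_norm_diff:
  assumes "A \<in> carrier_mat r c" "B \<in> carrier_mat r c"
  shows "fro_norm (A - B) \<le> fro_norm A + fro_norm B"
proof -
  have "A - B = A + (-1) \<cdot>\<^sub>m B" using assms by (intro eq_matI) auto
  then show ?thesis
    using fro_norm_add[OF assms(1), of "(-1) \<cdot>\<^sub>m B"] assms(2) by simp
qed

lemma abs_entry_le_fro_norm:
  assumes "i < dim_row A" "j < dim_col A"
  shows "\<bar>A $$ (i,j)\<bar> \<le> fro_norm A"
  unfolding fro_norm_L2_set real_norm_def[symmetric]
  using member_le_L2_set[of "{..<dim_row A} \<times> {..<dim_col A}" "(i,j)" "\<lambda>p. \<bar>A $$ p\<bar>"] assms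
  by (auto simp: L2_set_def)

lemma fro_norm_le_entries:
  assumes "A \<in> carrier_mat d d" "0 \<le> K" "\<And>i j. i < d \<Longrightarrow> j < d \<Longrightarrow> \<bar>A $$ (i,j)\<bar> \<le> K"
  shows "fro_norm A \<le> d * K"
proof -
  have "(fro_norm A)\<^sup>2 \<le> (\<Sum>i<d. \<Sum>j<d. K\<^sup>2)"
    unfolding fro_norm_sq carrier_matD[OF assms(1)] using assms
    by (intro sum_mono) (auto simp: abs_le_square_iff[symmetric])
  also have "\<dots> = (d * K)\<^sup>2" by (simp add: power2_eq_square)
  finally show ?thesis using assms(2) by (simp add: abs_le_square_iff[symmetric])
qed

lemma fro_norm_low_le: "fro_norm (low A) \<le> fro_norm A"
  unfolding fro_norm_def low_dim
  by (intro real_sqrt_le_mono sum_mono) auto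

lemma Cauchy_Schwarz_sum:
  fixes f g :: "'a \<Rightarrow> real"
  shows "(\<Sum>k\<in>I. f k * g k)\<^sup>2 \<le> (\<Sum>k\<in>I. (f k)\<^sup>2) * (\<Sum>k\<in>I. (g k)\<^sup>2)"
proof -
  have "\<bar>\<Sum>k\<in>I. f k * g k\<bar> \<le> L2_set f I * L2_set g I"
    using sum_abs[of "\<lambda>k. f k * g k" I] L2_set_mult_ineq[of f g I] by (simp add: abs_mult)
  then have "(\<Sum>k\<in>I. f k * g k)\<^sup>2 \<le> (L2_set f I * L2_set g I)\<^sup>2"
    using power_mono[of "\<bar>\<Sum>k\<in>I. f k * g k\<bar>" _ 2] by simp
  then show ?thesis by (simp add: power_mult_distrib L2_set_def sum_nonneg)
qed

lemma fro_norm_mult: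
  assumes A: "A \<in> carrier_mat r n" and B: "B \<in> carrier_mat n c"
  shows "fro_norm (A * B) \<le> fro_norm A * fro_norm B"
proof -
  have "((A * B) $$ (i,j))\<^sup>2 \<le> (\<Sum>k<n. (A $$ (i,k))\<^sup>2) * (\<Sum>k<n. (B $$ (k,j))\<^sup>2)"
    if "i < r" "j < c" for i j
    unfolding mult_mat_entry[OF A B that] by (rule Cauchy_Schwarz_sum)
  then have "(fro_norm (A * B))\<^sup>2
      \<le> (\<Sum>i<r. \<Sum>j<c. (\<Sum>k<n. (A $$ (i,k))\<^sup>2) * (\<Sum>k<n. (B $$ (k,j))\<^sup>2))"
    unfolding fro_norm_sq using A B by (auto intro!: sum_mono simp del: index_mult_mat(1))
  also have "\<dots> = (\<Sum>i<r. \<Sum>k<n. (A $$ (i,k))\<^sup>2) * (\<Sum>j<c. \<Sum>k<n. (B $$ (k,j))\<^sup>2)"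
    by (simp add: sum_product)
  also have "(\<Sum>j<c. \<Sum>k<n. (B $$ (k,j))\<^sup>2) = (\<Sum>k<n. \<Sum>j<c. (B $$ (k,j))\<^sup>2)"
    by (rule sum.swap)
  finally have "(fro_norm (A * B))\<^sup>2 \<le> (fro_norm A * fro_norm B)\<^sup>2"
    using A B by (simp add: power_mult_distrib fro_norm_sq)
  then show ?thesis by (simp add: abs_le_square_iff[symmetric])
qed

section \<open>Orthogonal matrices and the invariance of the Frobenius norm\<close>

lemma is_orthogonalD:
  assumes "is_orthogonal d U"
  shows "U \<in> carrier_mat d d" "transpose_mat U \<in> carrier_mat d d"
    "transpose_mat U * U = 1\<^sub>m d" "U * transpose_mat U = 1\<^sub>m d"
  using assms mat_mult_left_right_inverse[of "transpose_mat U" d U]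
  by (auto simp: is_orthogonal_def)

lemma is_orthogonal_transpose:
  assumes "is_orthogonal d U" shows "is_orthogonal d (transpose_mat U)"
  using is_orthogonalD(2,4)[OF assms] by (simp add: is_orthogonal_def)

lemma is_orthogonal_mult:
  assumes U: "is_orthogonal d U" and V: "is_orthogonal d V"
  shows "is_orthogonal d (U * V)"
proof -
  note u = is_orthogonalD[OF U] and v = is_orthogonalD[OF V]
  have "transpose_mat (U * V) * (U * V) = transpose_mat V * (transpose_mat U * U) * V"
    using u(1,2) v(1,2) by (simp add: transpose_mult[OF u(1) v(1)] assoc_mult_mat[of _ d d _ d _ d])
  then show ?thesis using u v by (auto simp: is_orthogonal_def)
qed

lemma is_orthogonal_one: "is_orthogonal d (1\<^sub>m d)"
  by (auto simp: is_orthogonal_def)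

lemma fro_norm_orthogonal_left:
  assumes U: "is_orthogonal d U" and A: "A \<in> carrier_mat d c"
  shows "fro_norm (U * A) = fro_norm A"
proof -
  note u = is_orthogonalD[OF U]
  have "transpose_mat (U * A) * (U * A) = transpose_mat A * (transpose_mat U * U) * A"
    using u(1,2) A
    by (simp add: transpose_mult[OF u(1) A] assoc_mult_mat[of _ c d _ d _ c]
        assoc_mult_mat[of _ c d _ d _ d] assoc_mult_mat[of _ d d _ d _ c])
  also have "\<dots> = transpose_mat A * A" using u A by auto
  finally have "(fro_norm (U * A))\<^sup>2 = (fro_norm A)\<^sup>2"
    using fro_norm_sq_transpose_mult[of "U * A" d c] fro_norm_sq_transpose_mult[OF A] u A by simp
  then show ?thesis by (simp add: power2_eq_iff_nonneg)
qed

text \<open>Transposition preserves the norm and moves the right factor to the left, so left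
  invariance is enough, used twice.\<close>

lemma fro_norm_orthogonal_conj:
  assumes U: "is_orthogonal d U" and A: "A \<in> carrier_mat d d"
  shows "fro_norm (transpose_mat U * A * U) = fro_norm A"
proof -
  note u = is_orthogonalD[OF U]
  have "fro_norm (transpose_mat U * A * U) = fro_norm (transpose_mat (transpose_mat U * A * U))"
    by simp
  also have "transpose_mat (transpose_mat U * A * U) = transpose_mat U * (transpose_mat (transpose_mat U * A))"
    using u A by (subst transpose_mult[of _ d d _ d]) auto
  also have "fro_norm \<dots> = fro_norm (transpose_mat (transpose_mat U * A))"
    using u A by (intro fro_norm_orthogonal_left[OF is_orthogonal_transpose[OF U]]) auto
  also have "\<dots> = fro_norm A"
    using fro_norm_orthogonal_left[OF is_orthogonal_transpose[OF U] A] by simp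
  finally show ?thesis .
qed

text \<open>Submultiplicativity gives this from the first power on; the zeroth power is the
  identity, of norm \<open>sqrt d\<close>. The entrywise bound \<open>abs_pow_entry_le\<close> can
  include it, because the entries of the identity are at most 1.\<close>

lemma fro_norm_pow_le:
  assumes A: "A \<in> carrier_mat d d"
  shows "fro_norm (A ^\<^sub>m Suc k) \<le> fro_norm A ^ Suc k"
proof (induction k)
  case 0
  then show ?case using A by simp
next
  case (Suc k)
  have "fro_norm (A ^\<^sub>m Suc k * A) \<le> fro_norm (A ^\<^sub>m Suc k) * fro_norm A"
    using A by (intro fro_norm_mult[of _ d d _ d]) auto
  also have "\<dots> \<le> fro_norm A ^ Suc k * fro_norm A"
    using Suc by (intro mult_right_mono) auto
  finally show ?case by (simp add: mult.commute)
qed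

lemma abs_pow_entry_le:
  assumes A: "A \<in> carrier_mat d d" and "i < d" "j < d"
  shows "\<bar>(A ^\<^sub>m k) $$ (i,j)\<bar> \<le> fro_norm A ^ k"
proof (cases k)
  case 0
  then show ?thesis using assms by auto
next
  case (Suc m)
  have "\<bar>(A ^\<^sub>m k) $$ (i,j)\<bar> \<le> fro_norm (A ^\<^sub>m k)"
    using assms by (intro abs_entry_le_fro_norm) (auto simp: pow_mat_dim)
  then show ?thesis using fro_norm_pow_le[OF A, of m] Suc by simp
qed

section \<open>The matrix exponential up to second order\<close>

lemma mat_exp_carrier [simp]: "A \<in> carrier_mat r c \<Longrightarrow> mat_exp A \<in> carrier_mat r c"
  by (auto simp: mat_exp_def)

lemma mat_exp_dim [simp]: "dim_row (mat_exp A) = dim_row A" "dim_col (mat_exp A) = dim_col A"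
  by (auto simp: mat_exp_def)

lemma mat_exp_summable:
  fixes A :: "real mat"
  assumes A: "A \<in> carrier_mat d d" and ij: "i < d" "j < d"
  shows "summable (\<lambda>k. (A ^\<^sub>m k) $$ (i,j) / fact k)"
proof (rule summable_comparison_test'[where N=0])
  show "summable (\<lambda>k. fro_norm A ^ k / fact k)"
    using summable_exp[of "fro_norm A"] by (simp add: field_simps)
  show "norm ((A ^\<^sub>m k) $$ (i,j) / fact k) \<le> fro_norm A ^ k / fact k" if "k \<ge> 0" for k
    using abs_pow_entry_le[OF A ij, of k] by (simp add: divide_right_mono)
qed

lemma mat_exp_remainder_entry:
  assumes A: "A \<in> carrier_mat d d" and a: "fro_norm A \<le> 1" and ij: "i < d" "j < d"
  shows "\<bar>(mat_exp A - 1\<^sub>m d - A) $$ (i,j)\<bar> \<le> 3 * (fro_norm A)\<^sup>2"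
proof -
  let ?a = "fro_norm A"
  define f where "f k = (A ^\<^sub>m k) $$ (i,j) / fact k" for k
  have sf: "summable f" using mat_exp_summable[OF A ij] by (simp add: f_def[abs_def])
  have s0: "suminf f = (\<Sum>k. f (k + 2)) + sum f {..<2}"
    by (rule suminf_split_initial_segment[OF sf])
  have f01: "f 0 = (1\<^sub>m d) $$ (i,j)" "f 1 = A $$ (i,j)"
    using A by (auto simp: f_def)
  have tl: "(mat_exp A - 1\<^sub>m d - A) $$ (i,j) = (\<Sum>k. f (k + 2))"
  proof -
    have "mat_exp A $$ (i,j) = suminf f" using A ij by (simp add: mat_exp_def f_def[abs_def])
    moreover have "sum f {..<2} = (1\<^sub>m d) $$ (i,j) + A $$ (i,j)"
      using f01 by (simp add: numeral_2_eq_2)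
    ultimately show ?thesis using s0 A ij by simp
  qed
  have se: "summable (\<lambda>k. ?a\<^sup>2 * (1 / fact k))"
    using summable_exp[of "1::real"] by (intro summable_mult) (simp add: field_simps)
  have bnd: "norm (f (k + 2)) \<le> ?a\<^sup>2 * (1 / fact k)" for k
  proof -
    have "norm (f (k + 2)) \<le> ?a ^ (k + 2) / fact (k + 2)"
      unfolding f_def using abs_pow_entry_le[OF A ij, of "k+2"] by (simp add: divide_right_mono del: fact_Suc)
    also have "\<dots> \<le> ?a\<^sup>2 / fact k"
    proof (rule frac_le)
      have "?a ^ (k + 2) = ?a ^ k * ?a\<^sup>2" by (rule power_add)
      also have "\<dots> \<le> 1 * ?a\<^sup>2" using a by (intro mult_right_mono power_le_one) auto
      finally show "?a ^ (k + 2) \<le> ?a\<^sup>2" by simp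
    qed (auto intro: fact_mono simp del: fact_Suc)
    finally show ?thesis by simp
  qed
  have "norm (\<Sum>k. f (k + 2)) \<le> (\<Sum>k. ?a\<^sup>2 * (1 / fact k))"
    by (rule norm_suminf_le[OF bnd se])
  also have "\<dots> = ?a\<^sup>2 * exp 1"
    using summable_exp[of "1::real"] by (subst suminf_mult) (simp_all add: exp_def field_simps)
  also have "\<dots> \<le> ?a\<^sup>2 * 3" using exp_le by (intro mult_left_mono) auto
  finally show ?thesis using tl by simp
qed

lemma mat_exp_remainder:
  assumes A: "A \<in> carrier_mat d d" and a: "fro_norm A \<le> 1"
  shows "fro_norm (mat_exp A - 1\<^sub>m d - A) \<le> d * (3 * (fro_norm A)\<^sup>2)"
  using A by (intro fro_norm_le_entries mat_exp_remainder_entry a) auto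

lemma conj_perturbation:
  fixes A :: "real mat"
  assumes A: "A \<in> carrier_mat d d" and F: "F \<in> carrier_mat d d"
  shows "transpose_mat (1\<^sub>m d + F) * A * (1\<^sub>m d + F)
    = A + (A * F + (transpose_mat F * A + transpose_mat F * A * F))"
proof -
  have t: "transpose_mat (1\<^sub>m d + F) = 1\<^sub>m d + transpose_mat F"
    using F by (intro eq_matI) auto
  have "transpose_mat (1\<^sub>m d + F) * A = A + transpose_mat F * A"
    unfolding t using A F by (subst add_mult_distrib_mat[of _ d d _ _ d]) auto
  moreover have "(A + transpose_mat F * A) * (1\<^sub>m d + F)
      = (A + transpose_mat F * A) + (A + transpose_mat F * A) * F"
    using A F by (subst mult_add_distrib_mat[of _ d d _ d]) auto
  moreover have "(A + transpose_mat F * A) * F = A * F + transpose_mat F * A * F"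
    using A F by (subst add_mult_distrib_mat[of _ d d _ _ d]) auto
  ultimately show ?thesis using A F by (intro eq_matI) auto
qed

text \<open>With \<open>mat_exp Y = 1 + F\<close> and \<open>F = Y + R\<close>, the summand
  \<open>6 * real d\<close> collects the two terms linear in the remainder \<open>R\<close>, and the
  square comes from the quadratic term \<open>transpose_mat F * A * F\<close>.\<close>

definition exp_const :: "nat \<Rightarrow> real" where
  "exp_const d = 6 * real d + (1 + 3 * real d)\<^sup>2"

text \<open>Skewness turns the two first-order terms \<open>A * Y\<close> and
  \<open>transpose_mat Y * A\<close> into a commutator. All other terms contain \<open>R\<close> or
  two factors \<open>F\<close>, hence are of second order in \<open>Y\<close>.\<close>

lemma exp_conj_expansion:
  assumes A: "A \<in> carrier_mat d d" and Y: "Y \<in> carrier_mat d d" and skew: "transpose_mat Y = - Y"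
    and y: "fro_norm Y \<le> 1"
  shows "fro_norm (transpose_mat (mat_exp Y) * A * mat_exp Y - A - (A * Y - Y * A))
      \<le> exp_const d * fro_norm A * (fro_norm Y)\<^sup>2"
proof -
  define R where "R = mat_exp Y - 1\<^sub>m d - Y"
  define F where "F = Y + R"
  let ?y = "fro_norm Y" and ?a = "fro_norm A"
  have [simp]: "R \<in> carrier_mat d d" "F \<in> carrier_mat d d" using Y by (auto simp: R_def F_def)
  have R: "fro_norm R \<le> 3 * real d * ?y\<^sup>2"
    using mat_exp_remainder[OF Y y] by (simp add: R_def mult_ac)
  have y2: "?y\<^sup>2 \<le> ?y" using y mult_left_le[OF y, of ?y] by (simp add: power2_eq_square)
  have "fro_norm F \<le> ?y + 3 * real d * ?y\<^sup>2"
    using fro_norm_add[OF Y, of R] R by (simp add: F_def)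
  also have "\<dots> \<le> ?y + 3 * real d * ?y" using y2 by (intro add_left_mono mult_left_mono) auto
  finally have F: "fro_norm F \<le> (1 + 3 * real d) * ?y" by (simp add: algebra_simps)
  have E: "mat_exp Y = 1\<^sub>m d + F" using Y mat_exp_carrier[OF Y] by (intro eq_matI) (auto simp: F_def R_def)
  have AF: "A * F = A * Y + A * R"
    unfolding F_def using A Y by (intro mult_add_distrib_mat) auto
  have FA: "transpose_mat F * A = - (Y * A) + transpose_mat R * A"
  proof -
    have "transpose_mat F = - Y + transpose_mat R"
      unfolding F_def using Y by (subst transpose_add[of _ d d]) (auto simp: skew)
    then have "transpose_mat F * A = (- Y) * A + transpose_mat R * A"
      using A Y by (simp add: add_mult_distrib_mat[of _ d d _ _ d])
    then show ?thesis using A Y by simp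
  qed
  have FA': "transpose_mat F * A \<in> carrier_mat d d"
    by (rule mult_carrier_mat[OF _ A]) simp
  have RA: "transpose_mat R * A \<in> carrier_mat d d"
    by (rule mult_carrier_mat[OF _ A]) simp
  have eq: "transpose_mat (mat_exp Y) * A * mat_exp Y - A - (A * Y - Y * A)
      = (A * R + transpose_mat R * A) + transpose_mat F * A * F"
  proof -
    \<comment> \<open>Stated for arbitrary matrices, so that the entrywise check treats each product
      as one atom.\<close>
    have cancel: "A + (P + Q + ((- S + T) + W)) - A - (P - S) = (Q + T) + W"
      if "P \<in> carrier_mat d d" "Q \<in> carrier_mat d d" "S \<in> carrier_mat d d"
        "T \<in> carrier_mat d d" "W \<in> carrier_mat d d" for P Q S T W
      using A that by (intro eq_matI) auto
    have eq0: "transpose_mat (mat_exp Y) * A * mat_exp Y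
        = A + (A * Y + A * R + ((- (Y * A) + transpose_mat R * A) + transpose_mat F * A * F))"
      unfolding E conj_perturbation[OF A \<open>F \<in> carrier_mat d d\<close>] AF by (simp only: FA)

    show ?thesis unfolding eq0
      by (rule cancel[OF mult_carrier_mat[OF A Y] mult_carrier_mat[OF A \<open>R \<in> carrier_mat d d\<close>]
            mult_carrier_mat[OF Y A] RA mult_carrier_mat[OF FA' \<open>F \<in> carrier_mat d d\<close>]])
  qed
  have 1: "fro_norm (A * R) \<le> ?a * (3 * real d * ?y\<^sup>2)"
    using fro_norm_mult[OF A, of R d] R mult_left_mono[OF R, of ?a] by simp
  have 2: "fro_norm (transpose_mat R * A) \<le> (3 * real d * ?y\<^sup>2) * ?a"
    using fro_norm_mult[of "transpose_mat R" d d A d] A mult_right_mono[OF R, of ?a] by simp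
  have "fro_norm (transpose_mat F * A * F) \<le> fro_norm (transpose_mat F * A) * fro_norm F"
    by (rule fro_norm_mult[OF FA' \<open>F \<in> carrier_mat d d\<close>])
  also have "\<dots> \<le> (fro_norm F * ?a) * fro_norm F"
    using fro_norm_mult[of "transpose_mat F" d d A d] A by (intro mult_right_mono) auto
  also have "\<dots> = ?a * (fro_norm F)\<^sup>2" by (simp add: power2_eq_square)
  also have "\<dots> \<le> ?a * ((1 + 3 * real d) * ?y)\<^sup>2"
    using F by (intro mult_left_mono power_mono) auto
  finally have 3: "fro_norm (transpose_mat F * A * F) \<le> ?a * ((1 + 3 * real d) * ?y)\<^sup>2" .
  have "fro_norm ((A * R + transpose_mat R * A) + transpose_mat F * A * F)
      \<le> fro_norm (A * R) + fro_norm (transpose_mat R * A) + fro_norm (transpose_mat F * A * F)"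
    using fro_norm_add[OF add_carrier_mat[OF RA, of "A * R"] mult_carrier_mat[OF FA' \<open>F \<in> carrier_mat d d\<close>]]
      fro_norm_add[OF mult_carrier_mat[OF A \<open>R \<in> carrier_mat d d\<close>] RA] by linarith
  also have "\<dots> \<le> ?a * (3 * real d * ?y\<^sup>2) + (3 * real d * ?y\<^sup>2) * ?a + ?a * ((1 + 3 * real d) * ?y)\<^sup>2"
    using 1 2 3 by linarith
  also have "\<dots> = exp_const d * ?a * ?y\<^sup>2"
    unfolding exp_const_def power_mult_distrib by (simp add: algebra_simps)
  finally show ?thesis unfolding eq .
qed

text \<open>Only the order matters here: this is the cost of replacing \<open>A\<close> by its
  conjugate inside a commutator that already carries a factor \<open>\<alpha>\<close>.\<close>

lemma exp_conj_lipschitz: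
  assumes A: "A \<in> carrier_mat d d" and Y: "Y \<in> carrier_mat d d" and skew: "transpose_mat Y = - Y"
    and y: "fro_norm Y \<le> 1"
  shows "fro_norm (transpose_mat (mat_exp Y) * A * mat_exp Y - A)
      \<le> (2 + exp_const d) * fro_norm A * fro_norm Y"
proof -
  let ?Z = "transpose_mat (mat_exp Y) * A * mat_exp Y - A" and ?C = "A * Y - Y * A"
  let ?y = "fro_norm Y" and ?a = "fro_norm A"
  have c: "?Z \<in> carrier_mat d d" "?C \<in> carrier_mat d d" using A Y by auto
  have "?Z = (?Z - ?C) + ?C" using A Y by (intro eq_matI) (auto simp del: index_mult_mat(1))
  then have "fro_norm ?Z \<le> fro_norm (?Z - ?C) + fro_norm ?C"
    using fro_norm_add[of "?Z - ?C" d d ?C] c by (metis minus_carrier_mat)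
  moreover have "fro_norm ?C \<le> ?a * ?y + ?y * ?a"
    using fro_norm_diff[of "A * Y" d d "Y * A"] fro_norm_mult[OF A Y] fro_norm_mult[OF Y A]
      mult_carrier_mat[OF A Y] mult_carrier_mat[OF Y A] by linarith
  moreover have "exp_const d * ?a * ?y\<^sup>2 \<le> exp_const d * ?a * ?y"
    using y mult_left_le[OF y, of ?y] by (intro mult_left_mono) (auto simp: power2_eq_square exp_const_def)
  ultimately show ?thesis
    using exp_conj_expansion[OF assms] by (simp add: algebra_simps)
qed

section \<open>The commutator with an upper triangular matrix\<close>

text \<open>For \<open>j < i\<close>, upper triangularity of \<open>A\<close> leaves only
  \<open>k >= i > j\<close> in the first product and \<open>k <= j < i\<close> in the second, and
  there \<open>X\<close> and \<open>low X\<close> agree. The linear term thus depends on as many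
  unknowns as \<open>T_hat\<close> has columns.\<close>

lemma low_commutator:
  fixes A X :: "real mat"
  assumes A: "A \<in> carrier_mat d d" and up: "upper_triangular A" and X: "X \<in> carrier_mat d d"
    and diag: "\<And>i. i < d \<Longrightarrow> X $$ (i,i) = 0"
  shows "low (A * X - X * A) = low (A * low X - low X * A)"
proof (rule eq_matI)
  fix i j assume "i < dim_row (low (A * low X - low X * A))" "j < dim_col (low (A * low X - low X * A))"
  then have ij: "i < d" "j < d" using A X by auto
  note L = low_carrier[OF X]
  show "low (A * X - X * A) $$ (i,j) = low (A * low X - low X * A) $$ (i,j)"
  proof (cases "j < i")
    case True
    have "(\<Sum>k<d. A $$ (i,k) * X $$ (k,j)) = (\<Sum>k<d. A $$ (i,k) * low X $$ (k,j))"
    proof (intro sum.cong refl)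
      fix k assume "k \<in> {..<d}"
      then show "A $$ (i,k) * X $$ (k,j) = A $$ (i,k) * low X $$ (k,j)"
        using upper_triangularD[OF up, of k i] True ij A X by (cases "k < i") auto
    qed
    moreover have "(\<Sum>k<d. X $$ (i,k) * A $$ (k,j)) = (\<Sum>k<d. low X $$ (i,k) * A $$ (k,j))"
    proof (intro sum.cong refl)
      fix k assume "k \<in> {..<d}"
      then show "X $$ (i,k) * A $$ (k,j) = low X $$ (i,k) * A $$ (k,j)"
        using upper_triangularD[OF up, of j k] True ij A X by (cases "j < k") auto
    qed
    ultimately show ?thesis
      using ij True A X L
      by (simp add: mult_mat_entry[OF A X] mult_mat_entry[OF X A] mult_mat_entry[OF A L] mult_mat_entry[OF L A]
          del: index_mult_mat(1) low_index(1) add: low_def[of "_ - _"])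
  qed (use ij A X in auto)
qed (use A X in auto)

text \<open>The diagonal contributions are isolated as the pivot of the back substitution. For upper
  triangular \<open>A\<close> the other sums involve \<open>L\<close> only at \<open>(k,j)\<close>
  with \<open>k > i\<close> and at \<open>(i,k)\<close> with \<open>k < j\<close>, farther from the
  diagonal.\<close>

lemma commutator_diag_term:
  fixes A L :: "real mat"
  assumes A: "A \<in> carrier_mat d d" and L: "L \<in> carrier_mat d d" and i: "i < d" and j: "j < d"
  shows "(A $$ (i,i) - A $$ (j,j)) * L $$ (i,j) = (A * L - L * A) $$ (i,j)
    - (\<Sum>k\<in>{..<d}-{i}. A $$ (i,k) * L $$ (k,j)) + (\<Sum>k\<in>{..<d}-{j}. L $$ (i,k) * A $$ (k,j))"
proof -
  have "(A * L - L * A) $$ (i,j) = (\<Sum>k<d. A $$ (i,k) * L $$ (k,j)) - (\<Sum>k<d. L $$ (i,k) * A $$ (k,j))"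
    using mult_mat_entry[OF A L i j] mult_mat_entry[OF L A i j] A L i j by (simp del: index_mult_mat(1))
  moreover have "(\<Sum>k<d. A $$ (i,k) * L $$ (k,j))
      = A $$ (i,i) * L $$ (i,j) + (\<Sum>k\<in>{..<d}-{i}. A $$ (i,k) * L $$ (k,j))"
    using i by (intro sum.remove) auto
  moreover have "(\<Sum>k<d. L $$ (i,k) * A $$ (k,j))
      = L $$ (i,j) * A $$ (j,j) + (\<Sum>k\<in>{..<d}-{j}. L $$ (i,k) * A $$ (k,j))"
    using j by (intro sum.remove) auto
  ultimately show ?thesis by (simp add: algebra_simps)
qed

lemma abs_sum_le:
  fixes f :: "nat \<Rightarrow> real"
  assumes "\<And>k. k \<in> {..<d} - {i} \<Longrightarrow> \<bar>f k\<bar> \<le> M" "0 \<le> M"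
  shows "\<bar>\<Sum>k\<in>{..<d}-{i}. f k\<bar> \<le> real d * M"
proof -
  have "\<bar>\<Sum>k\<in>{..<d}-{i}. f k\<bar> \<le> (\<Sum>k\<in>{..<d}-{i}. \<bar>f k\<bar>)" by (rule sum_abs)
  also have "\<dots> \<le> real (card ({..<d} - {i})) * M"
    using assms(1) by (rule sum_bounded_above)
  also have "\<dots> \<le> real d * M"
    using card_mono[of "{..<d}" "{..<d} - {i}"] assms(2) by (intro mult_right_mono) auto
  finally show ?thesis .
qed

text \<open>The operator is triangular when the strictly lower entries are ordered by \<open>i - j\<close>, with the
  differences of diagonal entries on its diagonal; back substitution starts at the corner \<open>(d - 1, 0)\<close>.\<close>

lemma low_commutator_inverse_bound:
  fixes g B :: real
  assumes g: "g > 0" and B: "B \<ge> 0"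
  obtains K where "K > 0"
    "\<And>A L. A \<in> carrier_mat d d \<Longrightarrow> upper_triangular A \<Longrightarrow> fro_norm A \<le> B \<Longrightarrow>
      (\<And>i j. i < d \<Longrightarrow> j < d \<Longrightarrow> i \<noteq> j \<Longrightarrow> g \<le> \<bar>A $$ (i,i) - A $$ (j,j)\<bar>) \<Longrightarrow>
      L \<in> carrier_mat d d \<Longrightarrow> low L = L \<Longrightarrow>
      fro_norm L \<le> K * fro_norm (low (A * L - L * A))"
proof -
  define P where "P A L \<longleftrightarrow> A \<in> carrier_mat d d \<and> upper_triangular A \<and> fro_norm A \<le> B \<and>
      (\<forall>i<d. \<forall>j<d. i \<noteq> j \<longrightarrow> g \<le> \<bar>A $$ (i,i) - A $$ (j,j)\<bar>) \<and> L \<in> carrier_mat d d \<and> low L = L" for A L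
  \<comment> \<open>\<open>t\<close> counts the diagonals, starting at the corner, that are already
    under control: \<open>t = 0\<close> is vacuous and \<open>t = d\<close> covers every entry below
    the diagonal. \<open>K\<close> is chosen before \<open>A\<close> and \<open>L\<close>, hence
    uniform in them.\<close>
  have "\<exists>K\<ge>0. \<forall>A L i j. P A L \<and> j < i \<and> i < d \<and> d \<le> i - j + t \<longrightarrow>
      \<bar>L $$ (i,j)\<bar> \<le> K * fro_norm (low (A * L - L * A))" for t
  proof (induction t)
    case 0
    show ?case by (intro exI[of _ 0]) auto
  next
    case (Suc t)
    then obtain K where K0: "K \<ge> 0" and K: "\<And>A L i j. P A L \<Longrightarrow> j < i \<Longrightarrow> i < d \<Longrightarrow> d \<le> i - j + t \<Longrightarrow>
      \<bar>L $$ (i,j)\<bar> \<le> K * fro_norm (low (A * L - L * A))" by blast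
    \<comment> \<open>One unit for the commutator entry and \<open>real d * (B * K)\<close> for each
      of the two sums over entries treated before, all divided by the gap.\<close>
    define K' where "K' = (1 + 2 * (real d * (B * K))) / g"
    show ?case
    proof (intro exI[of _ K'] conjI allI impI)
      show "K' \<ge> 0" using K0 g B by (simp add: K'_def)
      fix A L i j assume asm: "P A L \<and> j < i \<and> i < d \<and> d \<le> i - j + Suc t"
      then have PAL: "P A L" and ji: "j < i" and id: "i < d" "j < d" and dt: "d \<le> i - j + Suc t" by auto
      then have A: "A \<in> carrier_mat d d" and up: "upper_triangular A" and AB: "fro_norm A \<le> B"
        and gap: "g \<le> \<bar>A $$ (i,i) - A $$ (j,j)\<bar>"
        and L: "L \<in> carrier_mat d d" and lL: "low L = L"
        by (auto simp: P_def)
      let ?e = "fro_norm (low (A * L - L * A))"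
      have entB: "\<bar>A $$ (a,b)\<bar> \<le> B" if "a < d" "b < d" for a b
        using abs_entry_le_fro_norm[of a A b] that A AB by auto
      have nn: "0 \<le> B * (K * ?e)" using B K0 by simp
      have t1: "\<bar>A $$ (i,k) * L $$ (k,j)\<bar> \<le> B * (K * ?e)" if "k \<in> {..<d} - {i}" for k
      proof (cases "k < i")
        case True
        then show ?thesis using upper_triangularD[OF up, of k i] id A K0 B by simp
      next
        case False
        then have "i < k" "k < d" using that by auto
        then show ?thesis using entB[of i k] K[OF PAL, of j k] ji dt id B
          by (simp add: abs_mult mult_mono')
      qed
      have s1: "\<bar>\<Sum>k\<in>{..<d}-{i}. A $$ (i,k) * L $$ (k,j)\<bar> \<le> real d * (B * (K * ?e))"
        by (rule abs_sum_le[OF t1 nn])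
      have t2: "\<bar>L $$ (i,k) * A $$ (k,j)\<bar> \<le> B * (K * ?e)" if "k \<in> {..<d} - {j}" for k
      proof (cases "j < k")
        case True
        then show ?thesis using upper_triangularD[OF up, of j k] that A K0 B by simp
      next
        case False
        then have "k < j" "k < d" using that by auto
        then show ?thesis using entB[of k j] K[OF PAL, of k i] ji dt id B
          by (simp add: abs_mult mult.commute[of "\<bar>L $$ _\<bar>"] mult_mono')
      qed
      have s2: "\<bar>\<Sum>k\<in>{..<d}-{j}. L $$ (i,k) * A $$ (k,j)\<bar> \<le> real d * (B * (K * ?e))"
        by (rule abs_sum_le[OF t2 nn])
      have c: "\<bar>(A * L - L * A) $$ (i,j)\<bar> \<le> ?e"
        using abs_entry_le_fro_norm[of i "low (A * L - L * A)" j] ji id A L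
        by (simp del: index_mult_mat(1) index_minus_mat(1))
      have "g * \<bar>L $$ (i,j)\<bar> \<le> \<bar>A $$ (i,i) - A $$ (j,j)\<bar> * \<bar>L $$ (i,j)\<bar>"
        using gap by (intro mult_right_mono) auto
      also have "\<dots> = \<bar>(A * L - L * A) $$ (i,j) - (\<Sum>k\<in>{..<d}-{i}. A $$ (i,k) * L $$ (k,j))
            + (\<Sum>k\<in>{..<d}-{j}. L $$ (i,k) * A $$ (k,j))\<bar>"
        using commutator_diag_term[OF A L id] by (simp add: abs_mult[symmetric])
      also have "\<dots> \<le> (1 + 2 * (real d * (B * K))) * ?e"
        using s1 s2 c by (simp add: algebra_simps)
      finally show "\<bar>L $$ (i,j)\<bar> \<le> K' * ?e"
        using g by (simp add: K'_def field_simps)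
    qed
  qed
  from this[of d] obtain K where K0: "K \<ge> 0" and K: "\<And>A L i j. P A L \<Longrightarrow> j < i \<Longrightarrow> i < d \<Longrightarrow>
      \<bar>L $$ (i,j)\<bar> \<le> K * fro_norm (low (A * L - L * A))" by auto
  show ?thesis
  proof (rule that[of "real d * K + 1"])
    show "real d * K + 1 > 0" using K0 by (simp add: add_nonneg_pos)
    fix A L
    assume A: "A \<in> carrier_mat d d" "upper_triangular A" "fro_norm A \<le> B"
      "\<And>i j. i < d \<Longrightarrow> j < d \<Longrightarrow> i \<noteq> j \<Longrightarrow> g \<le> \<bar>A $$ (i,i) - A $$ (j,j)\<bar>"
      and L: "L \<in> carrier_mat d d" "low L = L"
    then have P: "P A L" by (auto simp: P_def)
    let ?e = "fro_norm (low (A * L - L * A))"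
    have "\<bar>L $$ (i,j)\<bar> \<le> K * ?e" if "i < d" "j < d" for i j
    proof (cases "j < i")
      case True
      then show ?thesis using K[OF P] that by auto
    next
      case False
      then have "L $$ (i,j) = 0" using that L(1) low_index[of i L j] unfolding L(2) by auto
      then show ?thesis using K0 by simp
    qed
    then have "fro_norm L \<le> d * (K * ?e)"
      using K0 by (intro fro_norm_le_entries[OF L(1)]) auto
    also have "\<dots> \<le> (real d * K + 1) * ?e" by (simp add: algebra_simps)
    finally show "fro_norm L \<le> (real d * K + 1) * ?e" .
  qed
qed

section \<open>Diagonals of triangular matrices and separated eigenvalues\<close>

lemma set_diag_mat_eq_roots:
  fixes A :: "'a :: field mat"
  assumes A: "A \<in> carrier_mat d d" and up: "upper_triangular A"
  shows "set (diag_mat A) = {x. poly (char_poly A) x = 0}"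
  unfolding char_poly_upper_triangular[OF A up]
  by (auto simp: poly_prod_list prod_list_zero_iff)

text \<open>Similar matrices have the same characteristic polynomial, whose roots are the diagonal
  entries of a triangular matrix. This gives equality of sets only; since \<open>\<mu>\<close> takes
  \<open>d\<close> distinct values, counting excludes repetitions on the diagonal of
  \<open>A\<close>.\<close>

lemma upper_triangular_similar_diag:
  fixes A :: "'a :: field mat"
  assumes A: "A \<in> carrier_mat d d" and up: "upper_triangular A"
    and sim: "similar_mat A (mat_diag d \<mu>)" and inj: "inj_on \<mu> {..<d}"
  shows "inj_on (\<lambda>i. A $$ (i,i)) {..<d}" "(\<lambda>i. A $$ (i,i)) ` {..<d} = \<mu> ` {..<d}"
proof -
  have set: "set (diag_mat B) = (\<lambda>i. B $$ (i,i)) ` {..<d}" if "B \<in> carrier_mat d d" for B :: "'a mat"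
    using that by (auto simp: diag_mat_def)
  have D: "mat_diag d \<mu> \<in> carrier_mat d d" "upper_triangular (mat_diag d \<mu>)"
    by (auto simp: mat_diag_def intro!: upper_triangularI)
  have "set (diag_mat A) = set (diag_mat (mat_diag d \<mu>))"
    unfolding set_diag_mat_eq_roots[OF A up] set_diag_mat_eq_roots[OF D] char_poly_similar[OF sim] ..
  moreover have "set (diag_mat (mat_diag d \<mu>)) = \<mu> ` {..<d}"
    unfolding set[OF D(1)] by (auto simp: mat_diag_def)
  ultimately show im: "(\<lambda>i. A $$ (i,i)) ` {..<d} = \<mu> ` {..<d}"
    using set[OF A] by simp
  show "inj_on (\<lambda>i. A $$ (i,i)) {..<d}"
    using card_image[OF inj] im by (intro eq_card_imp_inj_on) auto
qed

text \<open>The weights are powers \<open>t ^ n\<close> of a single real number. For each pair of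
  indices the difference of the combined eigenvalues is a polynomial in \<open>t\<close>, nonzero by
  non-degeneracy, so only finitely many \<open>t\<close> are bad.\<close>

lemma generic_combination:
  fixes \<Lambda> :: "nat \<Rightarrow> nat \<Rightarrow> real"
  assumes nondeg: "\<forall>i<d. \<forall>i'<d. i \<noteq> i' \<longrightarrow> (\<exists>n\<in>{1..N}. \<Lambda> n i \<noteq> \<Lambda> n i')"
  obtains \<beta> :: "nat \<Rightarrow> real" where "inj_on (\<lambda>i. \<Sum>n\<in>{1..N}. \<beta> n * \<Lambda> n i) {..<d}"
proof -
  define p where "p i j = (\<Sum>n\<in>{1..N}. monom (\<Lambda> n i - \<Lambda> n j) n)" for i j
  have pz: "p i j \<noteq> 0" if ij: "i < d" "j < d" "i \<noteq> j" for i j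
  proof -
    obtain n where n: "n \<in> {1..N}" "\<Lambda> n i \<noteq> \<Lambda> n j" using nondeg ij by blast
    have "coeff (p i j) n = \<Lambda> n i - \<Lambda> n j"
      using n by (simp add: p_def coeff_sum)
    then show ?thesis using n by auto
  qed
  have "finite (\<Union>(i,j) \<in> {(i,j). i < d \<and> j < d \<and> i \<noteq> j}. {t. poly (p i j) t = 0})"
  proof (rule finite_UN_I)
    show "finite {(i,j). i < d \<and> j < d \<and> i \<noteq> j}"
      by (rule finite_subset[of _ "{..<d} \<times> {..<d}"]) auto
  qed (use pz in \<open>auto intro: poly_roots_finite\<close>)
  then obtain t where t: "t \<notin> (\<Union>(i,j) \<in> {(i,j). i < d \<and> j < d \<and> i \<noteq> j}. {t. poly (p i j) t = 0})"
    using ex_new_if_finite[OF infinite_UNIV_char_0] by blast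
  have "inj_on (\<lambda>i. \<Sum>n\<in>{1..N}. t ^ n * \<Lambda> n i) {..<d}"
  proof (rule inj_onI, rule ccontr)
    fix i j assume ij: "i \<in> {..<d}" "j \<in> {..<d}" "i \<noteq> j"
      and eq: "(\<Sum>n\<in>{1..N}. t ^ n * \<Lambda> n i) = (\<Sum>n\<in>{1..N}. t ^ n * \<Lambda> n j)"
    then have "poly (p i j) t = 0"
      by (simp add: p_def poly_sum poly_monom algebra_simps sum_subtractf)
    then show False using t ij by auto
  qed
  then show ?thesis by (rule that)
qed

lemma inj_on_gap:
  fixes \<mu> :: "nat \<Rightarrow> real"
  assumes "inj_on \<mu> {..<d}"
  obtains g where "g > 0" "\<And>x y. x \<in> \<mu> ` {..<d} \<Longrightarrow> y \<in> \<mu> ` {..<d} \<Longrightarrow> x \<noteq> y \<Longrightarrow> g \<le> \<bar>x - y\<bar>"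
proof -
  \<comment> \<open>The inserted 1 keeps the minimum defined when there are fewer than two
    values.\<close>
  define S where "S = insert 1 ((\<lambda>(x,y). \<bar>x - y\<bar>) ` {(x,y). x \<in> \<mu> ` {..<d} \<and> y \<in> \<mu> ` {..<d} \<and> x \<noteq> y})"
  have "finite {(x,y). x \<in> \<mu> ` {..<d} \<and> y \<in> \<mu> ` {..<d} \<and> x \<noteq> y}"
    by (rule finite_subset[of _ "\<mu> ` {..<d} \<times> \<mu> ` {..<d}"]) auto
  then have S: "finite S" "S \<noteq> {}" by (auto simp: S_def)
  show ?thesis
  proof (rule that)
    show "Min S > 0" using S by (subst Min_gr_iff) (auto simp: S_def)
    show "Min S \<le> \<bar>x - y\<bar>" if "x \<in> \<mu> ` {..<d}" "y \<in> \<mu> ` {..<d}" "x \<noteq> y" for x y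
      using S that by (intro Min_le) (auto simp: S_def)
  qed
qed

section \<open>Spectral norm and the matrix \<open>T_hat\<close>\<close>

lemma euc_norm_L2_set: "euc_norm v = L2_set (\<lambda>i. v $ i) {..<dim_vec v}"
  by (simp add: euc_norm_def L2_set_def)

lemma euc_norm_nonneg [simp]: "0 \<le> euc_norm v"
  by (simp add: euc_norm_L2_set L2_set_nonneg)

lemma euc_norm_sq_scalar_prod: "(euc_norm v)\<^sup>2 = v \<bullet> v"
  by (simp add: euc_norm_def sum_nonneg scalar_prod_def atLeast0LessThan power2_eq_square)

lemma euc_norm_zero [simp]: "euc_norm (0\<^sub>v n) = 0"
  by (simp add: euc_norm_def)

lemma euc_norm_eq_0D: "euc_norm v = 0 \<Longrightarrow> v = 0\<^sub>v (dim_vec v)"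
  by (auto simp: euc_norm_L2_set L2_set_eq_0_iff)

lemma euc_norm_smult: "euc_norm (a \<cdot>\<^sub>v v) = \<bar>a\<bar> * euc_norm v"
proof -
  have "euc_norm (a \<cdot>\<^sub>v v) = sqrt (a\<^sup>2 * (\<Sum>i<dim_vec v. (v $ i)\<^sup>2))"
    by (simp add: euc_norm_def power_mult_distrib sum_distrib_left)
  then show ?thesis by (simp add: euc_norm_def real_sqrt_mult)
qed

lemma scalar_prod_le_euc_norm:
  assumes "v \<in> carrier_vec n" "w \<in> carrier_vec n"
  shows "v \<bullet> w \<le> euc_norm v * euc_norm w"
proof -
  have "v \<bullet> w = (\<Sum>i<n. v $ i * w $ i)" using assms by (simp add: scalar_prod_def atLeast0LessThan)
  also have "\<dots> \<le> (\<Sum>i<n. \<bar>v $ i\<bar> * \<bar>w $ i\<bar>)" by (intro sum_mono) (simp add: abs_mult[symmetric])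
  also have "\<dots> \<le> euc_norm v * euc_norm w"
    using L2_set_mult_ineq[of "\<lambda>i. v $ i" "\<lambda>i. w $ i" "{..<n}"] assms by (simp add: euc_norm_L2_set)
  finally show ?thesis .
qed

lemma euc_norm_mult_vec_le_fro_norm:
  assumes A: "A \<in> carrier_mat r c" and v: "v \<in> carrier_vec c"
  shows "euc_norm (A *\<^sub>v v) \<le> fro_norm A * euc_norm v"
proof -
  have "(euc_norm (A *\<^sub>v v))\<^sup>2 = (\<Sum>i<r. (\<Sum>k<c. A $$ (i,k) * v $ k)\<^sup>2)"
    using A v by (simp add: euc_norm_def sum_nonneg scalar_prod_def atLeast0LessThan)
  also have "\<dots> \<le> (\<Sum>i<r. (\<Sum>k<c. (A $$ (i,k))\<^sup>2) * (\<Sum>k<c. (v $ k)\<^sup>2))"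
    by (intro sum_mono Cauchy_Schwarz_sum)
  also have "\<dots> = (fro_norm A * euc_norm v)\<^sup>2"
    using A v by (simp add: power_mult_distrib fro_norm_sq euc_norm_def sum_nonneg sum_distrib_right)
  finally show ?thesis by (simp add: abs_le_square_iff[symmetric])
qed

lemma euc_norm_le_spec_norm:
  assumes v: "v \<in> carrier_vec (dim_col A)"
  shows "euc_norm (A *\<^sub>v v) \<le> spec_norm A * euc_norm v"
proof (cases "euc_norm v = 0")
  case True
  then have "v = 0\<^sub>v (dim_col A)" using v euc_norm_eq_0D[of v] by simp
  then have "A *\<^sub>v v = 0\<^sub>v (dim_row A)" by (auto intro!: eq_vecI)
  then show ?thesis using True by simp
next
  case False
  let ?S = "{euc_norm (A *\<^sub>v v) | v. v \<in> carrier_vec (dim_col A) \<and> euc_norm v = 1}"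
  define u where "u = (1 / euc_norm v) \<cdot>\<^sub>v v"
  have u: "u \<in> carrier_vec (dim_col A)" "euc_norm u = 1" "v = euc_norm v \<cdot>\<^sub>v u"
    using v False by (auto simp: u_def euc_norm_smult smult_smult_assoc)
  \<comment> \<open>A real supremum says something only about a bounded set; the Frobenius norm
    supplies the bound.\<close>
  have "bdd_above ?S"
    by (rule bdd_aboveI[of _ "fro_norm A"])
      (use euc_norm_mult_vec_le_fro_norm[of A "dim_row A" "dim_col A"] in fastforce)
  then have "euc_norm (A *\<^sub>v u) \<le> spec_norm A"
    unfolding spec_norm_def using u by (intro cSup_upper) auto
  then have "euc_norm v * euc_norm (A *\<^sub>v u) \<le> euc_norm v * spec_norm A"
    by (intro mult_left_mono) auto
  moreover have "A *\<^sub>v v = euc_norm v \<cdot>\<^sub>v (A *\<^sub>v u)"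
    using u mult_mat_vec[of A "dim_row A" "dim_col A" u] by (metis carrier_matI)
  ultimately show ?thesis by (simp add: euc_norm_smult mult.commute)
qed

text \<open>A unit vector to compare with exists once there is a column; otherwise the supremum
  ranges over the empty set.\<close>

lemma spec_norm_nonneg:
  assumes "dim_col A > 0"
  shows "0 \<le> spec_norm A"
proof -
  have "euc_norm (unit_vec (dim_col A) 0) = 1"
  proof -
    have "(euc_norm (unit_vec (dim_col A) 0))\<^sup>2 = 1"
      unfolding euc_norm_sq_scalar_prod using assms by simp
    then show ?thesis by (simp add: power2_eq_1_iff) (smt (verit) euc_norm_nonneg)
  qed
  then have "euc_norm (A *\<^sub>v unit_vec (dim_col A) 0) \<le> spec_norm A"
    using euc_norm_le_spec_norm[of "unit_vec (dim_col A) 0" A] by simp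
  then show ?thesis using euc_norm_nonneg order_trans by blast
qed

text \<open>For \<open>w = transpose_mat A *\<^sub>v v\<close>, the square of the norm of
  \<open>w\<close> is the inner product of \<open>v\<close> and \<open>A *\<^sub>v w\<close>.
  Cauchy-Schwarz and the bound for \<open>A\<close> give the claim times the norm of
  \<open>w\<close>, which cancels.\<close>

lemma euc_norm_transpose_le_spec_norm:
  assumes A: "A \<in> carrier_mat r c" and c: "c > 0" and v: "v \<in> carrier_vec r"
  shows "euc_norm (transpose_mat A *\<^sub>v v) \<le> spec_norm A * euc_norm v"
proof -
  let ?w = "transpose_mat A *\<^sub>v v"
  have w: "?w \<in> carrier_vec c" using A by (simp add: carrier_vecI)
  have Aw: "A *\<^sub>v ?w \<in> carrier_vec r" using A by (simp add: carrier_vecI)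
  have "euc_norm ?w * euc_norm ?w = ?w \<bullet> ?w"
    using euc_norm_sq_scalar_prod[of ?w] by (simp add: power2_eq_square)
  also have "\<dots> = v \<bullet> (A *\<^sub>v ?w)"
    using transpose_vec_mult_scalar[OF A w v] Aw v
    by (metis comm_scalar_prod mult_mat_vec_carrier A transpose_carrier_mat)
  also have "\<dots> \<le> euc_norm v * euc_norm (A *\<^sub>v ?w)"
    by (rule scalar_prod_le_euc_norm[OF v Aw])
  also have "\<dots> \<le> euc_norm v * (spec_norm A * euc_norm ?w)"
    using euc_norm_le_spec_norm[of ?w A] w A by (intro mult_left_mono) auto
  finally have le: "euc_norm ?w * euc_norm ?w \<le> (spec_norm A * euc_norm v) * euc_norm ?w"
    by (simp add: mult_ac)
  show ?thesis
  proof (cases "euc_norm ?w = 0")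
    case True
    then show ?thesis using spec_norm_nonneg[of A] A c by simp
  next
    case False
    then have "euc_norm ?w > 0" using euc_norm_nonneg[of ?w] by linarith
    then show ?thesis using le by simp
  qed
qed

section \<open>Linear combinations of a family of matrices\<close>

definition mat_comb :: "nat \<Rightarrow> nat \<Rightarrow> (nat \<Rightarrow> real) \<Rightarrow> (nat \<Rightarrow> real mat) \<Rightarrow> real mat" where
  "mat_comb d N \<beta> F = mat d d (\<lambda>ij. \<Sum>n\<in>{1..N}. \<beta> n * F n $$ ij)"

lemma mat_comb_carrier [simp]: "mat_comb d N \<beta> F \<in> carrier_mat d d"
  by (simp add: mat_comb_def)

lemma mat_comb_dim [simp]: "dim_row (mat_comb d N \<beta> F) = d" "dim_col (mat_comb d N \<beta> F) = d"
  by (simp_all add: mat_comb_def)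

lemma mat_comb_index [simp]:
  "i < d \<Longrightarrow> j < d \<Longrightarrow> mat_comb d N \<beta> F $$ (i,j) = (\<Sum>n\<in>{1..N}. \<beta> n * F n $$ (i,j))"
  by (simp add: mat_comb_def)

lemma mat_comb_cong:
  "(\<And>n. n \<in> {1..N} \<Longrightarrow> F n = G n) \<Longrightarrow> mat_comb d N \<beta> F = mat_comb d N \<beta> G"
  by (simp add: mat_comb_def)

lemma low_mat_comb:
  assumes "\<And>n. n \<in> {1..N} \<Longrightarrow> F n \<in> carrier_mat d d"
  shows "low (mat_comb d N \<beta> F) = mat_comb d N \<beta> (\<lambda>n. low (F n))"
proof (rule eq_matI)
  fix i j assume "i < dim_row (mat_comb d N \<beta> (\<lambda>n. low (F n)))" "j < dim_col (mat_comb d N \<beta> (\<lambda>n. low (F n)))"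
  then have ij: "i < d" "j < d" by auto
  then have "low (F n) $$ (i,j) = (if j < i then F n $$ (i,j) else 0)" if "n \<in> {1..N}" for n
    using assms[OF that] by simp
  then show "low (mat_comb d N \<beta> F) $$ (i,j) = mat_comb d N \<beta> (\<lambda>n. low (F n)) $$ (i,j)"
    using ij by simp
qed auto

lemma mult_mat_comb:
  assumes P: "P \<in> carrier_mat d d" and F: "\<And>n. n \<in> {1..N} \<Longrightarrow> F n \<in> carrier_mat d d"
  shows "P * mat_comb d N \<beta> F = mat_comb d N \<beta> (\<lambda>n. P * F n)"
proof (rule eq_matI)
  fix i j assume "i < dim_row (mat_comb d N \<beta> (\<lambda>n. P * F n))" "j < dim_col (mat_comb d N \<beta> (\<lambda>n. P * F n))"
  then have ij: "i < d" "j < d" by auto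
  have "(P * mat_comb d N \<beta> F) $$ (i,j) = (\<Sum>k<d. \<Sum>n\<in>{1..N}. \<beta> n * (P $$ (i,k) * F n $$ (k,j)))"
    using ij by (simp add: mult_mat_entry[OF P mat_comb_carrier ij] sum_distrib_left mult_ac del: index_mult_mat(1))
  also have "\<dots> = (\<Sum>n\<in>{1..N}. \<beta> n * (P * F n) $$ (i,j))"
    by (subst sum.swap) (intro sum.cong refl, simp add: mult_mat_entry[OF P F ij] sum_distrib_left del: index_mult_mat(1))
  finally show "(P * mat_comb d N \<beta> F) $$ (i,j) = mat_comb d N \<beta> (\<lambda>n. P * F n) $$ (i,j)"
    using ij by simp
qed (use P in auto)

lemma mat_comb_mult:
  assumes P: "P \<in> carrier_mat d d" and F: "\<And>n. n \<in> {1..N} \<Longrightarrow> F n \<in> carrier_mat d d"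
  shows "mat_comb d N \<beta> F * P = mat_comb d N \<beta> (\<lambda>n. F n * P)"
proof (rule eq_matI)
  fix i j assume "i < dim_row (mat_comb d N \<beta> (\<lambda>n. F n * P))" "j < dim_col (mat_comb d N \<beta> (\<lambda>n. F n * P))"
  then have ij: "i < d" "j < d" by auto
  have "(mat_comb d N \<beta> F * P) $$ (i,j) = (\<Sum>k<d. \<Sum>n\<in>{1..N}. \<beta> n * (F n $$ (i,k) * P $$ (k,j)))"
    using ij by (simp add: mult_mat_entry[OF mat_comb_carrier P ij] sum_distrib_left sum_distrib_right mult_ac del: index_mult_mat(1))
  also have "\<dots> = (\<Sum>n\<in>{1..N}. \<beta> n * (F n * P) $$ (i,j))"
    by (subst sum.swap) (intro sum.cong refl, simp add: mult_mat_entry[OF F P ij] sum_distrib_left del: index_mult_mat(1))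
  finally show "(mat_comb d N \<beta> F * P) $$ (i,j) = mat_comb d N \<beta> (\<lambda>n. F n * P) $$ (i,j)"
    using ij by simp
qed (use P in auto)

lemma commutator_mat_comb:
  assumes L: "L \<in> carrier_mat d d" and F: "\<And>n. n \<in> {1..N} \<Longrightarrow> F n \<in> carrier_mat d d"
  shows "mat_comb d N \<beta> F * L - L * mat_comb d N \<beta> F = mat_comb d N \<beta> (\<lambda>n. F n * L - L * F n)"
proof -
  have entry: "(F n * L - L * F n) $$ (i,j) = (F n * L) $$ (i,j) - (L * F n) $$ (i,j)"
    if "n \<in> {1..N}" "i < d" "j < d" for n i j
    using F[OF that(1)] L that by (intro index_minus_mat) auto
  have "mat_comb d N \<beta> (\<lambda>n. F n * L) - mat_comb d N \<beta> (\<lambda>n. L * F n)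
      = mat_comb d N \<beta> (\<lambda>n. F n * L - L * F n)" (is "?l = ?r")
  proof (rule eq_matI)
    fix i j assume "i < dim_row ?r" "j < dim_col ?r"
    then have ij: "i < d" "j < d" by auto
    have "?r $$ (i,j) = (\<Sum>n\<in>{1..N}. \<beta> n * ((F n * L) $$ (i,j) - (L * F n) $$ (i,j)))"
      unfolding mat_comb_index[OF ij] using entry[OF _ ij] by (intro sum.cong refl) simp
    also have "\<dots> = ?l $$ (i,j)"
      using ij by (simp add: sum_subtractf right_diff_distrib del: index_mult_mat(1))
    finally show "?l $$ (i,j) = ?r $$ (i,j)" ..
  qed auto
  then show ?thesis by (simp only: mult_mat_comb[OF L F] mat_comb_mult[OF L F])
qed

lemma L2_set_sum_le: "L2_set (\<lambda>i. \<Sum>n\<in>S. f n i) A \<le> (\<Sum>n\<in>S. L2_set (f n) A)"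
proof (induction S rule: infinite_finite_induct)
  case (insert x S)
  then show ?case
    using L2_set_triangle_ineq[of "f x" "\<lambda>i. \<Sum>n\<in>S. f n i" A] by simp
qed (auto simp: L2_set_def)

lemma fro_norm_mat_comb_le:
  assumes F: "\<And>n. n \<in> {1..N} \<Longrightarrow> F n \<in> carrier_mat d d"
  shows "fro_norm (mat_comb d N \<beta> F) \<le> (\<Sum>n\<in>{1..N}. \<bar>\<beta> n\<bar> * fro_norm (F n))"
proof -
  have "fro_norm (mat_comb d N \<beta> F) = L2_set (\<lambda>p. \<Sum>n\<in>{1..N}. \<beta> n * F n $$ p) ({..<d} \<times> {..<d})"
    by (auto simp: fro_norm_L2_set intro!: L2_set_cong)
  also have "\<dots> \<le> (\<Sum>n\<in>{1..N}. L2_set (\<lambda>p. \<beta> n * F n $$ p) ({..<d} \<times> {..<d}))"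
    by (rule L2_set_sum_le)
  also have "\<dots> = (\<Sum>n\<in>{1..N}. \<bar>\<beta> n\<bar> * fro_norm (F n))"
  proof (intro sum.cong refl)
    fix n assume "n \<in> {1..N}"
    then have "L2_set (\<lambda>p. \<beta> n * F n $$ p) ({..<d} \<times> {..<d}) = fro_norm (\<beta> n \<cdot>\<^sub>m F n)"
      using F[of n] by (auto simp: fro_norm_L2_set intro!: L2_set_cong)
    then show "L2_set (\<lambda>p. \<beta> n * F n $$ p) ({..<d} \<times> {..<d}) = \<bar>\<beta> n\<bar> * fro_norm (F n)" by simp
  qed
  finally show ?thesis .
qed

lemma fro_norm_low_mat_comb_le:
  assumes F: "\<And>n. n \<in> {1..N} \<Longrightarrow> F n \<in> carrier_mat d d"
  shows "fro_norm (low (mat_comb d N \<beta> F)) \<le> (\<Sum>n\<in>{1..N}. \<bar>\<beta> n\<bar> * fro_norm (low (F n)))"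
  using low_mat_comb[OF F] fro_norm_mat_comb_le[of N "\<lambda>n. low (F n)" d \<beta>] F by simp

section \<open>Vectorization of the strictly lower part and the entries of
  \<open>T_hat\<close>\<close>

lemma set_low_positions: "set (low_positions d) = (\<lambda>(i,j). j * d + i) ` (SIGMA i:{..<d}. {..<i})"
  and low_positions_inj: "inj_on (\<lambda>(i,j). j * d + i) (SIGMA i:{..<d}. {..<i})"
  and distinct_low_positions: "distinct (low_positions d)"
  and length_low_positions: "length (low_positions d) = d * (d - 1) div 2"
proof -
  have eq: "{j * d + i | i j. j < i \<and> i < d} = (\<lambda>(i,j). j * d + i) ` (SIGMA i:{..<d}. {..<i})"
    by (auto simp: image_iff)
  have fin: "finite {j * d + i | i j. j < i \<and> i < d}" unfolding eq by auto
  show s: "set (low_positions d) = (\<lambda>(i,j). j * d + i) ` (SIGMA i:{..<d}. {..<i})"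
    unfolding low_positions_def using fin eq by simp
  show inj: "inj_on (\<lambda>(i,j). j * d + i) (SIGMA i:{..<d}. {..<i})"
  proof (rule inj_onI, clarsimp)
    fix i j i' j' :: nat
    assume "i < d" "j < i" "i' < d" "j' < i'" and e: "j * d + i = j' * d + i'"
    \<comment> \<open>The row index is below \<open>d\<close>, so \<open>mod\<close> and
      \<open>div\<close> recover the row and the column from a position.\<close>
    then have "(j * d + i) mod d = (j' * d + i') mod d" "(j * d + i) div d = (j' * d + i') div d" by simp_all
    then show "i = i' \<and> j = j'" using \<open>i < d\<close> \<open>i' < d\<close> by simp
  qed
  show "distinct (low_positions d)" by (simp add: low_positions_def)
  then have "length (low_positions d) = card (set (low_positions d))" by (simp add: distinct_card)
  also have "\<dots> = (\<Sum>i<d. i)" unfolding s card_image[OF inj] by simp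
  also have "\<dots> = d * (d - 1) div 2"
    using Sum_Ico_nat[of 0 d] by (simp add: atLeast0LessThan)
  finally show "length (low_positions d) = d * (d - 1) div 2" .
qed

lemma low_positions_nth:
  assumes "k < d * (d - 1) div 2"
  shows "low_positions d ! k mod d < d" "low_positions d ! k div d < low_positions d ! k mod d"
    "low_positions d ! k < d * d"
proof -
  have "low_positions d ! k \<in> set (low_positions d)" using assms length_low_positions[of d] by simp
  then obtain i j where ij: "j < i" "i < d" and e: "low_positions d ! k = j * d + i"
    unfolding set_low_positions by auto
  have "Suc j * d \<le> d * d" using ij by (intro mult_right_mono) auto
  then show "low_positions d ! k mod d < d" "low_positions d ! k div d < low_positions d ! k mod d"
    "low_positions d ! k < d * d" using ij by (simp_all add: e)
qed

text \<open>The enumeration order disappears: a sum over list positions becomes a sum over the lower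
  triangle. Both the norm of \<open>vec_low\<close> and the action of \<open>T_hat\<close> are
  computed this way.\<close>

lemma sum_low_positions:
  fixes f :: "nat \<Rightarrow> real"
  shows "(\<Sum>k<d * (d - 1) div 2. f (low_positions d ! k)) = (\<Sum>i<d. \<Sum>j<i. f (j * d + i))"
proof -
  have "(\<Sum>k<d * (d - 1) div 2. f (low_positions d ! k)) = sum_list (map f (low_positions d))"
    unfolding length_low_positions[symmetric] by (simp add: sum_list_sum_nth atLeast0LessThan)
  also have "\<dots> = sum f (set (low_positions d))"
    using distinct_low_positions by (simp add: sum_list_distinct_conv_sum_set)
  also have "\<dots> = (\<Sum>(i,j) \<in> (SIGMA i:{..<d}. {..<i}). f (j * d + i))"
    unfolding set_low_positions sum.reindex[OF low_positions_inj] by (simp add: case_prod_unfold)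
  also have "\<dots> = (\<Sum>i<d. \<Sum>j<i. f (j * d + i))" by (simp add: sum.Sigma)
  finally show ?thesis .
qed

text \<open>The composition of \<open>P_low\<close> with column-wise vectorization.\<close>

definition vec_low :: "nat \<Rightarrow> real mat \<Rightarrow> real vec" where
  "vec_low d A = vec (d * (d - 1) div 2) (\<lambda>k. A $$ (low_positions d ! k mod d, low_positions d ! k div d))"

lemma vec_low_carrier [simp]: "vec_low d A \<in> carrier_vec (d * (d - 1) div 2)"
  by (simp add: vec_low_def)

text \<open>An isometry, through which the spectral norm, defined by vectors, controls Frobenius
  norms of strictly lower parts.\<close>

lemma euc_norm_vec_low:
  assumes A: "A \<in> carrier_mat d d"
  shows "euc_norm (vec_low d A) = fro_norm (low A)"
proof -
  have "(\<Sum>k<d * (d - 1) div 2. (A $$ (low_positions d ! k mod d, low_positions d ! k div d))\<^sup>2)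
      = (\<Sum>i<d. \<Sum>j<i. (A $$ (i,j))\<^sup>2)"
    unfolding sum_low_positions[of "\<lambda>p. (A $$ (p mod d, p div d))\<^sup>2"]
    by (intro sum.cong refl) auto
  also have "\<dots> = (\<Sum>i<d. \<Sum>j<d. (low A $$ (i,j))\<^sup>2)"
  proof (rule sum.cong[OF refl])
    fix i assume i: "i \<in> {..<d}"
    have "(\<Sum>j<d. (low A $$ (i,j))\<^sup>2) = (\<Sum>j<i. (low A $$ (i,j))\<^sup>2)"
      using i A by (intro sum.mono_neutral_right) auto
    then show "(\<Sum>j<i. (A $$ (i,j))\<^sup>2) = (\<Sum>j<d. (low A $$ (i,j))\<^sup>2)" using i A by simp
  qed
  finally show ?thesis using A by (simp add: euc_norm_def vec_low_def fro_norm_def)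
qed

text \<open>Each row of \<open>P_low\<close> contains a single 1, so this two-sided product extracts
  a submatrix.\<close>

lemma P_low_conj_index:
  assumes K: "K \<in> carrier_mat (d * d) (d * d)" and k: "k < d * (d - 1) div 2" and l: "l < d * (d - 1) div 2"
  shows "(P_low d * K * transpose_mat (P_low d)) $$ (k,l) = K $$ (low_positions d ! k, low_positions d ! l)"
proof -
  let ?m = "d * (d - 1) div 2"
  have P: "P_low d \<in> carrier_mat ?m (d * d)" by (simp add: P_low_def)
  have PK: "(P_low d * K) $$ (k,q) = K $$ (low_positions d ! k, q)" if "q < d * d" for q
    unfolding mult_mat_entry[OF P K k that] using low_positions_nth(3)[OF k] k
    by (simp add: P_low_def if_distrib[of "\<lambda>x. x * _"] cong: if_cong)
  have "(P_low d * K * transpose_mat (P_low d)) $$ (k,l)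
      = (\<Sum>q<d*d. (P_low d * K) $$ (k,q) * transpose_mat (P_low d) $$ (q,l))"
    using P K k l by (intro mult_mat_entry) auto
  also have "\<dots> = (\<Sum>q<d*d. if q = low_positions d ! l then K $$ (low_positions d ! k, q) else 0)"
  proof (intro sum.cong refl)
    fix q assume "q \<in> {..<d*d}"
    then show "(P_low d * K) $$ (k,q) * transpose_mat (P_low d) $$ (q,l)
        = (if q = low_positions d ! l then K $$ (low_positions d ! k, q) else 0)"
      using PK[of q] l by (simp add: P_low_def)
  qed
  also have "\<dots> = K $$ (low_positions d ! k, low_positions d ! l)"
    using low_positions_nth(3)[OF l] by simp
  finally show ?thesis .
qed

lemma foldr_add_mat:
  fixes F :: "'b \<Rightarrow> real mat"
  assumes "\<And>n. n \<in> set xs \<Longrightarrow> F n \<in> carrier_mat r c"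
  shows "foldr (\<lambda>n acc. acc + F n) xs (0\<^sub>m r c)
    = mat r c (\<lambda>ij. \<Sum>n\<leftarrow>xs. F n $$ ij)"
  using assms
proof (induction xs)
  case (Cons x xs)
  then have "dim_row (F x) = r" "dim_col (F x) = c" by auto
  with Cons show ?case by (intro eq_matI) auto
qed auto

text \<open>In a position, \<open>div d\<close> is the column and \<open>mod d\<close> the row of
  the matrix entry. The identity factor of a Kronecker product forces one of them to agree: the
  column where it stands on the left, the row where it stands on the right.\<close>

lemma T_hat_carrier_index:
  assumes Mh: "\<And>n. n \<in> {1..N} \<Longrightarrow> Mh n \<in> carrier_mat d d" and U: "U \<in> carrier_mat d d"
  defines "A \<equiv> \<lambda>n. transpose_mat U * Mh n * U" and "m \<equiv> d * (d - 1) div 2"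
  shows "T_hat d N \<beta> Mh U \<in> carrier_mat m m"
    and "k < m \<Longrightarrow> l < m \<Longrightarrow> T_hat d N \<beta> Mh U $$ (k,l) = (\<Sum>n\<in>{1..N}. \<beta> n *
      ((if low_positions d ! k div d = low_positions d ! l div d
          then A n $$ (low_positions d ! l mod d, low_positions d ! k mod d) else 0)
       - (if low_positions d ! k mod d = low_positions d ! l mod d
          then A n $$ (low_positions d ! k div d, low_positions d ! l div d) else 0)))"
proof -
  define K where "K n = kron (1\<^sub>m d) (transpose_mat U * transpose_mat (Mh n) * U) - kron (A n) (1\<^sub>m d)" for n
  define F where "F n = \<beta> n \<cdot>\<^sub>m (P_low d * K n * transpose_mat (P_low d))" for n
  have A: "A n \<in> carrier_mat d d" if "n \<in> {1..N}" for n using Mh[OF that] U by (auto simp: A_def)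
  \<comment> \<open>Hence the first Kronecker term carries the transpose of \<open>A n\<close>,
    which explains the swapped indices in the entry formula.\<close>
  have AT: "transpose_mat U * transpose_mat (Mh n) * U = transpose_mat (A n)" if "n \<in> {1..N}" for n
  proof -
    have "transpose_mat (A n) = transpose_mat U * (transpose_mat (Mh n) * U)"
      unfolding A_def using Mh[OF that] U by (simp add: transpose_mult[of _ d d _ d])
    then show ?thesis using Mh[OF that] U by (simp add: assoc_mult_mat[of _ d d _ d _ d])
  qed
  have Kc: "K n \<in> carrier_mat (d*d) (d*d)" if "n \<in> {1..N}" for n
    using A[OF that] U by (auto simp: K_def kron_def)
  have Kidx: "K n $$ (p,q) = (if p div d = q div d then A n $$ (q mod d, p mod d) else 0)
      - (if p mod d = q mod d then A n $$ (p div d, q div d) else 0)"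
    if n: "n \<in> {1..N}" and p: "p < d * d" and q: "q < d * d" for n p q
  proof -
    have "d > 0" using p by (cases d) auto
    then have "p mod d < d" "q mod d < d" "p div d < d" "q div d < d"
      using p q by (auto simp: less_mult_imp_div_less)
    then show ?thesis
      unfolding K_def AT[OF n] using A[OF n] p q by (auto simp: kron_def)
  qed
  have T: "T_hat d N \<beta> Mh U = foldr (\<lambda>n acc. acc + F n) [1..<N+1] (0\<^sub>m m m)"
    by (simp add: T_hat_def Let_def F_def K_def A_def m_def)
  have Fc: "F n \<in> carrier_mat m m" for n by (auto simp: F_def P_low_def m_def)
  show "T_hat d N \<beta> Mh U \<in> carrier_mat m m" unfolding T foldr_add_mat[OF Fc] by simp
  assume kl: "k < m" "l < m"
  have "T_hat d N \<beta> Mh U $$ (k,l) = (\<Sum>n\<leftarrow>[1..<N+1]. F n $$ (k,l))"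
    unfolding T foldr_add_mat[OF Fc] using kl by simp
  also have "\<dots> = (\<Sum>n\<in>{1..N}. F n $$ (k,l))"
    unfolding interv_sum_list_conv_sum_set_nat by (intro sum.cong) auto
  also have "\<dots> = (\<Sum>n\<in>{1..N}. \<beta> n * K n $$ (low_positions d ! k, low_positions d ! l))"
  proof (intro sum.cong refl)
    fix n assume n: "n \<in> {1..N}"
    have "F n $$ (k,l) = \<beta> n * (P_low d * K n * transpose_mat (P_low d)) $$ (k,l)"
      unfolding F_def using kl by (intro index_smult_mat) (auto simp: P_low_def m_def)
    then show "F n $$ (k,l) = \<beta> n * K n $$ (low_positions d ! k, low_positions d ! l)"
      using P_low_conj_index[OF Kc[OF n]] kl by (simp add: m_def)
  qed
  finally show "T_hat d N \<beta> Mh U $$ (k,l) = (\<Sum>n\<in>{1..N}. \<beta> n *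
      ((if low_positions d ! k div d = low_positions d ! l div d
          then A n $$ (low_positions d ! l mod d, low_positions d ! k mod d) else 0)
       - (if low_positions d ! k mod d = low_positions d ! l mod d
          then A n $$ (low_positions d ! k div d, low_positions d ! l div d) else 0)))"
    using Kidx low_positions_nth(3) kl by (simp add: m_def)
qed

text \<open>It is the transpose of \<open>T_hat\<close>, not \<open>T_hat\<close> itself, that represents the linearized map
  \<open>L \<mapsto> low (A L - L A)\<close>; both have inverses of the same spectral norm.\<close>

lemma T_hat_transpose_mult_vec_low:
  assumes Mh: "\<And>n. n \<in> {1..N} \<Longrightarrow> Mh n \<in> carrier_mat d d" and U: "U \<in> carrier_mat d d"
    and L: "L \<in> carrier_mat d d" and lL: "low L = L"
  defines "A \<equiv> \<lambda>n. transpose_mat U * Mh n * U"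
  shows "transpose_mat (T_hat d N \<beta> Mh U) *\<^sub>v vec_low d L
    = vec_low d (mat_comb d N \<beta> (\<lambda>n. A n * L - L * A n))"
proof (rule eq_vecI)
  let ?m = "d * (d - 1) div 2" and ?T = "T_hat d N \<beta> Mh U" and ?p = "\<lambda>k. low_positions d ! k"
  have T: "?T \<in> carrier_mat ?m ?m" by (rule T_hat_carrier_index(1)[OF Mh U])

  have A: "A n \<in> carrier_mat d d" if "n \<in> {1..N}" for n using Mh[OF that] U by (auto simp: A_def)
  show "dim_vec (transpose_mat ?T *\<^sub>v vec_low d L) = dim_vec (vec_low d (mat_comb d N \<beta> (\<lambda>n. A n * L - L * A n)))"
    using T by (simp add: vec_low_def)
  fix l assume "l < dim_vec (vec_low d (mat_comb d N \<beta> (\<lambda>n. A n * L - L * A n)))"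
  then have l: "l < ?m" by (simp add: vec_low_def)
  define i' j' where "i' = ?p l mod d" and "j' = ?p l div d"
  have ij': "i' < d" "j' < d" using low_positions_nth[OF l] by (auto simp: i'_def j'_def)
  \<comment> \<open>The \<open>n\<close>-th term of the entry of \<open>T_hat\<close> in the row of
    position \<open>p\<close> and in column \<open>l\<close>, times the entry of \<open>L\<close> at
    \<open>p\<close>.\<close>
  define G where "G n p = ((if p div d = j' then A n $$ (i', p mod d) else 0)
       - (if p mod d = i' then A n $$ (p div d, j') else 0)) * L $$ (p mod d, p div d)" for n p
  have Gsum: "(\<Sum>i<d. \<Sum>j<i. G n (j * d + i)) = (A n * L - L * A n) $$ (i',j')" if n: "n \<in> {1..N}" for n
  proof -
    define H where "H i j = ((if j = j' then A n $$ (i', i) else 0)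
       - (if i = i' then A n $$ (j, j') else 0)) * L $$ (i, j)" for i j
    have L0: "L $$ (i,j) = 0" if "i < d" "j < d" "\<not> j < i" for i j
      using low_index[of i L j] that L unfolding lL by auto
    have "(\<Sum>i<d. \<Sum>j<i. G n (j * d + i)) = (\<Sum>i<d. \<Sum>j<i. H i j)"
      by (intro sum.cong refl) (auto simp: G_def H_def)
    \<comment> \<open>\<open>L\<close> vanishes on and above the diagonal, so the sum may run over
      all columns and become a matrix product.\<close>
    also have "\<dots> = (\<Sum>i<d. \<Sum>j<d. H i j)"
      using L0 by (intro sum.cong refl sum.mono_neutral_left) (auto simp: H_def)
    also have "\<dots> = (\<Sum>i<d. \<Sum>j<d. if j = j' then A n $$ (i', i) * L $$ (i, j) else 0)
        - (\<Sum>i<d. \<Sum>j<d. if i = i' then L $$ (i, j) * A n $$ (j, j') else 0)"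
      unfolding sum_subtractf[symmetric] by (intro sum.cong refl) (auto simp: H_def algebra_simps)
    also have "(\<Sum>i<d. \<Sum>j<d. if j = j' then A n $$ (i', i) * L $$ (i, j) else 0) = (A n * L) $$ (i',j')"
      unfolding mult_mat_entry[OF A[OF n] L ij'] using ij' by simp
    also have "(\<Sum>i<d. \<Sum>j<d. if i = i' then L $$ (i, j) * A n $$ (j, j') else 0) = (L * A n) $$ (i',j')"
      unfolding mult_mat_entry[OF L A[OF n] ij'] using ij' by (subst sum.swap) simp
    finally show ?thesis using ij' A[OF n] L by simp
  qed
  have "(transpose_mat ?T *\<^sub>v vec_low d L) $ l = (\<Sum>k<?m. ?T $$ (k,l) * vec_low d L $ k)"
    using T l by (simp add: scalar_prod_def atLeast0LessThan vec_low_def)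
  also have "\<dots> = (\<Sum>k<?m. \<Sum>n\<in>{1..N}. \<beta> n * G n (?p k))"
  proof (rule sum.cong[OF refl])
    fix k assume k: "k \<in> {..<?m}"
    have "?T $$ (k,l) = (\<Sum>n\<in>{1..N}. \<beta> n * ((if ?p k div d = j' then A n $$ (i', ?p k mod d) else 0)
       - (if ?p k mod d = i' then A n $$ (?p k div d, j') else 0)))"
      unfolding A_def i'_def j'_def by (rule T_hat_carrier_index(2)[OF Mh U]) (use k l in auto)
    then show "?T $$ (k,l) * vec_low d L $ k = (\<Sum>n\<in>{1..N}. \<beta> n * G n (?p k))"
      using k by (simp add: vec_low_def G_def sum_distrib_right mult.assoc)
  qed
  also have "\<dots> = (\<Sum>n\<in>{1..N}. \<beta> n * (\<Sum>k<?m. G n (?p k)))"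
    by (subst sum.swap) (simp add: sum_distrib_left)
  also have "\<dots> = (\<Sum>n\<in>{1..N}. \<beta> n * (A n * L - L * A n) $$ (i',j'))"
    unfolding sum_low_positions using Gsum by simp
  also have "\<dots> = vec_low d (mat_comb d N \<beta> (\<lambda>n. A n * L - L * A n)) $ l"
    using l ij' by (simp add: vec_low_def i'_def j'_def)
  finally show "(transpose_mat ?T *\<^sub>v vec_low d L) $ l = vec_low d (mat_comb d N \<beta> (\<lambda>n. A n * L - L * A n)) $ l" .
qed

text \<open>\<open>mat_inv\<close> is a choice among matrices of any size; its dimensions are
  recovered by comparing the column counts in the two product equations.\<close>

lemma invertible_mat_inv:
  assumes T: "T \<in> carrier_mat m m" and inv: "invertible_mat T"
  shows "mat_inv T \<in> carrier_mat m m" "T * mat_inv T = 1\<^sub>m m" "mat_inv T * T = 1\<^sub>m m"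
proof -
  have "inverts_mat T (mat_inv T) \<and> inverts_mat (mat_inv T) T"
    unfolding mat_inv_def
    by (rule someI_ex) (use inv in \<open>simp add: invertible_mat_def\<close>)
  then have 1: "T * mat_inv T = 1\<^sub>m m" and 2: "mat_inv T * T = 1\<^sub>m (dim_row (mat_inv T))"
    using T by (auto simp: inverts_mat_def)
  from arg_cong[OF 1, of dim_col] have c: "dim_col (mat_inv T) = m" by simp
  from arg_cong[OF 2, of dim_col] have r: "dim_row (mat_inv T) = m" using T by simp
  from c r 1 2 show "mat_inv T \<in> carrier_mat m m" "T * mat_inv T = 1\<^sub>m m" "mat_inv T * T = 1\<^sub>m m" by auto
qed

text \<open>\<open>v\<close> is recovered from \<open>transpose_mat T *\<^sub>v v\<close> by the
  transpose of \<open>mat_inv T\<close>, and transposition does not worsen the spectral bound. This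
  lets the inverse of \<open>T_hat\<close> itself appear in the final estimate.\<close>

lemma euc_norm_le_transpose_inverse:
  assumes T: "T \<in> carrier_mat m m" and inv: "invertible_mat T" and m: "m > 0" and v: "v \<in> carrier_vec m"
  shows "euc_norm v \<le> spec_norm (mat_inv T) * euc_norm (transpose_mat T *\<^sub>v v)"
proof -
  note I = invertible_mat_inv[OF T inv]
  have "transpose_mat (mat_inv T) *\<^sub>v (transpose_mat T *\<^sub>v v) = transpose_mat (T * mat_inv T) *\<^sub>v v"
    unfolding transpose_mult[OF T I(1)] using I T v
    by (intro assoc_mult_mat_vec[symmetric, of _ m m _ m]) auto
  also have "\<dots> = v" using v I by simp
  finally show ?thesis
    using euc_norm_transpose_le_spec_norm[OF I(1) m, of "transpose_mat T *\<^sub>v v"] T v by simp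
qed

text \<open>The diagonal is zero and mirrored entries have equal squares, so the lower half carries
  half of the squared norm. The factor \<open>sqrt 2\<close> of the theorem originates here.\<close>

lemma fro_norm_low_skew:
  assumes X: "X \<in> carrier_mat d d" and skew: "transpose_mat X = - X"
  shows "(fro_norm X)\<^sup>2 = 2 * (fro_norm (low X))\<^sup>2"
proof -
  have sk: "X $$ (j,i) = - X $$ (i,j)" if "i < d" "j < d" for i j
    using arg_cong[OF skew, of "\<lambda>M. M $$ (i,j)"] X that by simp
  have "(fro_norm X)\<^sup>2 = (\<Sum>i<d. \<Sum>j<d. (low X $$ (i,j))\<^sup>2 + (low X $$ (j,i))\<^sup>2)"
    unfolding fro_norm_sq carrier_matD[OF X]
  proof (intro sum.cong refl)
    fix i j assume "i \<in> {..<d}" "j \<in> {..<d}"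
    then have ij: "i < d" "j < d" by auto
    have "low X $$ (i,j) = (if j < i then X $$ (i,j) else 0)"
      "low X $$ (j,i) = (if i < j then X $$ (j,i) else 0)"
      using ij X by simp_all
    moreover have "X $$ (i,j) = 0" if "i = j" using sk[OF ij] that by simp
    moreover have "(X $$ (j,i))\<^sup>2 = (X $$ (i,j))\<^sup>2" using sk[OF ij] by simp
    ultimately show "(X $$ (i,j))\<^sup>2 = (low X $$ (i,j))\<^sup>2 + (low X $$ (j,i))\<^sup>2"
      by (cases i j rule: linorder_cases) simp_all
  qed
  also have "\<dots> = (\<Sum>i<d. \<Sum>j<d. (low X $$ (i,j))\<^sup>2) + (\<Sum>i<d. \<Sum>j<d. (low X $$ (j,i))\<^sup>2)"
    by (simp add: sum.distrib)
  also have "(\<Sum>i<d. \<Sum>j<d. (low X $$ (j,i))\<^sup>2) = (\<Sum>i<d. \<Sum>j<d. (low X $$ (i,j))\<^sup>2)"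
    by (rule sum.swap)
  finally show ?thesis using X by (simp add: fro_norm_sq)
qed

lemma model_M_carrier:
  "V \<in> carrier_mat d d \<Longrightarrow> Vinv \<in> carrier_mat d d \<Longrightarrow> model_M d V Vinv \<Lambda> n \<in> carrier_mat d d"
  by (auto simp: model_M_def mat_diag_def)

section \<open>The perturbation bound\<close>

text \<open>As \<open>A\<close> has no strictly lower part, that of \<open>Ah\<close> consists of
  the first-order commutator, the noise and a second-order remainder, so the commutator can be
  solved for. The version with \<open>A\<close> serves the uniform bound, which needs triangular
  matrices; the version with \<open>Ah\<close> serves \<open>T_hat\<close>, which is built from
  noisy data. Passing between them costs a commutator with \<open>Ah - A\<close>, of order
  \<open>\<sigma> + \<alpha>\<close>, times \<open>\<alpha>\<close>.\<close>

lemma low_commutator_skew_le: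
  assumes A: "A \<in> carrier_mat d d" and up: "upper_triangular A"
    and X: "X \<in> carrier_mat d d" and skew: "transpose_mat X = - X" and nX: "fro_norm X = 1"
    and \<alpha>: "0 < \<alpha>" "\<alpha> \<le> 1" and \<sigma>: "0 < \<sigma>" and W: "W \<in> carrier_mat d d" "fro_norm W \<le> 1"
    and Ah: "Ah = transpose_mat (mat_exp (\<alpha> \<cdot>\<^sub>m X)) * A * mat_exp (\<alpha> \<cdot>\<^sub>m X) + \<sigma> \<cdot>\<^sub>m W"
  shows "\<alpha> * fro_norm (low (A * low X - low X * A))
      \<le> fro_norm (low Ah) + \<sigma> + exp_const d * fro_norm A * \<alpha>\<^sup>2" (is "?a")
    and "\<alpha> * fro_norm (low (Ah * low X - low X * Ah))
      \<le> fro_norm (low Ah) + \<sigma> + exp_const d * fro_norm A * \<alpha>\<^sup>2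
        + 2 * \<alpha> * ((2 + exp_const d) * fro_norm A * \<alpha> + \<sigma>)" (is "?b")
proof -
  define Y where "Y = \<alpha> \<cdot>\<^sub>m X"
  define Z where "Z = transpose_mat (mat_exp Y) * A * mat_exp Y"
  define R where "R = Z - A - (A * Y - Y * A)"
  define L where "L = low X"
  have Y: "Y \<in> carrier_mat d d" using X by (simp add: Y_def)
  have skY: "transpose_mat Y = - Y"
  proof -
    have "transpose_mat Y = \<alpha> \<cdot>\<^sub>m transpose_mat X" unfolding Y_def by (intro eq_matI) auto
    also have "\<dots> = - Y" unfolding skew Y_def by (intro eq_matI) auto
    finally show ?thesis .
  qed
  have nY: "fro_norm Y = \<alpha>" using nX \<alpha> by (simp add: Y_def)
  have Z: "Z \<in> carrier_mat d d" unfolding Z_def using A Y by auto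
  have Lc: "L \<in> carrier_mat d d" using X by (simp add: L_def)
  have AYA: "A * Y - Y * A \<in> carrier_mat d d" by (rule minus_carrier_mat[OF mult_carrier_mat[OF Y A]])
  have Rc: "R \<in> carrier_mat d d" unfolding R_def by (rule minus_carrier_mat[OF AYA])
  have Ah': "Ah = Z + \<sigma> \<cdot>\<^sub>m W" using Ah by (simp add: Z_def Y_def)
  have Ahc: "Ah \<in> carrier_mat d d" using Z W by (simp add: Ah')
  have nR: "fro_norm R \<le> exp_const d * fro_norm A * \<alpha>\<^sup>2"
    using exp_conj_expansion[OF A Y skY] nY \<alpha> by (simp add: R_def Z_def)
  have nZ: "fro_norm (Z - A) \<le> (2 + exp_const d) * fro_norm A * \<alpha>"
    using exp_conj_lipschitz[OF A Y skY] nY \<alpha> by (simp add: Z_def)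
  have diag: "X $$ (i,i) = 0" if "i < d" for i
    using arg_cong[OF skew, of "\<lambda>M. M $$ (i,i)"] X that by simp
  have AX: "A * X \<in> carrier_mat d d" "X * A \<in> carrier_mat d d" using A X by auto
  have comm: "low (A * Y - Y * A) = \<alpha> \<cdot>\<^sub>m low (A * L - L * A)"
  proof -
    have "A * Y - Y * A = \<alpha> \<cdot>\<^sub>m (A * X - X * A)"
    proof -
      have "\<alpha> \<cdot>\<^sub>m P - \<alpha> \<cdot>\<^sub>m Q = \<alpha> \<cdot>\<^sub>m (P - Q)" if "P \<in> carrier_mat d d" "Q \<in> carrier_mat d d" for P Q :: "real mat"
        using that by (intro eq_matI) (auto simp: right_diff_distrib)
      then show ?thesis
        unfolding Y_def mult_smult_distrib[OF A X] mult_smult_assoc_mat[OF X A] using AX by blast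
    qed
    moreover have "low (\<alpha> \<cdot>\<^sub>m P) = \<alpha> \<cdot>\<^sub>m low P" for P
      by (intro eq_matI) auto
    ultimately have "low (A * Y - Y * A) = \<alpha> \<cdot>\<^sub>m low (A * X - X * A)" by simp
    then show ?thesis using low_commutator[OF A up X diag] by (simp add: L_def)
  qed
  have split: "low (A * Y - Y * A) = low Ah - (\<sigma> \<cdot>\<^sub>m low W + low R)"
  proof (rule eq_matI)
    fix i j assume "i < dim_row (low Ah - (\<sigma> \<cdot>\<^sub>m low W + low R))" "j < dim_col (low Ah - (\<sigma> \<cdot>\<^sub>m low W + low R))"
    then have ij: "i < d" "j < d" using Rc by auto
    have "j < i \<Longrightarrow> A $$ (i,j) = 0" using upper_triangularD[OF up] ij A by auto
    moreover have "R $$ (i,j) = Z $$ (i,j) - A $$ (i,j) - (A * Y - Y * A) $$ (i,j)"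
    proof -
      have "(Z - A - P) $$ (i,j) = Z $$ (i,j) - A $$ (i,j) - P $$ (i,j)" if "P \<in> carrier_mat d d" for P
        using ij Z A that by simp
      then show ?thesis unfolding R_def using AYA by blast
    qed
    moreover have "Ah $$ (i,j) = Z $$ (i,j) + \<sigma> * W $$ (i,j)" unfolding Ah' using ij Z W by simp
    moreover have "low (A * Y - Y * A) $$ (i,j) = (if j < i then (A * Y - Y * A) $$ (i,j) else 0)"
      by (intro low_index) (use ij AYA in auto)
    ultimately show "low (A * Y - Y * A) $$ (i,j) = (low Ah - (\<sigma> \<cdot>\<^sub>m low W + low R)) $$ (i,j)"
      using ij Ahc W(1) Rc by simp
  qed (use AYA Rc in auto)
  have "\<alpha> * fro_norm (low (A * L - L * A)) = fro_norm (low (A * Y - Y * A))"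
    unfolding comm using \<alpha> by simp
  also have "\<dots> \<le> fro_norm (low Ah) + fro_norm (\<sigma> \<cdot>\<^sub>m low W + low R)"
    unfolding split by (rule fro_norm_diff[of _ d d]) (use Ahc W Rc in auto)
  also have "fro_norm (\<sigma> \<cdot>\<^sub>m low W + low R) \<le> fro_norm (\<sigma> \<cdot>\<^sub>m low W) + fro_norm (low R)"
    by (rule fro_norm_add[of _ d d]) (use W Rc in auto)
  also have "fro_norm (\<sigma> \<cdot>\<^sub>m low W) \<le> \<sigma>"
    using \<sigma> W(2) fro_norm_low_le[of W] by (simp add: mult_left_le)
  also have "fro_norm (low R) \<le> exp_const d * fro_norm A * \<alpha>\<^sup>2"
    using fro_norm_low_le[of R] nR by linarith
  finally have a: "\<alpha> * fro_norm (low (A * L - L * A))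
      \<le> fro_norm (low Ah) + \<sigma> + exp_const d * fro_norm A * \<alpha>\<^sup>2" by linarith
  then show ?a by (simp add: L_def)
  define D where "D = Ah - A"
  have Dc: "D \<in> carrier_mat d d" unfolding D_def by (rule minus_carrier_mat[OF A])
  have nD: "fro_norm D \<le> (2 + exp_const d) * fro_norm A * \<alpha> + \<sigma>"
  proof -
    have "D = (Z - A) + \<sigma> \<cdot>\<^sub>m W" unfolding D_def Ah' using Z A W by (intro eq_matI) auto
    then have "fro_norm D \<le> fro_norm (Z - A) + fro_norm (\<sigma> \<cdot>\<^sub>m W)"
      using fro_norm_add[of "Z - A" d d "\<sigma> \<cdot>\<^sub>m W"] A W by (simp add: minus_carrier_mat)
    moreover have "fro_norm (\<sigma> \<cdot>\<^sub>m W) \<le> \<sigma>" using \<sigma> W(2) by (simp add: mult_left_le)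
    ultimately show ?thesis using nZ by linarith
  qed
  have nL: "fro_norm L \<le> 1" using fro_norm_low_le[of X] nX by (simp add: L_def)
  have cs: "D * L \<in> carrier_mat d d" "L * D \<in> carrier_mat d d" "A * L \<in> carrier_mat d d" "L * A \<in> carrier_mat d d"
    using A Dc Lc by auto
  have "Ah = A + D" unfolding D_def using A Ahc by (intro eq_matI) auto
  then have AhL: "Ah * L - L * Ah = (A * L + D * L) - (L * A + L * D)"
    using add_mult_distrib_mat[OF A Dc Lc] mult_add_distrib_mat[OF Lc A Dc] by simp
  have distrib: "(P + Q) - (S + T) = (P - S) + (Q - T)"
    "low ((P - S) + (Q - T)) = low (P - S) + low (Q - T)"
    if "P \<in> carrier_mat d d" "Q \<in> carrier_mat d d" "S \<in> carrier_mat d d" "T \<in> carrier_mat d d"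
    for P Q S T :: "real mat"
    using that by (intro eq_matI; auto)+
  have "low (Ah * L - L * Ah) = low (A * L - L * A) + low (D * L - L * D)"
    unfolding AhL distrib(1)[OF cs(3,1,4,2)] by (rule distrib(2)[OF cs(3,1,4,2)])
  then have "fro_norm (low (Ah * L - L * Ah)) \<le> fro_norm (low (A * L - L * A)) + fro_norm (low (D * L - L * D))"
    using fro_norm_add[of "low (A * L - L * A)" d d "low (D * L - L * D)"] cs by (simp add: minus_carrier_mat)
  moreover have "fro_norm (low (D * L - L * D)) \<le> 2 * fro_norm D"
  proof -
    have "fro_norm (low (D * L - L * D)) \<le> fro_norm (D * L) + fro_norm (L * D)"
      using fro_norm_low_le[of "D * L - L * D"] fro_norm_diff[OF cs(1,2)] by linarith
    also have "\<dots> \<le> fro_norm D * fro_norm L + fro_norm L * fro_norm D"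
      using fro_norm_mult[OF Dc Lc] fro_norm_mult[OF Lc Dc] by linarith
    also have "\<dots> \<le> 2 * fro_norm D"
      using mult_left_mono[OF nL fro_norm_nonneg[of D]] by (simp add: mult.commute)
    finally show ?thesis .
  qed
  ultimately have "fro_norm (low (Ah * L - L * Ah))
      \<le> fro_norm (low (A * L - L * A)) + 2 * ((2 + exp_const d) * fro_norm A * \<alpha> + \<sigma>)"
    using mult_left_mono[OF nD, of 2] by simp
  then have "\<alpha> * fro_norm (low (Ah * L - L * Ah))
      \<le> \<alpha> * (fro_norm (low (A * L - L * A)) + 2 * ((2 + exp_const d) * fro_norm A * \<alpha> + \<sigma>))"
    using \<alpha> by (intro mult_left_mono) auto
  then show ?b using a by (simp add: L_def algebra_simps)
qed

text \<open>Cauchy-Schwarz is applied separately to \<open>q\<close> and to the constant vector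
  \<open>\<sigma>\<close>, whose norm is \<open>\<sigma> * sqrt (real N)\<close>. With
  \<open>q n\<close> the norm of the \<open>n\<close>-th strictly lower part, the other norm is the
  square root of the loss.\<close>

lemma sum_abs_mult_add_le:
  fixes \<beta> q :: "nat \<Rightarrow> real"
  assumes "0 \<le> \<sigma>"
  shows "(\<Sum>n\<in>{1..N}. \<bar>\<beta> n\<bar> * (q n + \<sigma>))
    \<le> sqrt (\<Sum>n\<in>{1..N}. (\<beta> n)\<^sup>2) * (sqrt (\<Sum>n\<in>{1..N}. (q n)\<^sup>2) + \<sigma> * sqrt (real N))"
proof -
  have "(\<Sum>n\<in>{1..N}. \<bar>\<beta> n\<bar> * (q n + \<sigma>)) \<le> (\<Sum>n\<in>{1..N}. \<bar>\<beta> n\<bar> * \<bar>q n\<bar>) + (\<Sum>n\<in>{1..N}. \<bar>\<beta> n\<bar> * \<bar>\<sigma>\<bar>)"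
    unfolding sum.distrib[symmetric]
    using assms by (intro sum_mono) (auto simp: distrib_left[symmetric] intro!: mult_left_mono)
  also have "\<dots> \<le> L2_set \<beta> {1..N} * L2_set q {1..N} + L2_set \<beta> {1..N} * L2_set (\<lambda>_. \<sigma>) {1..N}"
    by (intro add_mono L2_set_mult_ineq)
  also have "L2_set (\<lambda>_. \<sigma>) {1..N} = \<sigma> * sqrt (real N)"
    using assms by (simp add: L2_set_def real_sqrt_mult mult.commute)
  finally show ?thesis by (simp add: L2_set_def distrib_left)
qed

lemma conj_orthogonal_split:
  fixes U0 E M W :: "real mat"
  assumes U0: "U0 \<in> carrier_mat d d" and E: "E \<in> carrier_mat d d" and M: "M \<in> carrier_mat d d"
    and W: "W \<in> carrier_mat d d"
  shows "transpose_mat (U0 * E) * (M + \<sigma> \<cdot>\<^sub>m W) * (U0 * E)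
    = transpose_mat E * (transpose_mat U0 * M * U0) * E + \<sigma> \<cdot>\<^sub>m (transpose_mat (U0 * E) * W * (U0 * E))"
proof -
  have UE: "U0 * E \<in> carrier_mat d d" "transpose_mat (U0 * E) \<in> carrier_mat d d" using U0 E by auto
  have "transpose_mat (U0 * E) * (M + \<sigma> \<cdot>\<^sub>m W) * (U0 * E)
      = (transpose_mat (U0 * E) * M + \<sigma> \<cdot>\<^sub>m (transpose_mat (U0 * E) * W)) * (U0 * E)"
    using mult_add_distrib_mat[OF UE(2) M, of "\<sigma> \<cdot>\<^sub>m W"] mult_smult_distrib[OF UE(2) W] W by simp
  also have "\<dots> = transpose_mat (U0 * E) * M * (U0 * E) + \<sigma> \<cdot>\<^sub>m (transpose_mat (U0 * E) * W * (U0 * E))"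
    using add_mult_distrib_mat[of "transpose_mat (U0 * E) * M" d d "\<sigma> \<cdot>\<^sub>m (transpose_mat (U0 * E) * W)" "U0 * E" d]
      mult_smult_assoc_mat[of "transpose_mat (U0 * E) * W" d d "U0 * E" d] UE M W
    by (metis mult_carrier_mat smult_carrier_mat)
  also have "transpose_mat (U0 * E) * M * (U0 * E) = transpose_mat E * (transpose_mat U0 * M * U0) * E"
    unfolding transpose_mult[OF U0 E] using U0 E M by (simp add: assoc_mult_mat[of _ d d _ d _ d])
  finally show ?thesis .
qed

text \<open>All \<open>model_M\<close> matrices share \<open>V\<close>, so their combination is
  diagonalized by \<open>V\<close>, and \<open>transpose_mat U0 * V\<close> witnesses the
  similarity. The set of diagonal entries is therefore the same for every \<open>U0\<close>, which
  makes the eigenvalue gap uniform.\<close>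

lemma mat_comb_triangular_diag:
  assumes V: "V \<in> carrier_mat d d" "Vinv \<in> carrier_mat d d"
    and Vinv: "V * Vinv = 1\<^sub>m d" "Vinv * V = 1\<^sub>m d"
    and U0: "is_orthogonal d U0"
    and up: "\<And>n. n \<in> {1..N} \<Longrightarrow> upper_triangular (transpose_mat U0 * model_M d V Vinv \<Lambda> n * U0)"
    and inj: "inj_on (\<lambda>i. \<Sum>n\<in>{1..N}. \<beta> n * \<Lambda> n i) {..<d}"
  defines "A \<equiv> mat_comb d N \<beta> (\<lambda>n. transpose_mat U0 * model_M d V Vinv \<Lambda> n * U0)"
  shows "upper_triangular A" "inj_on (\<lambda>i. A $$ (i,i)) {..<d}"
    "(\<lambda>i. A $$ (i,i)) ` {..<d} = (\<lambda>i. \<Sum>n\<in>{1..N}. \<beta> n * \<Lambda> n i) ` {..<d}"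
proof -
  note u = is_orthogonalD[OF U0]
  let ?\<mu> = "\<lambda>i. \<Sum>n\<in>{1..N}. \<beta> n * \<Lambda> n i"
  have Mc: "model_M d V Vinv \<Lambda> n \<in> carrier_mat d d" for n by (rule model_M_carrier[OF V])
  have D: "mat_diag d (\<lambda>i. \<Lambda> n i) \<in> carrier_mat d d" for n by (simp add: mat_diag_def)
  show up': "upper_triangular A"
  proof (rule upper_triangularI)
    fix i j assume "j < i" "i < dim_row A"
    then have ij: "j < i" "i < d" by (auto simp: A_def)
    have "(transpose_mat U0 * model_M d V Vinv \<Lambda> n * U0) $$ (i,j) = 0" if "n \<in> {1..N}" for n
      using upper_triangularD[OF up[OF that] ij(1)] ij u by simp
    then show "A $$ (i,j) = 0" using ij by (simp add: A_def del: index_mult_mat(1))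
  qed
  have diag: "mat_comb d N \<beta> (\<lambda>n. mat_diag d (\<lambda>i. \<Lambda> n i)) = mat_diag d ?\<mu>"
    by (intro eq_matI) (auto simp: mat_diag_def)
  have M: "mat_comb d N \<beta> (model_M d V Vinv \<Lambda>) = V * mat_diag d ?\<mu> * Vinv"
    unfolding diag[symmetric] mult_mat_comb[OF V(1) D] mat_comb_mult[OF V(2) mult_carrier_mat[OF V(1) D]]
    by (rule mat_comb_cong) (simp add: model_M_def)
  have "A = transpose_mat U0 * mat_comb d N \<beta> (model_M d V Vinv \<Lambda>) * U0"
    unfolding A_def mult_mat_comb[OF u(2) Mc] mat_comb_mult[OF u(1) mult_carrier_mat[OF u(2) Mc]] ..
  also have "\<dots> = (transpose_mat U0 * V) * mat_diag d ?\<mu> * (Vinv * U0)"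
  proof -
    have "transpose_mat U0 * (V * D * Vinv) * U0 = (transpose_mat U0 * V) * D * (Vinv * U0)"
      if "D \<in> carrier_mat d d" for D
      using u(1,2) V that by (simp add: assoc_mult_mat[of _ d d _ d _ d])
    then show ?thesis unfolding M by (simp add: mat_diag_def)
  qed
  finally have A: "A = (transpose_mat U0 * V) * mat_diag d ?\<mu> * (Vinv * U0)" .
  have "transpose_mat U0 * V * (Vinv * U0) = transpose_mat U0 * (V * Vinv) * U0"
    using u(1,2) V by (simp add: assoc_mult_mat[of _ d d _ d _ d])
  then have inv1: "transpose_mat U0 * V * (Vinv * U0) = 1\<^sub>m d" using u Vinv by simp
  have "Vinv * U0 * (transpose_mat U0 * V) = Vinv * (U0 * transpose_mat U0) * V"
    using u(1,2) V by (simp add: assoc_mult_mat[of _ d d _ d _ d])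
  then have inv2: "Vinv * U0 * (transpose_mat U0 * V) = 1\<^sub>m d" using u V Vinv by simp
  have Ac: "A \<in> carrier_mat d d" by (simp add: A_def)
  have "similar_mat A (mat_diag d ?\<mu>)"
    by (rule similar_matI[OF _ inv1 inv2 A]) (use Ac u V in \<open>auto simp: mat_diag_def\<close>)
  from upper_triangular_similar_diag[OF Ac up' this inj]
  show "inj_on (\<lambda>i. A $$ (i,i)) {..<d}" "(\<lambda>i. A $$ (i,i)) ` {..<d} = ?\<mu> ` {..<d}" by blast+
qed

text \<open>Two estimates meet here: \<open>key\<close>, through separating weights
  \<open>\<gamma>\<close> that have nothing to do with \<open>\<beta>\<close>, and
  \<open>main\<close>, through \<open>T_hat\<close>, whose error still carries the factor
  \<open>s\<close>.\<close>

lemma triangularizer_distance_bound: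
  fixes d N :: nat and \<Lambda> :: "nat \<Rightarrow> nat \<Rightarrow> real" and \<beta> :: "nat \<Rightarrow> real"
  assumes d2: "d \<ge> 2"
    and V: "V \<in> carrier_mat d d" "Vinv \<in> carrier_mat d d"
    and Vinv: "V * Vinv = 1\<^sub>m d" "Vinv * V = 1\<^sub>m d"
    and nondeg: "\<forall>i<d. \<forall>i'<d. i \<noteq> i' \<longrightarrow> (\<exists>n\<in>{1..N}. \<Lambda> n i \<noteq> \<Lambda> n i')"
  obtains C \<delta> where "\<delta> > 0"
    "\<And>\<sigma> \<alpha> W U U0 X Mh. Mh = (\<lambda>n. model_M d V Vinv \<Lambda> n + \<sigma> \<cdot>\<^sub>m W n) \<Longrightarrow>
      \<sigma> > 0 \<Longrightarrow> (\<And>n. n \<in> {1..N} \<Longrightarrow> W n \<in> carrier_mat d d \<and> fro_norm (W n) \<le> 1) \<Longrightarrow>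
      is_orthogonal d U \<Longrightarrow> exact_joint_triangularizer d N (model_M d V Vinv \<Lambda>) U0 \<Longrightarrow>
      X \<in> carrier_mat d d \<Longrightarrow> transpose_mat X = - X \<Longrightarrow> fro_norm X = 1 \<Longrightarrow> \<alpha> > 0 \<Longrightarrow>
      U = U0 * mat_exp (\<alpha> \<cdot>\<^sub>m X) \<Longrightarrow> \<sigma> + \<alpha> < \<delta> \<Longrightarrow> invertible_mat (T_hat d N \<beta> Mh U) \<Longrightarrow>
      \<alpha> \<le> sqrt 2 * sqrt (\<Sum>n\<in>{1..N}. (\<beta> n)\<^sup>2) * spec_norm (mat_inv (T_hat d N \<beta> Mh U)) *
        (sqrt (loss N Mh U) + \<sigma> * sqrt (real N)) + C * (\<sigma> + \<alpha>)\<^sup>2"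
proof -
  let ?M = "model_M d V Vinv \<Lambda>"
  define B where "B = (\<Sum>n\<in>{1..N}. fro_norm (?M n))"
  have B: "fro_norm (?M n) \<le> B" if "n \<in> {1..N}" for n
    unfolding B_def by (rule member_le_sum[OF that]) auto
  have B0: "B \<ge> 0" unfolding B_def by (intro sum_nonneg) auto
  have Mc: "?M n \<in> carrier_mat d d" for n by (rule model_M_carrier[OF V])
  have ec: "exp_const d \<ge> 0" by (simp add: exp_const_def)
  obtain \<gamma> where inj: "inj_on (\<lambda>i. \<Sum>n\<in>{1..N}. \<gamma> n * \<Lambda> n i) {..<d}"
    using generic_combination[OF nondeg] by blast
  obtain g where g: "g > 0" and gap: "\<And>x y. x \<in> (\<lambda>i. \<Sum>n\<in>{1..N}. \<gamma> n * \<Lambda> n i) ` {..<d} \<Longrightarrow>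
      y \<in> (\<lambda>i. \<Sum>n\<in>{1..N}. \<gamma> n * \<Lambda> n i) ` {..<d} \<Longrightarrow> x \<noteq> y \<Longrightarrow> g \<le> \<bar>x - y\<bar>"
    using inj_on_gap[OF inj] by blast
  define s1 where "s1 = (\<Sum>n\<in>{1..N}. \<bar>\<gamma> n\<bar>)"
  have s1: "s1 \<ge> 0" unfolding s1_def by (intro sum_nonneg) auto
  obtain K where K0: "K > 0" and K: "\<And>A L. A \<in> carrier_mat d d \<Longrightarrow> upper_triangular A \<Longrightarrow> fro_norm A \<le> s1 * B \<Longrightarrow>
      (\<And>i j. i < d \<Longrightarrow> j < d \<Longrightarrow> i \<noteq> j \<Longrightarrow> g \<le> \<bar>A $$ (i,i) - A $$ (j,j)\<bar>) \<Longrightarrow>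
      L \<in> carrier_mat d d \<Longrightarrow> low L = L \<Longrightarrow> fro_norm L \<le> K * fro_norm (low (A * L - L * A))"
    using low_commutator_inverse_bound[of g "s1 * B" d] g B0 s1 by auto
  define nb where "nb = sqrt (\<Sum>n\<in>{1..N}. (\<beta> n)\<^sup>2)"
  define ng where "ng = sqrt (\<Sum>n\<in>{1..N}. (\<gamma> n)\<^sup>2)"
  have nb0: "nb \<ge> 0" "ng \<ge> 0" unfolding nb_def ng_def by (auto intro: sum_nonneg)
  \<comment> \<open>\<open>c1\<close> and \<open>c2\<close> are the coefficients of the inequality
    \<open>\<alpha> <= c1 * Q + c2 * \<alpha>\<^sup>2\<close> reached inside
    \<open>key\<close>.\<close>
  define c1 where "c1 = sqrt 2 * K * ng"
  define c2 where "c2 = sqrt 2 * K * (s1 * (exp_const d * B))"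
  have c12: "c1 \<ge> 0" "c2 \<ge> 0" using K0 nb0 s1 ec B0 by (auto simp: c1_def c2_def)
  \<comment> \<open>The 1 permits the expansion of the exponential; the other bound makes
    \<open>c2 * \<alpha>\<^sup>2\<close> at most half of \<open>\<alpha>\<close>, and the added 2
    covers \<open>c2 = 0\<close>.\<close>
  define \<delta> where "\<delta> = min 1 (1 / (2 * c2 + 2))"
  \<comment> \<open>All second-order terms for one \<open>n\<close>, as a multiple of
    \<open>(\<sigma> + \<alpha>)\<^sup>2\<close>; the 1 accounts for the mixed term
    \<open>2 * \<alpha> * \<sigma>\<close>.\<close>
  define e3 where "e3 = exp_const d * B + 2 * ((2 + exp_const d) * B + 1)"
  define c3 where "c3 = (\<Sum>n\<in>{1..N}. \<bar>\<beta> n\<bar>) * e3"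
  have e3: "e3 \<ge> 0" using ec B0 by (simp add: e3_def)
  have c3: "c3 \<ge> 0" unfolding c3_def using e3 by (intro mult_nonneg_nonneg sum_nonneg) auto
  \<comment> \<open>Solves \<open>sqrt 2 * nb * s0 = 2 * c1\<close> if \<open>nb\<close> is nonzero;
    for \<open>nb = 0\<close>, division by zero yields 0.\<close>
  define s0 where "s0 = 2 * c1 / (sqrt 2 * nb)"
  have s0: "s0 \<ge> 0" using c12 nb0 by (simp add: s0_def)
  define C where "C = sqrt 2 * s0 * c3"
  have C: "C \<ge> 0" using s0 c3 by (simp add: C_def)
  show ?thesis
  proof (rule that[of \<delta> C])
    show "\<delta> > 0" using c12 by (simp add: \<delta>_def)
    fix \<sigma> \<alpha> :: real and W U U0 X and Mh :: "nat \<Rightarrow> real mat"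
    assume Mh: "Mh = (\<lambda>n. ?M n + \<sigma> \<cdot>\<^sub>m W n)" and \<sigma>: "\<sigma> > 0"
      and W: "\<And>n. n \<in> {1..N} \<Longrightarrow> W n \<in> carrier_mat d d \<and> fro_norm (W n) \<le> 1"
      and U: "is_orthogonal d U" and U0: "exact_joint_triangularizer d N ?M U0"
      and X: "X \<in> carrier_mat d d" "transpose_mat X = - X" "fro_norm X = 1" and \<alpha>: "\<alpha> > 0"
      and UE: "U = U0 * mat_exp (\<alpha> \<cdot>\<^sub>m X)" and small: "\<sigma> + \<alpha> < \<delta>"
      and inv: "invertible_mat (T_hat d N \<beta> Mh U)"
    define T where "T = T_hat d N \<beta> Mh U"
    define s where "s = spec_norm (mat_inv T)"
    define Q where "Q = sqrt (loss N Mh U) + \<sigma> * sqrt (real N)"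
    have Q: "Q \<ge> 0" unfolding Q_def loss_def using \<sigma> by (intro add_nonneg_nonneg real_sqrt_ge_zero sum_nonneg) auto
    have \<alpha>1: "\<alpha> \<le> 1" using small \<sigma> by (simp add: \<delta>_def)
    have oU0: "is_orthogonal d U0" using U0 by (simp add: exact_joint_triangularizer_def)
    note u0 = is_orthogonalD[OF oU0] and u = is_orthogonalD[OF U]
    let ?m = "d * (d - 1) div 2"
    have m: "?m > 0"
    proof -
      have "2 * 1 \<le> d * (d - 1)" using d2 by (intro mult_mono) auto
      then show ?thesis by simp
    qed
    define A where "A n = transpose_mat U0 * ?M n * U0" for n
    define Ah where "Ah n = transpose_mat U * Mh n * U" for n
    define L where "L = low X"
    define q where "q n = fro_norm (low (Ah n))" for n
    have Ac: "A n \<in> carrier_mat d d" for n using u0 Mc by (auto simp: A_def)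
    have Mhc: "Mh n \<in> carrier_mat d d" if "n \<in> {1..N}" for n using W[OF that] Mc by (simp add: Mh)
    have Ahc: "Ah n \<in> carrier_mat d d" if "n \<in> {1..N}" for n using Mhc[OF that] u by (auto simp: Ah_def)
    have up: "upper_triangular (A n)" if "n \<in> {1..N}" for n
      using U0 that low_eq_0_iff[OF Ac] by (simp add: exact_joint_triangularizer_def A_def)
    have nA: "fro_norm (A n) \<le> B" if "n \<in> {1..N}" for n
      using fro_norm_orthogonal_conj[OF oU0 Mc] B[OF that] by (simp add: A_def)
    have L: "L \<in> carrier_mat d d" "low L = L" using X by (auto simp: L_def intro!: eq_matI)
    have nL: "sqrt 2 * fro_norm L = 1"
    proof -
      have "(sqrt 2 * fro_norm L)\<^sup>2 = 1"
        using fro_norm_low_skew[OF X(1,2)] X(3) by (simp add: power_mult_distrib L_def)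
      moreover have "0 \<le> sqrt 2 * fro_norm L" by simp
      ultimately show ?thesis by (metis abs_of_nonneg real_sqrt_abs real_sqrt_one)
    qed
    have AhE: "Ah n = transpose_mat (mat_exp (\<alpha> \<cdot>\<^sub>m X)) * A n * mat_exp (\<alpha> \<cdot>\<^sub>m X)
        + \<sigma> \<cdot>\<^sub>m (transpose_mat U * W n * U)" if "n \<in> {1..N}" for n
      unfolding Ah_def A_def UE Mh using conj_orthogonal_split[OF u0(1) _ Mc] W[OF that] X by simp
    have Wc: "transpose_mat U * W n * U \<in> carrier_mat d d" "fro_norm (transpose_mat U * W n * U) \<le> 1"
      if "n \<in> {1..N}" for n
      using W[OF that] fro_norm_orthogonal_conj[OF U] u by auto
    note per_n = low_commutator_skew_le[OF Ac up X \<alpha> \<alpha>1 \<sigma> Wc AhE, folded L_def]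
    have small2: "\<alpha>\<^sup>2 \<le> (\<sigma> + \<alpha>)\<^sup>2" "2 * \<alpha> * \<alpha> \<le> 2 * (\<sigma> + \<alpha>)\<^sup>2" "2 * \<alpha> * \<sigma> \<le> 2 * (\<sigma> + \<alpha>)\<^sup>2"
      using \<alpha> \<sigma> by (auto simp: power2_eq_square algebra_simps)
    have Q_sum: "(\<Sum>n\<in>{1..N}. \<bar>b n\<bar> * (q n + \<sigma>)) \<le> sqrt (\<Sum>n\<in>{1..N}. (b n)\<^sup>2) * Q" for b :: "nat \<Rightarrow> real"
      using sum_abs_mult_add_le[of \<sigma> b q N] \<sigma> by (simp add: Q_def loss_def q_def Ah_def)

    have key: "\<alpha> \<le> 2 * c1 * Q"
    proof -
      let ?A = "mat_comb d N \<gamma> A"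
      note tri = mat_comb_triangular_diag[OF V Vinv oU0 up[unfolded A_def] inj, folded A_def]
      have "fro_norm ?A \<le> (\<Sum>n\<in>{1..N}. \<bar>\<gamma> n\<bar> * fro_norm (A n))"
        by (rule fro_norm_mat_comb_le) (rule Ac)
      also have "\<dots> \<le> (\<Sum>n\<in>{1..N}. \<bar>\<gamma> n\<bar> * B)"
        using nA by (intro sum_mono mult_left_mono) auto
      finally have nAg: "fro_norm ?A \<le> s1 * B" by (simp add: s1_def sum_distrib_right)
      have gapA: "g \<le> \<bar>?A $$ (i,i) - ?A $$ (j,j)\<bar>" if "i < d" "j < d" "i \<noteq> j" for i j
      proof (rule gap)
        have mem: "?A $$ (k,k) \<in> (\<lambda>i. \<Sum>n\<in>{1..N}. \<gamma> n * \<Lambda> n i) ` {..<d}" if "k < d" for k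
        proof -
          have "?A $$ (k,k) \<in> (\<lambda>i. ?A $$ (i,i)) ` {..<d}"
            by (rule image_eqI[where x = k]) (use that in simp_all)
          then show ?thesis by (simp only: tri(3))
        qed
        show "?A $$ (i,i) \<in> (\<lambda>i. \<Sum>n\<in>{1..N}. \<gamma> n * \<Lambda> n i) ` {..<d}"
          "?A $$ (j,j) \<in> (\<lambda>i. \<Sum>n\<in>{1..N}. \<gamma> n * \<Lambda> n i) ` {..<d}"
          using that by (intro mem; simp)+
        show "?A $$ (i,i) \<noteq> ?A $$ (j,j)" using inj_onD[OF tri(2), of i j] that by auto
      qed
      have "\<alpha> * fro_norm (low (?A * L - L * ?A)) = \<alpha> * fro_norm (low (mat_comb d N \<gamma> (\<lambda>n. A n * L - L * A n)))"
        using commutator_mat_comb[OF L(1) Ac] by simp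
      also have "\<dots> \<le> \<alpha> * (\<Sum>n\<in>{1..N}. \<bar>\<gamma> n\<bar> * fro_norm (low (A n * L - L * A n)))"
        using \<alpha> Ac L(1) by (intro mult_left_mono fro_norm_low_mat_comb_le) (auto intro!: minus_carrier_mat)
      also have "\<dots> = (\<Sum>n\<in>{1..N}. \<bar>\<gamma> n\<bar> * (\<alpha> * fro_norm (low (A n * L - L * A n))))"
        by (simp add: sum_distrib_left mult_ac)
      also have "\<dots> \<le> (\<Sum>n\<in>{1..N}. \<bar>\<gamma> n\<bar> * (q n + \<sigma>) + \<bar>\<gamma> n\<bar> * (exp_const d * B * \<alpha>\<^sup>2))"
      proof (rule sum_mono)
        fix n assume n: "n \<in> {1..N}"
        have "exp_const d * fro_norm (A n) * \<alpha>\<^sup>2 \<le> exp_const d * B * \<alpha>\<^sup>2"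
          using ec nA[OF n] by (intro mult_right_mono mult_left_mono) auto
        then have "\<alpha> * fro_norm (low (A n * L - L * A n)) \<le> (q n + \<sigma>) + exp_const d * B * \<alpha>\<^sup>2"
          using per_n(1)[OF n n n n] unfolding q_def by linarith
        then show "\<bar>\<gamma> n\<bar> * (\<alpha> * fro_norm (low (A n * L - L * A n)))
            \<le> \<bar>\<gamma> n\<bar> * (q n + \<sigma>) + \<bar>\<gamma> n\<bar> * (exp_const d * B * \<alpha>\<^sup>2)"
          unfolding distrib_left[symmetric] by (intro mult_left_mono) auto
      qed
      also have "\<dots> \<le> ng * Q + s1 * (exp_const d * B) * \<alpha>\<^sup>2"
      proof -
        have "(\<Sum>n\<in>{1..N}. \<bar>\<gamma> n\<bar> * (exp_const d * B * \<alpha>\<^sup>2)) = s1 * (exp_const d * B) * \<alpha>\<^sup>2"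
          unfolding s1_def mult.assoc by (rule sum_distrib_right[symmetric])
        then show ?thesis using Q_sum[of \<gamma>] unfolding sum.distrib ng_def by linarith
      qed
      finally have 1: "\<alpha> * fro_norm (low (?A * L - L * ?A)) \<le> ng * Q + s1 * (exp_const d * B) * \<alpha>\<^sup>2" .
      have "fro_norm L \<le> K * fro_norm (low (?A * L - L * ?A))"
        by (rule K[OF mat_comb_carrier tri(1) nAg gapA L])
      then have "\<alpha> * (sqrt 2 * fro_norm L) \<le> \<alpha> * (sqrt 2 * (K * fro_norm (low (?A * L - L * ?A))))"
        using \<alpha> by (intro mult_left_mono) auto
      also have "\<dots> = sqrt 2 * K * (\<alpha> * fro_norm (low (?A * L - L * ?A)))" by simp
      also have "\<dots> \<le> sqrt 2 * K * (ng * Q + s1 * (exp_const d * B) * \<alpha>\<^sup>2)"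
        using 1 K0 by (intro mult_left_mono) auto
      finally have 2: "\<alpha> \<le> c1 * Q + c2 * \<alpha>\<^sup>2" unfolding nL by (simp add: c1_def c2_def algebra_simps)
      have "\<alpha> \<le> 1 / (2 * c2 + 2)" using small \<sigma> by (simp add: \<delta>_def)
      then have "\<alpha> * (2 * c2 + 2) \<le> 1" using c12 by (simp add: field_simps)
      then have "\<alpha> * (2 * c2) \<le> 1" using \<alpha> by (simp add: algebra_simps)
      then have "\<alpha> * (\<alpha> * (2 * c2)) \<le> \<alpha> * 1" using \<alpha> by (intro mult_left_mono) auto
      \<comment> \<open>The quadratic term is absorbed by half of the left-hand side, whence the
        factor 2 in \<open>key\<close>.\<close>
      then have "2 * (c2 * \<alpha>\<^sup>2) \<le> \<alpha>" by (simp add: power2_eq_square mult_ac)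
      then show ?thesis using 2 by linarith
    qed

    have Tc: "T \<in> carrier_mat ?m ?m" unfolding T_def by (rule T_hat_carrier_index(1)[OF Mhc u(1)])
    have inv': "invertible_mat T" using inv by (simp add: T_def)
    have s_nonneg: "s \<ge> 0"
      unfolding s_def using spec_norm_nonneg[of "mat_inv T"] invertible_mat_inv(1)[OF Tc inv'] m by simp
    have "fro_norm L = euc_norm (vec_low d L)"
      using euc_norm_vec_low[OF L(1)] L(2) by simp
    also have "\<dots> \<le> s * euc_norm (transpose_mat T *\<^sub>v vec_low d L)"
      unfolding s_def by (rule euc_norm_le_transpose_inverse[OF Tc inv' m vec_low_carrier])
    also have "transpose_mat T *\<^sub>v vec_low d L = vec_low d (mat_comb d N \<beta> (\<lambda>n. Ah n * L - L * Ah n))"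
      unfolding T_def Ah_def by (rule T_hat_transpose_mult_vec_low[OF Mhc u(1) L])
    also have "euc_norm \<dots> = fro_norm (low (mat_comb d N \<beta> (\<lambda>n. Ah n * L - L * Ah n)))"
      by (rule euc_norm_vec_low) simp
    also have "s * \<dots> \<le> s * (\<Sum>n\<in>{1..N}. \<bar>\<beta> n\<bar> * fro_norm (low (Ah n * L - L * Ah n)))"
      using s_nonneg Ahc L(1) by (intro mult_left_mono fro_norm_low_mat_comb_le) (auto intro!: minus_carrier_mat)
    finally have "\<alpha> * (sqrt 2 * fro_norm L)
        \<le> \<alpha> * (sqrt 2 * (s * (\<Sum>n\<in>{1..N}. \<bar>\<beta> n\<bar> * fro_norm (low (Ah n * L - L * Ah n)))))"
      using \<alpha> by (intro mult_left_mono) auto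
    also have "\<dots> = sqrt 2 * s * (\<Sum>n\<in>{1..N}. \<bar>\<beta> n\<bar> * (\<alpha> * fro_norm (low (Ah n * L - L * Ah n))))"
      by (simp add: sum_distrib_left mult_ac)
    also have "\<dots> \<le> sqrt 2 * s * (\<Sum>n\<in>{1..N}. \<bar>\<beta> n\<bar> * (q n + \<sigma>) + \<bar>\<beta> n\<bar> * (e3 * (\<sigma> + \<alpha>)\<^sup>2))"
    proof (intro mult_left_mono sum_mono)
      fix n assume n: "n \<in> {1..N}"
      have "exp_const d * fro_norm (A n) * \<alpha>\<^sup>2 \<le> exp_const d * B * (\<sigma> + \<alpha>)\<^sup>2"
        using ec nA[OF n] B0 small2 by (intro mult_mono mult_left_mono) auto
      moreover have "(2 + exp_const d) * fro_norm (A n) * (2 * \<alpha> * \<alpha>) \<le> (2 + exp_const d) * B * (2 * (\<sigma> + \<alpha>)\<^sup>2)"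
      proof (rule mult_mono)
        show "(2 + exp_const d) * fro_norm (A n) \<le> (2 + exp_const d) * B"
          using ec nA[OF n] by (intro mult_left_mono) auto
      qed (use small2(2) ec B0 \<alpha> in auto)
      ultimately have "\<alpha> * fro_norm (low (Ah n * L - L * Ah n)) \<le> (q n + \<sigma>) + e3 * (\<sigma> + \<alpha>)\<^sup>2"
        using per_n(2)[OF n n n n] small2(3) unfolding q_def e3_def by (simp add: algebra_simps)
      then show "\<bar>\<beta> n\<bar> * (\<alpha> * fro_norm (low (Ah n * L - L * Ah n)))
          \<le> \<bar>\<beta> n\<bar> * (q n + \<sigma>) + \<bar>\<beta> n\<bar> * (e3 * (\<sigma> + \<alpha>)\<^sup>2)"
        unfolding distrib_left[symmetric] by (intro mult_left_mono) auto
    qed (use s_nonneg in auto)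
    also have "\<dots> \<le> sqrt 2 * s * (nb * Q + c3 * (\<sigma> + \<alpha>)\<^sup>2)"
    proof (rule mult_left_mono)
      have "(\<Sum>n\<in>{1..N}. \<bar>\<beta> n\<bar> * (e3 * (\<sigma> + \<alpha>)\<^sup>2)) = c3 * (\<sigma> + \<alpha>)\<^sup>2"
        unfolding c3_def mult.assoc by (rule sum_distrib_right[symmetric])
      then show "(\<Sum>n\<in>{1..N}. \<bar>\<beta> n\<bar> * (q n + \<sigma>) + \<bar>\<beta> n\<bar> * (e3 * (\<sigma> + \<alpha>)\<^sup>2)) \<le> nb * Q + c3 * (\<sigma> + \<alpha>)\<^sup>2"
        using Q_sum[of \<beta>] unfolding sum.distrib nb_def by linarith
    qed (use s_nonneg in simp)
    finally have main: "\<alpha> \<le> sqrt 2 * s * (nb * Q + c3 * (\<sigma> + \<alpha>)\<^sup>2)" unfolding nL by simp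

    have "\<alpha> \<le> sqrt 2 * nb * s * Q + C * (\<sigma> + \<alpha>)\<^sup>2"
    \<comment> \<open>Up to the threshold, \<open>s0\<close> replaces \<open>s\<close> in the error
      of \<open>main\<close>. Beyond it, the leading term alone dominates the bound of
      \<open>key\<close>.\<close>
    proof (cases "s \<le> s0")
      case True
      have "sqrt 2 * s * (c3 * (\<sigma> + \<alpha>)\<^sup>2) \<le> sqrt 2 * s0 * (c3 * (\<sigma> + \<alpha>)\<^sup>2)"
        using True c3 by (intro mult_right_mono mult_left_mono) auto
      then show ?thesis using main by (simp add: C_def algebra_simps)
    next
      case False
      \<comment> \<open>If all weights were zero, \<open>main\<close> would force
        \<open>\<alpha> <= 0\<close>.\<close>
      have "nb \<noteq> 0"
      proof
        assume nb: "nb = 0"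
        then have "\<beta> n = 0" if "n \<in> {1..N}" for n
          using that by (auto simp: nb_def sum_nonneg_eq_0_iff)
        then have "c3 = 0" by (simp add: c3_def)
        then show False using main nb \<alpha> by simp
      qed
      then have nb: "nb > 0" using nb0 by simp
      have "2 * c1 = sqrt 2 * nb * s0" using nb by (simp add: s0_def)
      also have "\<dots> \<le> sqrt 2 * nb * s" using False nb by (intro mult_left_mono) auto
      finally have "2 * c1 * Q \<le> sqrt 2 * nb * s * Q" using Q by (intro mult_right_mono)
      moreover have "0 \<le> C * (\<sigma> + \<alpha>)\<^sup>2" using C by simp
      ultimately show ?thesis using key by linarith
    qed
    then show "\<alpha> \<le> sqrt 2 * sqrt (\<Sum>n\<in>{1..N}. (\<beta> n)\<^sup>2) * spec_norm (mat_inv (T_hat d N \<beta> Mh U)) *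
        (sqrt (loss N Mh U) + \<sigma> * sqrt (real N)) + C * (\<sigma> + \<alpha>)\<^sup>2"
      by (simp add: nb_def s_def T_def Q_def)
  qed
qed

section \<open>Existence of exact joint triangularizers\<close>

lemma mult_vec_entry:
  assumes "A \<in> carrier_mat r c" "v \<in> carrier_vec c" "i < r"
  shows "(A *\<^sub>v v) $ i = (\<Sum>k<c. A $$ (i,k) * v $ k)"
  using assms by (simp add: scalar_prod_def atLeast0LessThan)

lemma scalar_prod_sum:
  assumes "w \<in> carrier_vec n"
  shows "v \<bullet> w = (\<Sum>k<n. v $ k * w $ k)"
  using assms by (simp add: scalar_prod_def atLeast0LessThan)

lemma scalar_prod_self_eq_0:
  fixes v :: "real vec"
  assumes "v \<in> carrier_vec n" "v \<bullet> v = 0"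
  shows "v = 0\<^sub>v n"
  using assms euc_norm_sq_scalar_prod[of v] euc_norm_eq_0D[of v] by simp

lemma scalar_prod_self_nonneg: "(v :: real vec) \<bullet> v \<ge> 0"
  using euc_norm_sq_scalar_prod[of v] by (metis zero_le_power2)

lemma normalize_vec:
  fixes v :: "real vec"
  assumes v: "v \<in> carrier_vec n" "v \<noteq> 0\<^sub>v n"
  obtains r where "r > 0" "(r \<cdot>\<^sub>v v) \<bullet> (r \<cdot>\<^sub>v v) = 1"
proof (rule that[of "1 / euc_norm v"])
  have "euc_norm v \<noteq> 0" using v euc_norm_eq_0D[of v] by auto
  then show "1 / euc_norm v > 0" using euc_norm_nonneg[of v] by (simp add: less_le)
  then show "(1 / euc_norm v \<cdot>\<^sub>v v) \<bullet> (1 / euc_norm v \<cdot>\<^sub>v v) = 1"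
    unfolding euc_norm_sq_scalar_prod[symmetric] euc_norm_smult by simp
qed

lemma is_orthogonal_scalar_prod:
  assumes Q: "is_orthogonal d Q" and v: "v \<in> carrier_vec d" and w: "w \<in> carrier_vec d"
  shows "(Q *\<^sub>v v) \<bullet> (Q *\<^sub>v w) = v \<bullet> w"
proof -
  note q = is_orthogonalD[OF Q]
  have Qv: "Q *\<^sub>v v \<in> carrier_vec d" using q(1) v by simp
  have "v \<bullet> w = v \<bullet> ((transpose_mat Q * Q) *\<^sub>v w)" using q w by simp
  also have "\<dots> = v \<bullet> (transpose_mat Q *\<^sub>v (Q *\<^sub>v w))"
    by (subst assoc_mult_mat_vec[OF q(2,1) w]) simp
  also have "\<dots> = (transpose_mat (transpose_mat Q) *\<^sub>v v) \<bullet> (Q *\<^sub>v w)"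
    using transpose_vec_mult_scalar[OF q(2), of "Q *\<^sub>v w" v] q(1) v w by simp
  finally show ?thesis by simp
qed

lemma is_orthogonal_det:
  assumes "is_orthogonal d Q"
  shows "det Q * det Q = 1"
proof -
  note q = is_orthogonalD[OF assms]
  have "det (transpose_mat Q * Q) = 1" unfolding q(3) by simp
  then show ?thesis unfolding det_mult[OF q(2,1)] det_transpose[OF q(1)] .
qed

text \<open>The reflection in the hyperplane orthogonal to \<open>x - y\<close>; for
  \<open>x = y\<close> there is no such hyperplane and the identity serves. The statement about
  fixed vectors lets a later reflection leave earlier results intact.\<close>

lemma householder:
  fixes x y :: "real vec"
  assumes x: "x \<in> carrier_vec d" and y: "y \<in> carrier_vec d" and eq: "x \<bullet> x = y \<bullet> y"
  obtains H where "is_orthogonal d H" "H *\<^sub>v x = y"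
    "\<And>z. z \<in> carrier_vec d \<Longrightarrow> z \<bullet> (x - y) = 0 \<Longrightarrow> H *\<^sub>v z = z"
proof (cases "x = y")
  case True
  then show ?thesis using that[of "1\<^sub>m d"] y by (auto simp: is_orthogonal_one)
next
  case False
  define w where "w = x - y"
  have w: "w \<in> carrier_vec d" using x y by (simp add: w_def)
  have "w \<noteq> 0\<^sub>v d"
  proof
    assume "w = 0\<^sub>v d"
    then have "w $ i = 0" if "i < d" for i using that by simp
    then have "x $ i = y $ i" if "i < d" for i using that x y by (simp add: w_def)
    then show False using False x y by (auto intro: eq_vecI)
  qed
  then have ww: "w \<bullet> w \<noteq> 0" using scalar_prod_self_eq_0[OF w] by blast
  define c where "c = 2 / (w \<bullet> w)"
  define H where "H = mat d d (\<lambda>(i,j). (if i = j then 1 else 0) - c * (w $ i * w $ j))"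
  have H: "H \<in> carrier_mat d d" by (simp add: H_def)
  have Hz: "H *\<^sub>v z = z - (c * (w \<bullet> z)) \<cdot>\<^sub>v w" if z: "z \<in> carrier_vec d" for z
  proof (rule eq_vecI)
    fix i assume "i < dim_vec (z - (c * (w \<bullet> z)) \<cdot>\<^sub>v w)"
    then have i: "i < d" using w by simp
    have "(H *\<^sub>v z) $ i = (\<Sum>k<d. (if i = k then z $ k else 0) - c * w $ i * (w $ k * z $ k))"
      unfolding mult_vec_entry[OF H z i] using i by (intro sum.cong refl) (auto simp: H_def algebra_simps)
    also have "\<dots> = z $ i - c * w $ i * (w \<bullet> z)"
      using i by (simp add: sum_subtractf sum_distrib_left[symmetric] scalar_prod_sum[OF z])
    finally show "(H *\<^sub>v z) $ i = (z - (c * (w \<bullet> z)) \<cdot>\<^sub>v w) $ i" using i w z by simp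
  qed (use H w in auto)
  have HT: "transpose_mat H = H" by (intro eq_matI) (auto simp: H_def)
  have "H * H = 1\<^sub>m d"
  proof (rule eq_matI)
    fix i j assume "i < dim_row (1\<^sub>m d :: real mat)" "j < dim_col (1\<^sub>m d :: real mat)"
    then have ij: "i < d" "j < d" by auto
    have "(H * H) $$ (i,j) = (\<Sum>k<d. (if i = k then (if k = j then 1 else 0) - c * (w $ k * w $ j) else 0)
        - c * (w $ i * w $ k) * (if k = j then 1 else 0) + c * c * w $ i * w $ j * (w $ k * w $ k))"
      unfolding mult_mat_entry[OF H H ij] using ij by (intro sum.cong refl) (auto simp: H_def algebra_simps)
    also have "\<dots> = ((if i = j then 1 else 0) - c * (w $ i * w $ j)) - c * (w $ i * w $ j)
        + c * c * w $ i * w $ j * (w \<bullet> w)"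
      using ij by (simp add: sum.distrib sum_subtractf sum_distrib_left[symmetric] scalar_prod_sum[OF w]
          if_distrib[of "\<lambda>x. _ * x"] cong: if_cong)
    also have "\<dots> = (if i = j then 1 else 0)" using ww by (simp add: c_def field_simps)
    finally show "(H * H) $$ (i,j) = 1\<^sub>m d $$ (i,j)" using ij by simp
  qed (use H in auto)
  then have orth: "is_orthogonal d H" using H by (simp add: is_orthogonal_def HT)
  \<comment> \<open>Equality of the lengths enters here and makes the coefficient of
    \<open>w\<close> in \<open>H *\<^sub>v x\<close> equal to 1.\<close>
  have e: "w \<bullet> w = 2 * (w \<bullet> x)"
  proof -
    have "w \<bullet> w = w \<bullet> x - w \<bullet> y" using scalar_prod_minus_distrib[OF w x y] by (simp add: w_def)
    moreover have "w \<bullet> x = x \<bullet> x - y \<bullet> x" "w \<bullet> y = x \<bullet> y - y \<bullet> y"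
      unfolding w_def using minus_scalar_prod_distrib[OF x y] x y by auto
    moreover have "x \<bullet> y = y \<bullet> x" by (rule comm_scalar_prod[OF x y])
    ultimately show ?thesis using eq by simp
  qed
  then have "c * (w \<bullet> x) = 1" using ww by (simp add: c_def)
  then have "H *\<^sub>v x = x - 1 \<cdot>\<^sub>v w" using Hz[OF x] by simp
  also have "\<dots> = y" using x y by (intro eq_vecI) (auto simp: w_def)
  finally have Hx: "H *\<^sub>v x = y" .
  show ?thesis
  proof (rule that[OF orth Hx])
    fix z assume z: "z \<in> carrier_vec d" and "z \<bullet> (x - y) = 0"
    then have "w \<bullet> z = 0" using comm_scalar_prod[OF w z] by (simp add: w_def)
    then have "H *\<^sub>v z = z - 0 \<cdot>\<^sub>v w" using Hz[OF z] by simp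
    also have "\<dots> = z" using z w by (intro eq_vecI) auto
    finally show "H *\<^sub>v z = z" .
  qed
qed

text \<open>One reflection per column. Its vector \<open>x - y\<close> vanishes before coordinate
  \<open>k\<close>, whereas the finished columns vanish from \<open>k\<close> on; they are
  orthogonal to it and stay fixed.\<close>

lemma qr_decomposition:
  fixes A :: "real mat"
  assumes A: "A \<in> carrier_mat d d"
  obtains Q where "is_orthogonal d Q" "upper_triangular (Q * A)"
proof -
  have "\<exists>Q. is_orthogonal d Q \<and> (\<forall>i<d. \<forall>j<k. j < i \<longrightarrow> (Q * A) $$ (i,j) = 0)" if "k \<le> d" for k
    using that
  proof (induction k)
    case 0
    show ?case using is_orthogonal_one by auto
  next
    case (Suc k)
    then obtain Q where Q: "is_orthogonal d Q" and tri: "\<And>i j. i < d \<Longrightarrow> j < k \<Longrightarrow> j < i \<Longrightarrow> (Q * A) $$ (i,j) = 0"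
      by auto
    define B where "B = Q * A"
    have B: "B \<in> carrier_mat d d" using is_orthogonalD(1)[OF Q] A by (simp add: B_def)
    have k: "k < d" using Suc by simp
    \<comment> \<open>Column \<open>k\<close> from the diagonal downwards, to be sent to a multiple
      of the \<open>k\<close>-th unit vector of the same length.\<close>
    define x where "x = vec d (\<lambda>i. if i < k then 0 else B $$ (i,k))"
    define y where "y = euc_norm x \<cdot>\<^sub>v unit_vec d k"
    have x: "x \<in> carrier_vec d" and y: "y \<in> carrier_vec d" by (auto simp: x_def y_def)
    have "y \<bullet> y = euc_norm x * euc_norm x"
      unfolding y_def using k by simp
    then have "x \<bullet> x = y \<bullet> y" using euc_norm_sq_scalar_prod[of x] by (simp add: power2_eq_square)
    then obtain H where H: "is_orthogonal d H" "H *\<^sub>v x = y"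
      and fixed: "\<And>z. z \<in> carrier_vec d \<Longrightarrow> z \<bullet> (x - y) = 0 \<Longrightarrow> H *\<^sub>v z = z"
      using householder[OF x y] by blast
    note h = is_orthogonalD[OF H(1)]
    have xy0: "(x - y) $ i = 0" if "i < k" for i using that k by (simp add: x_def y_def)
    have colHB: "(H * B) $$ (i,j) = (H *\<^sub>v col B j) $ i" if "i < d" "j < d" for i j
      using h(1) B that by simp
    have "(H * B) $$ (i,j) = 0" if i: "i < d" and j: "j < Suc k" and ji: "j < i" for i j
    proof (cases "j = k")
      case False
      then have jk: "j < k" using j by simp
      have "col B j $ l * (x - y) $ l = 0" if "l < d" for l
        using xy0[of l] tri[of l j] jk that B k by (cases "l < k") (auto simp: B_def[symmetric])
      then have "(\<Sum>l<d. col B j $ l * (x - y) $ l) = 0" by (intro sum.neutral) blast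
      then have "col B j \<bullet> (x - y) = 0"
        using scalar_prod_sum[OF minus_carrier_vec[OF x y]] by simp
      then have "H *\<^sub>v col B j = col B j" using B by (intro fixed) (auto simp: carrier_vecI)
      then show ?thesis using colHB[of i j] tri[of i j] i jk ji k B by (simp add: B_def[symmetric])
    next
      case True
      \<comment> \<open>The rest of column \<open>k\<close>, above the diagonal, is orthogonal to
        \<open>x - y\<close> and so is not moved.\<close>
      define h' where "h' = vec d (\<lambda>i. if i < k then B $$ (i,k) else 0)"
      have h': "h' \<in> carrier_vec d" by (simp add: h'_def)
      have split: "col B k = h' + x" using B k by (intro eq_vecI) (auto simp: h'_def x_def)
      have "h' $ l * (x - y) $ l = 0" if "l < d" for l
        using xy0[of l] that by (cases "l < k") (auto simp: h'_def)
      then have "(\<Sum>l<d. h' $ l * (x - y) $ l) = 0" by (intro sum.neutral) blast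
      then have "h' \<bullet> (x - y) = 0"
        using scalar_prod_sum[OF minus_carrier_vec[OF x y]] by simp
      then have "H *\<^sub>v h' = h'" using h' by (intro fixed) auto
      then have "H *\<^sub>v col B k = h' + y"
        unfolding split using mult_add_distrib_mat_vec[OF h(1) h' x] H(2) by simp
      then show ?thesis using colHB[of i j] i ji True k by (simp add: h'_def y_def)
    qed
    then have "\<forall>i<d. \<forall>j<Suc k. j < i \<longrightarrow> (H * Q * A) $$ (i,j) = 0"
      using h(1) is_orthogonalD(1)[OF Q] A by (simp add: assoc_mult_mat[of _ d d _ d _ d] B_def)
    then show ?case using is_orthogonal_mult[OF H(1) Q] by blast
  qed
  from this[of d] obtain Q where Q: "is_orthogonal d Q" and
    tri: "\<And>i j. i < d \<Longrightarrow> j < d \<Longrightarrow> j < i \<Longrightarrow> (Q * A) $$ (i,j) = 0" by auto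
  have "upper_triangular (Q * A)"
    using tri is_orthogonalD(1)[OF Q] by (intro upper_triangularI) auto
  then show ?thesis using that Q by blast
qed

text \<open>Induction over columns: in the entry \<open>(i,j)\<close> of \<open>A * R\<close> the
  terms with \<open>k > j\<close> vanish by the shape of \<open>R\<close> and those with
  \<open>k < j\<close> by induction, which leaves \<open>A $$ (i,j)\<close> times a nonzero
  pivot.\<close>

lemma upper_triangular_left_factor:
  fixes A R :: "real mat"
  assumes A: "A \<in> carrier_mat d d" and R: "R \<in> carrier_mat d d"
    and up: "upper_triangular R" "upper_triangular (A * R)" and nz: "\<And>j. j < d \<Longrightarrow> R $$ (j,j) \<noteq> 0"
  shows "upper_triangular A"
proof (rule upper_triangularI)
  have "A $$ (i,j) = 0" if "j < i" "i < d" for i j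
    using that
  proof (induction j rule: less_induct)
    case (less j)
    have j: "j < d" using less by simp
    have "A $$ (i,k) * R $$ (k,j) = 0" if "k \<in> {..<d} - {j}" for k
      using less.IH[of k] less.prems upper_triangularD[OF up(1), of j k] that R
      by (cases k j rule: linorder_cases) auto
    then have z: "(\<Sum>k\<in>{..<d}-{j}. A $$ (i,k) * R $$ (k,j)) = 0" by (intro sum.neutral) blast
    have "0 = (A * R) $$ (i,j)"
      using upper_triangularD[OF up(2), of j i] less.prems A by simp
    also have "\<dots> = (\<Sum>k<d. A $$ (i,k) * R $$ (k,j))"
      by (rule mult_mat_entry[OF A R less.prems(2) j])
    also have "\<dots> = A $$ (i,j) * R $$ (j,j) + (\<Sum>k\<in>{..<d}-{j}. A $$ (i,k) * R $$ (k,j))"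
      using j by (intro sum.remove) auto
    finally show ?case using z nz[OF j] by simp
  qed
  then show "A $$ (i,j) = 0" if "j < i" "i < dim_row A" for i j using that A by auto
qed

lemma upper_triangular_mult_diag:
  fixes R :: "real mat"
  assumes R: "R \<in> carrier_mat d d" and up: "upper_triangular R"
  shows "upper_triangular (R * mat_diag d f)" "upper_triangular (mat_diag d f * R)"
  unfolding mat_diag_mult_right[OF R] mat_diag_mult_left[OF R]
  using upper_triangularD[OF up] R by (auto intro!: upper_triangularI)

text \<open>With \<open>R = Q * V\<close> triangular and invertible, the conjugate \<open>A\<close>
  of \<open>model_M\<close> by \<open>Q\<close> satisfies \<open>A * R = R * D\<close> for a
  diagonal \<open>D\<close>. The right-hand side is triangular, and cancelling \<open>R\<close>
  shows the same of \<open>A\<close>. One \<open>Q\<close> serves every \<open>n\<close> because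
  \<open>V\<close> is shared.\<close>

lemma exact_joint_triangularizer_exists:
  assumes V: "V \<in> carrier_mat d d" "Vinv \<in> carrier_mat d d"
    and Vinv: "V * Vinv = 1\<^sub>m d" "Vinv * V = 1\<^sub>m d"
  obtains U0 where "exact_joint_triangularizer d N (model_M d V Vinv \<Lambda>) U0"
proof -
  obtain Q where Q: "is_orthogonal d Q" and up: "upper_triangular (Q * V)"
    using qr_decomposition[OF V(1)] by blast
  note q = is_orthogonalD[OF Q]
  have R: "Q * V \<in> carrier_mat d d" using q V by auto
  have "det V * det Vinv = 1" using det_mult[OF V] Vinv by simp
  then have "det (Q * V) \<noteq> 0"
    using det_mult[OF q(1) V(1)] is_orthogonal_det[OF Q] by auto
  then have nz: "(Q * V) $$ (j,j) \<noteq> 0" if "j < d" for j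
    using det_upper_triangular[OF up R] that R by (auto simp: diag_mat_def prod_list_zero_iff simp del: index_mult_mat(1))
  have "low (transpose_mat (transpose_mat Q) * model_M d V Vinv \<Lambda> n * transpose_mat Q) = 0\<^sub>m d d" for n
  proof -
    define A where "A = Q * model_M d V Vinv \<Lambda> n * transpose_mat Q"
    have M: "model_M d V Vinv \<Lambda> n \<in> carrier_mat d d" by (rule model_M_carrier[OF V])
    have A: "A \<in> carrier_mat d d" using q M by (auto simp: A_def)
    have "A * (Q * V) = (Q * model_M d V Vinv \<Lambda> n) * (transpose_mat Q * Q) * V"
      unfolding A_def using q(1,2) M V by (simp add: assoc_mult_mat[of _ d d _ d _ d])
    also have "\<dots> = Q * model_M d V Vinv \<Lambda> n * V" using q M by simp
    also have "\<dots> = (Q * V) * mat_diag d (\<lambda>i. \<Lambda> n i) * (Vinv * V)"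
    proof -
      have "Q * (V * D * Vinv) * V = (Q * V) * D * (Vinv * V)" if "D \<in> carrier_mat d d" for D
        using q(1) V that by (simp add: assoc_mult_mat[of _ d d _ d _ d])
      then show ?thesis by (simp add: model_M_def)
    qed
    also have "\<dots> = (Q * V) * mat_diag d (\<lambda>i. \<Lambda> n i)"
      unfolding Vinv by (rule right_mult_one_mat[OF mult_carrier_mat[OF R mat_diag_dim]])
    finally have "A * (Q * V) = (Q * V) * mat_diag d (\<lambda>i. \<Lambda> n i)" .
    then have "upper_triangular (A * (Q * V))" using upper_triangular_mult_diag(1)[OF R up] by simp
    then have "upper_triangular A" by (intro upper_triangular_left_factor[OF A R up _ nz])
    then show ?thesis using low_eq_0_iff[OF A] by (simp add: A_def)
  qed
  then have "exact_joint_triangularizer d N (model_M d V Vinv \<Lambda>) (transpose_mat Q)"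
    by (simp add: exact_joint_triangularizer_def is_orthogonal_transpose[OF Q])
  then show ?thesis by (rule that)
qed

text \<open>Multiplying by this sign change flips the determinant, while conjugating by it preserves
  triangularity. It is also the model of the reflection used in
  \<open>special_orthogonal_invariant_subspace\<close>.\<close>

lemma reflection_diag:
  fixes d :: nat
  defines "S \<equiv> mat_diag d (\<lambda>i. if i = 0 then -1 else 1 :: real)"
  shows "is_orthogonal d S" "d > 0 \<Longrightarrow> det S = -1" "transpose_mat S = S" "S \<in> carrier_mat d d"
proof -
  show c: "S \<in> carrier_mat d d" by (simp add: S_def)
  show t: "transpose_mat S = S" unfolding S_def mat_diag_def by (intro eq_matI) auto
  have "S * S = mat_diag d (\<lambda>i. 1)"
    unfolding S_def mat_diag_diag by (rule arg_cong[of _ _ "mat_diag d"]) auto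
  then show "is_orthogonal d S" using c by (simp add: is_orthogonal_def t)
  have up: "upper_triangular S" by (auto simp: S_def mat_diag_def intro!: upper_triangularI)
  assume d: "d > 0"
  have "diag_mat S = map (\<lambda>i. if i = 0 then -1 else 1) [0..<d]"
    by (auto simp: S_def mat_diag_def diag_mat_def)
  also have "\<dots> = -1 # map (\<lambda>i. 1) [1..<d]"
    using d by (subst upt_conv_Cons) auto
  finally have "prod_list (diag_mat S) = -1"
    by (simp add: map_replicate_const prod_list_replicate)
  then show "det S = -1" using det_upper_triangular[OF up c] by simp
qed

lemma exact_joint_triangularizer_mult_reflection:
  assumes U0: "exact_joint_triangularizer d N M U0" and M: "\<And>n. n \<in> {1..N} \<Longrightarrow> M n \<in> carrier_mat d d"
  shows "exact_joint_triangularizer d N M (U0 * mat_diag d (\<lambda>i. if i = 0 then -1 else 1))"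
proof -
  let ?S = "mat_diag d (\<lambda>i. if i = 0 then -1 else 1) :: real mat"
  have o: "is_orthogonal d U0" using U0 by (simp add: exact_joint_triangularizer_def)
  note u = is_orthogonalD[OF o]
  have "low (transpose_mat (U0 * ?S) * M n * (U0 * ?S)) = 0\<^sub>m d d" if n: "n \<in> {1..N}" for n
  proof -
    let ?A = "transpose_mat U0 * M n * U0"
    have A: "?A \<in> carrier_mat d d" using u M[OF n] by auto
    have "upper_triangular ?A"
      using U0 n low_eq_0_iff[OF A] by (simp add: exact_joint_triangularizer_def)
    then have "upper_triangular (?S * ?A * ?S)"
      using upper_triangular_mult_diag A by (simp add: mult_carrier_mat[of _ d d _ d])
    moreover have "transpose_mat (U0 * ?S) * M n * (U0 * ?S) = ?S * ?A * ?S"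
      unfolding transpose_mult[OF u(1) reflection_diag(4)] reflection_diag(3)
      using u(1,2) M[OF n] by (simp add: assoc_mult_mat[of _ d d _ d _ d])
    ultimately show ?thesis using low_eq_0_iff[of "?S * ?A * ?S" d] A
      by (simp add: mult_carrier_mat[of _ d d _ d])
  qed
  then show ?thesis
    using is_orthogonal_mult[OF o reflection_diag(1)] by (simp add: exact_joint_triangularizer_def)
qed

text \<open>To be used with \<open>\<epsilon>\<close> the determinant of \<open>U\<close>, so that
  \<open>transpose_mat U0 * U\<close> becomes special orthogonal.\<close>

lemma exact_joint_triangularizer_det:
  assumes V: "V \<in> carrier_mat d d" "Vinv \<in> carrier_mat d d"
    and Vinv: "V * Vinv = 1\<^sub>m d" "Vinv * V = 1\<^sub>m d" and d: "d > 0" and \<epsilon>: "\<epsilon> * \<epsilon> = 1"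
  obtains U0 where "exact_joint_triangularizer d N (model_M d V Vinv \<Lambda>) U0" "det U0 = \<epsilon>"
proof -
  obtain U0 where U0: "exact_joint_triangularizer d N (model_M d V Vinv \<Lambda>) U0"
    using exact_joint_triangularizer_exists[OF V Vinv] by blast
  then have o: "is_orthogonal d U0" by (simp add: exact_joint_triangularizer_def)
  let ?S = "mat_diag d (\<lambda>i. if i = 0 then -1 else 1) :: real mat"
  have "det (U0 * ?S) = - det U0"
    using det_mult[OF is_orthogonalD(1)[OF o], of ?S] reflection_diag(2)[OF d] by simp
  moreover have "det U0 = \<epsilon> \<or> det U0 = - \<epsilon>"
    using is_orthogonal_det[OF o] \<epsilon> by (metis square_eq_iff)
  ultimately show ?thesis
    using that U0 exact_joint_triangularizer_mult_reflection[OF U0 model_M_carrier[OF V]]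
    by (metis add.inverse_inverse)
qed

section \<open>Skew-symmetric logarithms\<close>

text \<open>Conjugation commutes with powers, and an entry of \<open>P * Z * Q\<close> is a finite
  linear combination of entries of \<open>Z\<close>, hence can be exchanged with the entrywise
  series.\<close>

lemma mat_exp_similar:
  assumes wit: "similar_mat_wit A B P Q"
  shows "mat_exp A = P * mat_exp B * Q"
proof -
  define d where "d = dim_row A"
  from wit have c: "A \<in> carrier_mat d d" "B \<in> carrier_mat d d" "P \<in> carrier_mat d d" "Q \<in> carrier_mat d d"
    using similar_mat_witD[OF d_def wit] by blast+
  have PBQ: "(P * Z * Q) $$ (i,j) = (\<Sum>l<d. \<Sum>k<d. P $$ (i,k) * Q $$ (l,j) * Z $$ (k,l))"
    if Z: "Z \<in> carrier_mat d d" and ij: "i < d" "j < d" for Z i j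
  proof -
    have "(P * Z * Q) $$ (i,j) = (\<Sum>l<d. (P * Z) $$ (i,l) * Q $$ (l,j))"
      using c Z ij by (intro mult_mat_entry) auto
    also have "\<dots> = (\<Sum>l<d. (\<Sum>k<d. P $$ (i,k) * Z $$ (k,l)) * Q $$ (l,j))"
      using mult_mat_entry[OF c(3) Z ij(1)] by simp
    finally show ?thesis by (simp add: sum_distrib_left mult_ac)
  qed
  show ?thesis
  proof (rule eq_matI)
    fix i j assume "i < dim_row (P * mat_exp B * Q)" "j < dim_col (P * mat_exp B * Q)"
    then have ij: "i < d" "j < d" using c by auto
    have sB: "summable (\<lambda>n. (B ^\<^sub>m n) $$ (k,l) / fact n)" if "k < d" "l < d" for k l
      by (rule mat_exp_summable[OF c(2) that])
    have "mat_exp A $$ (i,j) = (\<Sum>n. (P * B ^\<^sub>m n * Q) $$ (i,j) / fact n)"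
      using ij c by (simp add: mat_exp_def similar_mat_wit_pow_id[OF wit])
    also have "\<dots> = (\<Sum>n. \<Sum>l<d. \<Sum>k<d. P $$ (i,k) * Q $$ (l,j) * ((B ^\<^sub>m n) $$ (k,l) / fact n))"
      using c ij by (simp add: PBQ sum_divide_distrib del: index_mult_mat(1))
    also have "\<dots> = (\<Sum>l<d. \<Sum>k<d. \<Sum>n. P $$ (i,k) * Q $$ (l,j) * ((B ^\<^sub>m n) $$ (k,l) / fact n))"
      by (subst suminf_sum, (intro summable_sum summable_mult sB; simp),
          rule sum.cong[OF refl], rule suminf_sum, intro summable_mult sB) auto
    also have "\<dots> = (\<Sum>l<d. \<Sum>k<d. P $$ (i,k) * Q $$ (l,j) * mat_exp B $$ (k,l))"
    proof (intro sum.cong[OF refl])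
      fix l k assume "l \<in> {..<d}" "k \<in> {..<d}"
      then show "(\<Sum>n. P $$ (i,k) * Q $$ (l,j) * ((B ^\<^sub>m n) $$ (k,l) / fact n))
          = P $$ (i,k) * Q $$ (l,j) * mat_exp B $$ (k,l)"
        using c sB[of k l] by (subst suminf_mult) (auto simp: mat_exp_def)
    qed
    also have "\<dots> = (P * mat_exp B * Q) $$ (i,j)" using c ij by (intro PBQ[symmetric]) auto
    finally show "mat_exp A $$ (i,j) = (P * mat_exp B * Q) $$ (i,j)" .
  qed (use c in auto)
qed

lemma mat_exp_orthogonal_conj:
  assumes H: "is_orthogonal d H" and Y: "Y \<in> carrier_mat d d"
  shows "mat_exp (transpose_mat H * Y * H) = transpose_mat H * mat_exp Y * H"
proof (rule mat_exp_similar)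
  note h = is_orthogonalD[OF H]
  show "similar_mat_wit (transpose_mat H * Y * H) Y (transpose_mat H) H"
    by (rule similar_mat_witI[of _ _ d]) (use h Y in auto)
qed

lemma mat_exp_four_block_diag:
  assumes A: "A \<in> carrier_mat n n" and B: "B \<in> carrier_mat m m"
  shows "mat_exp (four_block_mat A (0\<^sub>m n m) (0\<^sub>m m n) B)
    = four_block_mat (mat_exp A) (0\<^sub>m n m) (0\<^sub>m m n) (mat_exp B)"
proof (rule eq_matI)
  fix i j
  assume "i < dim_row (four_block_mat (mat_exp A) (0\<^sub>m n m) (0\<^sub>m m n) (mat_exp B))"
    "j < dim_col (four_block_mat (mat_exp A) (0\<^sub>m n m) (0\<^sub>m m n) (mat_exp B))"
  then have ij: "i < n + m" "j < n + m" using A B by auto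
  have p: "A ^\<^sub>m k \<in> carrier_mat n n" "B ^\<^sub>m k \<in> carrier_mat m m" for k using A B by auto
  show "mat_exp (four_block_mat A (0\<^sub>m n m) (0\<^sub>m m n) B) $$ (i,j)
      = four_block_mat (mat_exp A) (0\<^sub>m n m) (0\<^sub>m m n) (mat_exp B) $$ (i,j)"
    using ij A B carrier_matD[OF p(1)] carrier_matD[OF p(2)]
    by (auto simp: mat_exp_def pow_four_block_mat[OF A B])
qed (use A B in auto)

lemma mat_exp_zero: "mat_exp (0\<^sub>m d d) = 1\<^sub>m d"
proof (rule eq_matI)
  fix i j assume "i < dim_row (1\<^sub>m d :: real mat)" "j < dim_col (1\<^sub>m d :: real mat)"
  then have ij: "i < d" "j < d" by auto
  have "((0\<^sub>m d d :: real mat) ^\<^sub>m k) $$ (i,j) / fact k = (if k = 0 then 1\<^sub>m d $$ (i,j) else 0)" for k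
  proof (cases k)
    case (Suc m)
    have "(0\<^sub>m d d :: real mat) ^\<^sub>m k = 0\<^sub>m d d"
      unfolding Suc using right_mult_zero_mat[of "(0\<^sub>m d d :: real mat) ^\<^sub>m m" d d d] by simp
    then show ?thesis using ij Suc by simp
  qed (use ij in auto)
  then have "(\<Sum>k. ((0\<^sub>m d d :: real mat) ^\<^sub>m k) $$ (i,j) / fact k)
      = (\<Sum>k. if k = 0 then 1\<^sub>m d $$ (i,j) else 0)" by simp
  also have "\<dots> = (1\<^sub>m d $$ (i,j) :: real)"
    by (subst suminf_finite[of "{0}"]) auto
  finally show "mat_exp (0\<^sub>m d d) $$ (i,j) = 1\<^sub>m d $$ (i,j)" using ij by (simp add: mat_exp_def)
qed auto

text \<open>The real matrix of multiplication by the complex number \<open>c + i s\<close>;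
  \<open>rot_mult\<close> is complex multiplication and \<open>rot 0 \<theta>\<close> the generator
  of rotations.\<close>

definition rot :: "real \<Rightarrow> real \<Rightarrow> real mat" where
  "rot c s = mat 2 2 (\<lambda>(i,j). if i = j then c else if i = 0 then - s else s)"

lemma rot_carrier [simp]: "rot c s \<in> carrier_mat 2 2"
  by (simp add: rot_def)

lemma rot_mult: "rot a b * rot c s = rot (a * c - b * s) (a * s + b * c)"
  by (rule eq_matI) (auto simp: rot_def scalar_prod_def numeral_2_eq_2 less_Suc_eq)

lemma rot_skew: "transpose_mat (rot 0 \<theta>) = - rot 0 \<theta>"
  by (rule eq_matI) (auto simp: rot_def)

text \<open>These are the real and imaginary parts of the powers of \<open>i \<theta>\<close>.
  Expressed by \<open>cos_coeff\<close> and \<open>sin_coeff\<close>, which encode the period four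
  of the signs, they match the series of cosine and sine term by term.\<close>

lemma rot_pow: "rot 0 \<theta> ^\<^sub>m k = rot (fact k * (cos_coeff k * \<theta> ^ k)) (fact k * (sin_coeff k * \<theta> ^ k))"
proof (induction k)
  case 0
  show ?case by (rule eq_matI) (auto simp: rot_def)
next
  case (Suc k)
  have e: "fact (Suc k) * (cos_coeff (Suc k) * \<theta> ^ Suc k) = - (fact k * (sin_coeff k * \<theta> ^ k) * \<theta>)"
    "fact (Suc k) * (sin_coeff (Suc k) * \<theta> ^ Suc k) = fact k * (cos_coeff k * \<theta> ^ k) * \<theta>"
    unfolding cos_coeff_Suc sin_coeff_Suc fact_Suc by (simp_all add: field_simps del: of_nat_Suc)
  have r: "rot a b * rot 0 \<theta> = rot (- (b * \<theta>)) (a * \<theta>)" for a b by (simp add: rot_mult)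
  show ?case unfolding pow_mat.simps Suc.IH r e ..
qed

lemma mat_exp_rot: "mat_exp (rot 0 \<theta>) = rot (cos \<theta>) (sin \<theta>)"
proof (rule eq_matI)
  fix i j assume "i < dim_row (rot (cos \<theta>) (sin \<theta>))" "j < dim_col (rot (cos \<theta>) (sin \<theta>))"
  then have ij: "i < 2" "j < 2" by (auto simp: rot_def)
  have c: "(\<Sum>n. cos_coeff n * \<theta> ^ n) = cos \<theta>" "(\<Sum>n. sin_coeff n * \<theta> ^ n) = sin \<theta>"
    "(\<Sum>n. - (sin_coeff n * \<theta> ^ n)) = - sin \<theta>"
    using sums_unique[OF cos_converges[of \<theta>]] sums_unique[OF sin_converges[of \<theta>]]
      sums_unique[OF sums_minus[OF sin_converges[of \<theta>]]] by simp_all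
  show "mat_exp (rot 0 \<theta>) $$ (i,j) = rot (cos \<theta>) (sin \<theta>) $$ (i,j)"
    using ij by (simp add: mat_exp_def rot_pow carrier_matD[OF rot_carrier]) (auto simp: rot_def c)
qed (auto simp: rot_def)

lemma rot_orthogonal:
  assumes "c\<^sup>2 + s\<^sup>2 = 1"
  shows "is_orthogonal 2 (rot c s)"
proof -
  have "transpose_mat (rot c s) = rot c (- s)" by (rule eq_matI) (auto simp: rot_def)
  then have "transpose_mat (rot c s) * rot c s = rot 1 0"
    using assms by (simp add: rot_mult power2_eq_square)
  also have "\<dots> = 1\<^sub>m 2" by (rule eq_matI) (auto simp: rot_def)
  finally show ?thesis by (simp add: is_orthogonal_def)
qed

text \<open>A rotation is the square of the rotation by half the angle, so its determinant is the
  square of a determinant that is 1 or -1.\<close>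

lemma det_rot:
  assumes "c\<^sup>2 + s\<^sup>2 = 1"
  shows "det (rot c s) = 1"
proof -
  obtain t where t: "c = cos t" "s = sin t" using sincos_total_2pi[OF assms] by blast
  let ?R = "rot (cos (t/2)) (sin (t/2))"
  have "rot c s = ?R * ?R"
    unfolding rot_mult using cos_double[of "t/2"] sin_double[of "t/2"]
    by (simp add: t power2_eq_square mult_ac)
  then show ?thesis
    using is_orthogonal_det[OF rot_orthogonal[of "cos (t/2)" "sin (t/2)"]] det_mult[of ?R 2 ?R] by simp
qed

text \<open>A complex eigenvector \<open>a + i b\<close> exists. Comparing the inner products of
  \<open>S a\<close> with \<open>b\<close> and of \<open>a\<close> with \<open>S b\<close> shows
  that the imaginary part of the eigenvalue, times the squared length of the eigenvector, is zero.
  Then \<open>a\<close> or \<open>b\<close> is a real eigenvector.\<close>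

lemma symmetric_real_eigenvector:
  fixes S :: "real mat"
  assumes S: "S \<in> carrier_mat d d" and sym: "transpose_mat S = S" and d: "d > 0"
  obtains v c where "v \<in> carrier_vec d" "v \<bullet> v = 1" "S *\<^sub>v v = c \<cdot>\<^sub>v v"
proof -
  let ?S = "map_mat complex_of_real S"
  have Sc: "?S \<in> carrier_mat d d" using S by simp
  obtain \<mu> w where w: "w \<in> carrier_vec d" "w \<noteq> 0\<^sub>v d" "?S *\<^sub>v w = \<mu> \<cdot>\<^sub>v w"
    using spectrum_non_empty[OF Sc d] S by (auto simp: spectrum_def eigenvalue_def eigenvector_def)
  define a b where "a = map_vec Re w" and "b = map_vec Im w"
  have ab: "a \<in> carrier_vec d" "b \<in> carrier_vec d" using w by (auto simp: a_def b_def)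
  have e: "(\<Sum>k<d. complex_of_real (S $$ (i,k)) * w $ k) = \<mu> * w $ i" if "i < d" for i
    using arg_cong[OF w(3), of "\<lambda>v. v $ i"] mult_vec_entry[OF Sc w(1) that] S w(1) that by simp
  have Sa: "S *\<^sub>v a = Re \<mu> \<cdot>\<^sub>v a - Im \<mu> \<cdot>\<^sub>v b"
  proof (rule eq_vecI)
    fix i assume "i < dim_vec (Re \<mu> \<cdot>\<^sub>v a - Im \<mu> \<cdot>\<^sub>v b)"
    then have i: "i < d" using ab by simp
    have "(S *\<^sub>v a) $ i = Re (\<Sum>k<d. complex_of_real (S $$ (i,k)) * w $ k)"
      using mult_vec_entry[OF S ab(1) i] w by (simp add: a_def)
    then show "(S *\<^sub>v a) $ i = (Re \<mu> \<cdot>\<^sub>v a - Im \<mu> \<cdot>\<^sub>v b) $ i"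
      unfolding e[OF i] using i w by (simp add: a_def b_def)
  qed (use S ab in auto)
  have Sb: "S *\<^sub>v b = Im \<mu> \<cdot>\<^sub>v a + Re \<mu> \<cdot>\<^sub>v b"
  proof (rule eq_vecI)
    fix i assume "i < dim_vec (Im \<mu> \<cdot>\<^sub>v a + Re \<mu> \<cdot>\<^sub>v b)"
    then have i: "i < d" using ab by simp
    have "(S *\<^sub>v b) $ i = Im (\<Sum>k<d. complex_of_real (S $$ (i,k)) * w $ k)"
      using mult_vec_entry[OF S ab(2) i] w by (simp add: b_def)
    then show "(S *\<^sub>v b) $ i = (Im \<mu> \<cdot>\<^sub>v a + Re \<mu> \<cdot>\<^sub>v b) $ i"
      unfolding e[OF i] using i w by (simp add: a_def b_def)
  qed (use S ab in auto)
  have "(S *\<^sub>v a) \<bullet> b = a \<bullet> (S *\<^sub>v b)"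
    using transpose_vec_mult_scalar[OF S ab(2,1)] by (simp add: sym)
  then have "Im \<mu> * (a \<bullet> a + b \<bullet> b) = 0"
    unfolding Sa Sb using ab
    by (simp add: scalar_prod_add_distrib[of _ d] minus_scalar_prod_distrib[of _ d] algebra_simps)
  moreover have "a \<bullet> a + b \<bullet> b \<noteq> 0"
  proof
    assume "a \<bullet> a + b \<bullet> b = 0"
    then have "a \<bullet> a = 0" "b \<bullet> b = 0"
      using scalar_prod_self_nonneg[of a] scalar_prod_self_nonneg[of b] by linarith+
    then have z: "a = 0\<^sub>v d" "b = 0\<^sub>v d" using scalar_prod_self_eq_0 ab by blast+
    have "w $ i = 0" if "i < d" for i
      using arg_cong[OF z(1), of "\<lambda>v. v $ i"] arg_cong[OF z(2), of "\<lambda>v. v $ i"] that w(1)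
      by (simp add: a_def b_def complex_eq_iff)
    then have "w = 0\<^sub>v d" using w(1) by (intro eq_vecI) auto
    then show False using w(2) by simp
  qed
  ultimately have im: "Im \<mu> = 0" by simp
  have "\<exists>v. v \<in> carrier_vec d \<and> v \<noteq> 0\<^sub>v d \<and> S *\<^sub>v v = Re \<mu> \<cdot>\<^sub>v v"
  proof (cases "a = 0\<^sub>v d")
    case False
    then have "S *\<^sub>v a = Re \<mu> \<cdot>\<^sub>v a" unfolding Sa im using ab by (intro eq_vecI) auto
    then show ?thesis using ab False by blast
  next
    case True
    then have "b \<noteq> 0\<^sub>v d" using \<open>a \<bullet> a + b \<bullet> b \<noteq> 0\<close> by auto
    moreover have "S *\<^sub>v b = Re \<mu> \<cdot>\<^sub>v b" unfolding Sb im using ab by (intro eq_vecI) auto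
    ultimately show ?thesis using ab by blast
  qed
  then obtain v where v: "v \<in> carrier_vec d" "v \<noteq> 0\<^sub>v d" "S *\<^sub>v v = Re \<mu> \<cdot>\<^sub>v v" by blast
  obtain r where r: "r > 0" "(r \<cdot>\<^sub>v v) \<bullet> (r \<cdot>\<^sub>v v) = 1" using normalize_vec[OF v(1,2)] by blast
  have "S *\<^sub>v (r \<cdot>\<^sub>v v) = Re \<mu> \<cdot>\<^sub>v (r \<cdot>\<^sub>v v)"
    unfolding mult_mat_vec[OF S v(1)] v(3) by (simp add: smult_smult_assoc mult.commute)
  then show ?thesis using that[of "r \<cdot>\<^sub>v v"] r v(1) by simp
qed

text \<open>Orthogonality gives \<open>Q * transpose_mat (Q + 1) = Q + 1\<close>. Taking
  determinants, \<open>det (Q + 1)\<close> is its own negative, and a kernel vector of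
  \<open>Q + 1\<close> has eigenvalue -1.\<close>

lemma orthogonal_neg_det_eigenvector:
  assumes Q: "is_orthogonal d Q" and det: "det Q = -1"
  obtains v where "v \<in> carrier_vec d" "v \<bullet> v = 1" "Q *\<^sub>v v = - v"
proof -
  note q = is_orthogonalD[OF Q]
  have c: "Q + 1\<^sub>m d \<in> carrier_mat d d" using q by simp
  have "transpose_mat (Q + 1\<^sub>m d) = transpose_mat Q + 1\<^sub>m d"
    by (subst transpose_add[OF q(1)]) auto
  then have "Q * transpose_mat (Q + 1\<^sub>m d) = 1\<^sub>m d + Q"
    using mult_add_distrib_mat[OF q(1,2), of "1\<^sub>m d"] q by simp
  also have "\<dots> = Q + 1\<^sub>m d" using q by (intro comm_add_mat) auto
  finally have "det (Q + 1\<^sub>m d) = det Q * det (transpose_mat (Q + 1\<^sub>m d))"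
    using det_mult[OF q(1), of "transpose_mat (Q + 1\<^sub>m d)"] c by simp
  then have "det (Q + 1\<^sub>m d) = 0" using det det_transpose[OF c] by simp
  then obtain v where v: "v \<in> carrier_vec d" "v \<noteq> 0\<^sub>v d" "(Q + 1\<^sub>m d) *\<^sub>v v = 0\<^sub>v d"
    using det_0_iff_vec_prod_zero_field[OF c] by blast
  have "Q *\<^sub>v v + v = 0\<^sub>v d"
    using v add_mult_distrib_mat_vec[OF q(1), of "1\<^sub>m d" v] by simp
  then have "(Q *\<^sub>v v + v) $ i = 0" if "i < d" for i using that by simp
  then have Qv: "(Q *\<^sub>v v) $ i = - v $ i" if "i < d" for i
    using that v(1) q(1) by (simp add: eq_neg_iff_add_eq_0)
  obtain r where r: "r > 0" "(r \<cdot>\<^sub>v v) \<bullet> (r \<cdot>\<^sub>v v) = 1" using normalize_vec[OF v(1,2)] by blast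
  have "Q *\<^sub>v (r \<cdot>\<^sub>v v) = - (r \<cdot>\<^sub>v v)"
    unfolding mult_mat_vec[OF q(1) v(1)] using Qv v(1) q(1) by (intro eq_vecI) (auto simp del: index_mult_mat_vec)
  then show ?thesis using that[of "r \<cdot>\<^sub>v v"] r v(1) by simp
qed

text \<open>If \<open>v\<close> is an eigenvector of \<open>Q + transpose_mat Q\<close> with
  eigenvalue \<open>2 c\<close>, applying \<open>Q\<close> to the eigenvector equation gives
  \<open>Q (Q v) = 2 c (Q v) - v\<close>, so \<open>v\<close> and \<open>Q v\<close> span an
  invariant space. Gram-Schmidt makes it a rotation plane unless \<open>Q v\<close> is
  \<open>v\<close> or \<open>- v\<close>. In the last case the span is a line, and the determinant
  has to supply a second vector with eigenvalue -1.\<close>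

lemma special_orthogonal_invariant_subspace:
  assumes Q: "is_orthogonal d Q" and det: "det Q = 1" and d: "d > 0"
  obtains (fixed) v where "v \<in> carrier_vec d" "v \<bullet> v = 1" "Q *\<^sub>v v = v"
  | (plane) u v c s where "u \<in> carrier_vec d" "v \<in> carrier_vec d" "u \<bullet> u = 1" "v \<bullet> v = 1" "u \<bullet> v = 0"
      "c\<^sup>2 + s\<^sup>2 = 1" "Q *\<^sub>v v = c \<cdot>\<^sub>v v + s \<cdot>\<^sub>v u" "Q *\<^sub>v u = c \<cdot>\<^sub>v u - s \<cdot>\<^sub>v v"
proof -
  note q = is_orthogonalD[OF Q]
  have S: "Q + transpose_mat Q \<in> carrier_mat d d" using q by simp
  have sym: "transpose_mat (Q + transpose_mat Q) = Q + transpose_mat Q"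
    using q(1,2) by (subst transpose_add[OF q(1,2)]) (simp add: comm_add_mat[of _ d d])
  obtain v l where v: "v \<in> carrier_vec d" "v \<bullet> v = 1" and Sv: "(Q + transpose_mat Q) *\<^sub>v v = l \<cdot>\<^sub>v v"
    using symmetric_real_eigenvector[OF S sym d] by blast
  define x where "x = Q *\<^sub>v v"
  have x: "x \<in> carrier_vec d" using q v by (simp add: x_def)
  have xx: "x \<bullet> x = 1" using is_orthogonal_scalar_prod[OF Q v(1) v(1)] v by (simp add: x_def)
  define y where "y = transpose_mat Q *\<^sub>v v"
  have y: "y \<in> carrier_vec d" using q v by (simp add: y_def)
  have xy: "x + y = l \<cdot>\<^sub>v v" using Sv add_mult_distrib_mat_vec[OF q(1,2) v(1)] by (simp add: x_def y_def)
  have Qy: "Q *\<^sub>v y = v"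
    unfolding y_def using assoc_mult_mat_vec[OF q(1,2) v(1)] q v by simp
  define c where "c = v \<bullet> x"
  have l: "l = 2 * c"
  proof -
    have "v \<bullet> (x + y) = v \<bullet> x + v \<bullet> y" by (rule scalar_prod_add_distrib[OF v(1) x y])
    moreover have "v \<bullet> y = (Q *\<^sub>v v) \<bullet> (Q *\<^sub>v y)" using is_orthogonal_scalar_prod[OF Q v(1) y] by simp
    moreover have "\<dots> = c" unfolding Qy c_def x_def[symmetric] by (rule comm_scalar_prod[OF x v(1)])
    moreover have "v \<bullet> (x + y) = l" unfolding xy using v by simp
    ultimately show ?thesis by (simp add: c_def)
  qed
  have Qx: "Q *\<^sub>v x + v = (2 * c) \<cdot>\<^sub>v x"
  proof -
    have "Q *\<^sub>v (x + y) = Q *\<^sub>v x + v" using mult_add_distrib_mat_vec[OF q(1) x y] Qy by simp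
    moreover have "Q *\<^sub>v (x + y) = (2 * c) \<cdot>\<^sub>v x"
      unfolding xy l using mult_mat_vec[OF q(1) v(1)] by (simp add: x_def)
    ultimately show ?thesis by simp
  qed
  have Qxi: "(Q *\<^sub>v x) $ i = 2 * c * x $ i - v $ i" if "i < d" for i
  proof -
    have "(Q *\<^sub>v x + v) $ i = ((2 * c) \<cdot>\<^sub>v x) $ i" using Qx by simp
    then show ?thesis using that x v(1) by (simp del: index_mult_mat_vec)
  qed
  show ?thesis
  proof (cases "x = v \<or> x = - v")
    case False
    define w where "w = x - c \<cdot>\<^sub>v v"
    have w: "w \<in> carrier_vec d" using x v by (simp add: w_def)
    have wv: "w \<bullet> v = 0"
      unfolding w_def using x v minus_scalar_prod_distrib[of x d "c \<cdot>\<^sub>v v" v] comm_scalar_prod[OF x v(1)]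
      by (simp add: c_def)
    have "w \<bullet> w = w \<bullet> x"
      using scalar_prod_minus_distrib[OF w x, of "c \<cdot>\<^sub>v v"] v w wv by (simp add: w_def[symmetric])
    also have "\<dots> = 1 - c\<^sup>2"
      unfolding w_def using x v minus_scalar_prod_distrib[of x d "c \<cdot>\<^sub>v v" x] xx
      by (simp add: c_def power2_eq_square)
    finally have ww: "w \<bullet> w = 1 - c\<^sup>2" .
    have w0: "w \<noteq> 0\<^sub>v d"
    proof
      assume "w = 0\<^sub>v d"
      then have "w $ i = 0" if "i < d" for i using that by simp
      then have xc: "x = c \<cdot>\<^sub>v v" using x v by (intro eq_vecI) (auto simp: w_def)
      have "c\<^sup>2 = 1" using ww \<open>w = 0\<^sub>v d\<close> by simp
      then have "c = 1 \<or> c = -1" by (simp add: power2_eq_1_iff)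
      then show False using False xc v by (auto simp: uminus_l_inv_vec intro!: eq_vecI)
    qed
    define s where "s = euc_norm w"
    have s2: "s\<^sup>2 = 1 - c\<^sup>2" unfolding s_def euc_norm_sq_scalar_prod ww ..
    have s0: "s \<noteq> 0" using w0 euc_norm_eq_0D[of w] w by (auto simp: s_def)
    define u where "u = (1 / s) \<cdot>\<^sub>v w"
    have u: "u \<in> carrier_vec d" using w by (simp add: u_def)
    show ?thesis
    proof (rule plane[OF u v(1) _ v(2)])
      show "u \<bullet> u = 1" using w ww s2 s0 by (simp add: u_def power2_eq_square[symmetric] field_simps)
      show "u \<bullet> v = 0" using w v wv by (simp add: u_def)
      show "c\<^sup>2 + s\<^sup>2 = 1" using s2 by simp
      show "Q *\<^sub>v v = c \<cdot>\<^sub>v v + s \<cdot>\<^sub>v u"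
        unfolding x_def[symmetric] u_def using x v w s0 by (intro eq_vecI) (auto simp: w_def)
      have "Q *\<^sub>v u = (1 / s) \<cdot>\<^sub>v (Q *\<^sub>v w)" unfolding u_def by (rule mult_mat_vec[OF q(1) w])
      also have "Q *\<^sub>v w = Q *\<^sub>v x - c \<cdot>\<^sub>v x"
        unfolding w_def using mult_minus_distrib_mat_vec[OF q(1) x, of "c \<cdot>\<^sub>v v"] mult_mat_vec[OF q(1) v(1)] v(1)
        by (simp add: x_def[symmetric])
      finally have Qu: "Q *\<^sub>v u = (1 / s) \<cdot>\<^sub>v (Q *\<^sub>v x - c \<cdot>\<^sub>v x)" .
      show "Q *\<^sub>v u = c \<cdot>\<^sub>v u - s \<cdot>\<^sub>v v"
      proof (rule eq_vecI)
        fix i assume "i < dim_vec (c \<cdot>\<^sub>v u - s \<cdot>\<^sub>v v)"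
        then have i: "i < d" using v by simp
        have "(Q *\<^sub>v u) $ i = (1 / s) * ((2 * c * x $ i - v $ i) - c * x $ i)"
          unfolding Qu using i x q(1) Qxi[OF i] by (simp del: index_mult_mat_vec)
        also have "\<dots> = c * ((1 / s) * (x $ i - c * v $ i)) - s * v $ i"
        proof -
          have "(2 * c * x $ i - v $ i) - c * x $ i = c * (x $ i - c * v $ i) - s\<^sup>2 * v $ i"
            unfolding s2 by (simp add: algebra_simps power2_eq_square)
          then show ?thesis using s0 by (simp add: field_simps power2_eq_square)
        qed
        also have "\<dots> = (c \<cdot>\<^sub>v u - s \<cdot>\<^sub>v v) $ i" using i x v by (simp add: u_def w_def)
        finally show "(Q *\<^sub>v u) $ i = (c \<cdot>\<^sub>v u - s \<cdot>\<^sub>v v) $ i" .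
      qed (use q u v in auto)
    qed
  next
    case True
    show ?thesis
    proof (cases "x = v")
      case True
      then show ?thesis using fixed v by (simp add: x_def)
    next
      case False
      with True have xv: "Q *\<^sub>v v = - v" by (simp add: x_def)
      let ?e = "unit_vec d 0 :: real vec" and ?S = "mat_diag d (\<lambda>i. if i = 0 then -1 else 1) :: real mat"
      have e: "?e \<in> carrier_vec d" by simp
      have "v \<bullet> v = ?e \<bullet> ?e" using v d by simp
      then obtain H where H: "is_orthogonal d H" "H *\<^sub>v v = ?e" using householder[OF v(1) e] by blast
      note h = is_orthogonalD[OF H(1)] and r = reflection_diag[of d]
      \<comment> \<open>The reflection that negates \<open>v\<close>. The product
        \<open>Q * F\<close> has determinant -1 and fixes \<open>v\<close>, so its eigenvector for
        -1 is orthogonal to \<open>v\<close>; being fixed by \<open>F\<close>, it is also an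
        eigenvector of \<open>Q\<close> for -1.\<close>
      define F where "F = transpose_mat H * (?S * H)"
      have F: "is_orthogonal d F"
        unfolding F_def by (intro is_orthogonal_mult is_orthogonal_transpose H(1) r(1))
      have Sz: "(?S *\<^sub>v z) $ i = (if i = 0 then - z $ i else z $ i)" if "z \<in> carrier_vec d" "i < d" for z i
        unfolding mult_vec_entry[OF r(4) that] using that(2)
        by (simp add: mat_diag_def if_distrib[of "\<lambda>x. x * _"] cong: if_cong)
      have Fz: "F *\<^sub>v z = transpose_mat H *\<^sub>v (?S *\<^sub>v (H *\<^sub>v z))" if z: "z \<in> carrier_vec d" for z
        unfolding F_def assoc_mult_mat_vec[OF h(2) mult_carrier_mat[OF r(4) h(1)] z] assoc_mult_mat_vec[OF r(4) h(1) z] ..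
      have HH: "transpose_mat H *\<^sub>v (H *\<^sub>v z) = z" if z: "z \<in> carrier_vec d" for z
        using assoc_mult_mat_vec[OF h(2,1) z] h(3) z by simp
      have Fv: "F *\<^sub>v v = - v"
      proof -
        have "?S *\<^sub>v ?e = (-1) \<cdot>\<^sub>v ?e"
          by (rule eq_vecI) (use Sz[OF e] carrier_matD[OF r(4)] in \<open>auto simp del: index_mult_mat_vec(1)\<close>)
        then have "F *\<^sub>v v = (-1) \<cdot>\<^sub>v (transpose_mat H *\<^sub>v ?e)"
          unfolding Fz[OF v(1)] H(2) using mult_mat_vec[OF h(2) e] by simp
        also have "transpose_mat H *\<^sub>v ?e = v" using HH[OF v(1)] H(2) by simp
        finally show ?thesis using v(1) by (auto intro: eq_vecI)
      qed
      have detF: "det F = -1"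
        unfolding F_def det_mult[OF h(2) mult_carrier_mat[OF r(4) h(1)]] det_mult[OF r(4) h(1)]
          det_transpose[OF h(1)] r(2)[OF d] using is_orthogonal_det[OF H(1)] by simp
      note f = is_orthogonalD[OF F]
      have QF: "is_orthogonal d (Q * F)" by (rule is_orthogonal_mult[OF Q F])
      have "det (Q * F) = -1" unfolding det_mult[OF q(1) f(1)] det detF by simp
      then obtain u where u: "u \<in> carrier_vec d" "u \<bullet> u = 1" and QFu: "(Q * F) *\<^sub>v u = - u"
        using orthogonal_neg_det_eigenvector[OF QF] by blast
      have neg: "A *\<^sub>v (- z) = - (A *\<^sub>v z)" if "A \<in> carrier_mat d d" "z \<in> carrier_vec d" for A and z :: "real vec"
      proof -
        have "- z = (-1) \<cdot>\<^sub>v z" "- (A *\<^sub>v z) = (-1) \<cdot>\<^sub>v (A *\<^sub>v z)" by (auto intro!: eq_vecI)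
        then show ?thesis using mult_mat_vec[OF that] by simp
      qed
      have QFv: "(Q * F) *\<^sub>v v = v"
        unfolding assoc_mult_mat_vec[OF q(1) f(1) v(1)] Fv neg[OF q(1) v(1)] xv by simp
      have uv: "u \<bullet> v = 0"
      proof -
        have "u \<bullet> v = (- u) \<bullet> v"
          using is_orthogonal_scalar_prod[OF QF u(1) v(1)] unfolding QFu QFv by simp
        then show ?thesis using u v by simp
      qed
      have "(H *\<^sub>v u) \<bullet> ?e = 0" using is_orthogonal_scalar_prod[OF H(1) u(1) v(1)] H(2) uv by simp
      then have Hu0: "(H *\<^sub>v u) $ 0 = 0"
        using scalar_prod_right_unit[OF d, of "H *\<^sub>v u"] by (simp del: index_mult_mat_vec)
      have Hu: "H *\<^sub>v u \<in> carrier_vec d" using h(1) u(1) by simp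
      have "?S *\<^sub>v (H *\<^sub>v u) = H *\<^sub>v u"
        by (rule eq_vecI) (use Sz[OF Hu] Hu0 h(1) carrier_matD[OF r(4)] in \<open>auto simp del: index_mult_mat_vec(1)\<close>)
      then have "F *\<^sub>v u = u" using Fz[OF u(1)] HH[OF u(1)] by simp
      then have Qu: "Q *\<^sub>v u = - u" using QFu assoc_mult_mat_vec[OF q(1) f(1) u(1)] by simp
      show ?thesis
      proof (rule plane[OF u(1) v(1) u(2) v(2) uv])
        show "(-1)\<^sup>2 + (0::real)\<^sup>2 = 1" by simp
        show "Q *\<^sub>v v = (-1) \<cdot>\<^sub>v v + 0 \<cdot>\<^sub>v u" unfolding xv using u v by (intro eq_vecI) auto
        show "Q *\<^sub>v u = (-1) \<cdot>\<^sub>v u - 0 \<cdot>\<^sub>v v" unfolding Qu using u v by (intro eq_vecI) auto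
      qed
    qed
  qed
qed

section \<open>Splitting off an invariant block\<close>

lemma sum_lessThan_add:
  fixes f :: "nat \<Rightarrow> real"
  shows "(\<Sum>k<r + n. f k) = (\<Sum>k<r. f k) + (\<Sum>k<n. f (r + k))"
  by (induction n) auto

text \<open>The zero block makes the first \<open>r\<close> columns orthonormal already within
  \<open>B\<close>, so \<open>B\<close> is orthogonal. Its rows then have length 1 and exhaust the
  first \<open>r\<close> rows of \<open>Q\<close>, which forces the upper right block to
  vanish.\<close>

lemma orthogonal_block_split:
  assumes Q: "is_orthogonal (r + n) Q" and z: "\<And>i j. i < n \<Longrightarrow> j < r \<Longrightarrow> Q $$ (r + i, j) = 0"
  defines "B \<equiv> mat r r (\<lambda>ij. Q $$ ij)" and "D \<equiv> mat n n (\<lambda>(i,j). Q $$ (r + i, r + j))"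
  shows "is_orthogonal n D" "Q = four_block_mat B (0\<^sub>m r n) (0\<^sub>m n r) D"
proof -
  note q = is_orthogonalD[OF Q]
  have B: "B \<in> carrier_mat r r" and D: "D \<in> carrier_mat n n" by (auto simp: B_def D_def)
  have cols: "(\<Sum>k<r. Q $$ (k,i) * Q $$ (k,j)) + (\<Sum>k<n. Q $$ (r + k,i) * Q $$ (r + k,j)) = (if i = j then 1 else 0)"
    if "i < r + n" "j < r + n" for i j
    using arg_cong[OF q(3), of "\<lambda>M. M $$ (i,j)"] mult_mat_entry[OF q(2,1) that] q(1) that
    by (simp add: sum_lessThan_add del: index_mult_mat(1))
  have rows: "(\<Sum>k<r. Q $$ (i,k) * Q $$ (i,k)) + (\<Sum>k<n. Q $$ (i,r + k) * Q $$ (i,r + k)) = 1"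
    if "i < r + n" for i
    using arg_cong[OF q(4), of "\<lambda>M. M $$ (i,i)"] mult_mat_entry[OF q(1,2) that that] q(1) that
    by (simp add: sum_lessThan_add del: index_mult_mat(1))
  have "transpose_mat B * B = 1\<^sub>m r"
  proof (rule eq_matI)
    fix i j assume "i < dim_row (1\<^sub>m r :: real mat)" "j < dim_col (1\<^sub>m r :: real mat)"
    then have ij: "i < r" "j < r" by auto
    have "(transpose_mat B * B) $$ (i,j) = (\<Sum>k<r. Q $$ (k,i) * Q $$ (k,j))"
      using mult_mat_entry[of "transpose_mat B" r r B r i j] ij by (simp add: B_def del: index_mult_mat(1))
    then show "(transpose_mat B * B) $$ (i,j) = 1\<^sub>m r $$ (i,j)"
      using cols[of i j] ij z by (simp del: index_mult_mat(1))
  qed (use B in auto)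
  then have "is_orthogonal r B" using B by (simp add: is_orthogonal_def)
  note b = is_orthogonalD[OF this]
  have C0: "Q $$ (i, r + k) = 0" if i: "i < r" and k: "k < n" for i k
  proof -
    have "(\<Sum>k<r. Q $$ (i,k) * Q $$ (i,k)) = (B * transpose_mat B) $$ (i,i)"
      using mult_mat_entry[OF b(1,2) i i] i by (simp add: B_def del: index_mult_mat(1))
    also have "\<dots> = 1" unfolding b(4) using i by simp
    finally have "(\<Sum>k<n. Q $$ (i,r + k) * Q $$ (i,r + k)) = 0" using rows[of i] i by simp
    then have "\<forall>k\<in>{..<n}. Q $$ (i,r + k) * Q $$ (i,r + k) = 0"
      by (subst (asm) sum_nonneg_eq_0_iff) auto
    then show ?thesis using k by simp
  qed
  have "transpose_mat D * D = 1\<^sub>m n"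
  proof (rule eq_matI)
    fix i j assume "i < dim_row (1\<^sub>m n :: real mat)" "j < dim_col (1\<^sub>m n :: real mat)"
    then have ij: "i < n" "j < n" by auto
    have "(transpose_mat D * D) $$ (i,j) = (\<Sum>k<n. Q $$ (r + k,r + i) * Q $$ (r + k,r + j))"
      using mult_mat_entry[of "transpose_mat D" n n D n i j] ij by (simp add: D_def del: index_mult_mat(1))
    then show "(transpose_mat D * D) $$ (i,j) = 1\<^sub>m n $$ (i,j)"
      using cols[of "r + i" "r + j"] ij C0 by (simp del: index_mult_mat(1))
  qed (use D in auto)
  then show "is_orthogonal n D" using D by (simp add: is_orthogonal_def)
  show "Q = four_block_mat B (0\<^sub>m r n) (0\<^sub>m n r) D"
  proof (rule eq_matI)
    fix i j assume "i < dim_row (four_block_mat B (0\<^sub>m r n) (0\<^sub>m n r) D)"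
      "j < dim_col (four_block_mat B (0\<^sub>m r n) (0\<^sub>m n r) D)"
    then have ij: "i < r + n" "j < r + n" using B D by auto
    show "Q $$ (i,j) = four_block_mat B (0\<^sub>m r n) (0\<^sub>m n r) D $$ (i,j)"
      using ij B D z[of "i - r" j] C0[of i "j - r"]
      by (cases "i < r"; cases "j < r") (auto simp: B_def D_def)
  qed (use q B D in auto)
qed

definition is_skew_log :: "nat \<Rightarrow> real mat \<Rightarrow> real mat \<Rightarrow> bool" where
  "is_skew_log d Q Y \<longleftrightarrow> Y \<in> carrier_mat d d \<and> transpose_mat Y = - Y \<and> mat_exp Y = Q"

lemma is_skew_log_four_block:
  assumes "is_skew_log r B J" "is_skew_log n D Y"
  shows "is_skew_log (r + n) (four_block_mat B (0\<^sub>m r n) (0\<^sub>m n r) D) (four_block_mat J (0\<^sub>m r n) (0\<^sub>m n r) Y)"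
proof -
  have J: "J \<in> carrier_mat r r" "transpose_mat J = - J" "mat_exp J = B"
    and Y: "Y \<in> carrier_mat n n" "transpose_mat Y = - Y" "mat_exp Y = D"
    using assms by (auto simp: is_skew_log_def)
  have "transpose_mat (four_block_mat J (0\<^sub>m r n) (0\<^sub>m n r) Y) = four_block_mat (- J) (0\<^sub>m r n) (0\<^sub>m n r) (- Y)"
    using transpose_four_block_mat[OF J(1) zero_carrier_mat zero_carrier_mat Y(1)] J Y by simp
  also have "\<dots> = - four_block_mat J (0\<^sub>m r n) (0\<^sub>m n r) Y"
    using J(1) Y(1) by (intro eq_matI) auto
  finally show ?thesis
    using J Y mat_exp_four_block_diag[OF J(1) Y(1)] by (simp add: is_skew_log_def)
qed

lemma is_skew_log_conj:
  assumes H: "is_orthogonal d H" and Q: "Q \<in> carrier_mat d d"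
    and log: "is_skew_log d (H * Q * transpose_mat H) Y"
  shows "is_skew_log d Q (transpose_mat H * Y * H)"
proof -
  note h = is_orthogonalD[OF H]
  have Y: "Y \<in> carrier_mat d d" "transpose_mat Y = - Y" "mat_exp Y = H * Q * transpose_mat H"
    using log by (auto simp: is_skew_log_def)
  have "transpose_mat (transpose_mat H * Y * H) = transpose_mat H * (transpose_mat Y * H)"
    using h(1,2) Y(1) by (simp add: transpose_mult[of _ d d _ d])
  also have "\<dots> = transpose_mat H * (- (Y * H))"
    unfolding Y(2) using h(1) Y(1) by simp
  also have "\<dots> = - (transpose_mat H * Y * H)"
    using h(1,2) Y(1) uminus_mult_right_mat[of "transpose_mat H" "Y * H"] by (simp add: assoc_mult_mat[of _ d d _ d _ d])
  finally have sk: "transpose_mat (transpose_mat H * Y * H) = - (transpose_mat H * Y * H)" .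
  have "mat_exp (transpose_mat H * Y * H) = transpose_mat H * (H * Q * transpose_mat H) * H"
    using mat_exp_orthogonal_conj[OF H Y(1)] Y(3) by simp
  also have "\<dots> = (transpose_mat H * H) * Q * (transpose_mat H * H)"
    using h(1,2) Q by (simp add: assoc_mult_mat[of _ d d _ d _ d])
  also have "\<dots> = Q" using h Q by simp
  finally show ?thesis using sk h Y(1) by (simp add: is_skew_log_def mult_carrier_mat[of _ d d _ d])
qed

text \<open>The induction step for a block of any size \<open>r\<close>, applied with an identity
  block of size 1 and a rotation of size 2. Since \<open>B\<close> has determinant 1, the
  complementary block is special orthogonal again.\<close>

lemma special_orthogonal_skew_log_step:
  assumes IH: "\<And>D. is_orthogonal n D \<Longrightarrow> det D = 1 \<Longrightarrow> \<exists>Y. is_skew_log n D Y"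
    and Q: "is_orthogonal (r + n) Q" and det: "det Q = 1" and H: "is_orthogonal (r + n) H"
    and z: "\<And>i j. i < n \<Longrightarrow> j < r \<Longrightarrow> (H * Q * transpose_mat H) $$ (r + i, j) = 0"
    and B: "mat r r (\<lambda>ij. (H * Q * transpose_mat H) $$ ij) = B" and detB: "det B = 1" and J: "is_skew_log r B J"
  shows "\<exists>Y. is_skew_log (r + n) Q Y"
proof -
  let ?Q = "H * Q * transpose_mat H"
  note h = is_orthogonalD[OF H] and q = is_orthogonalD[OF Q]
  have o: "is_orthogonal (r + n) ?Q" by (intro is_orthogonal_mult H Q is_orthogonal_transpose)
  define D where "D = mat n n (\<lambda>(i,j). ?Q $$ (r + i, r + j))"
  have D: "is_orthogonal n D" and split: "?Q = four_block_mat B (0\<^sub>m r n) (0\<^sub>m n r) D"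
    using orthogonal_block_split[OF o z] unfolding B D_def by blast+
  have Bc: "B \<in> carrier_mat r r" using B by auto
  have "det ?Q = det B * det D"
    unfolding split by (rule det_four_block_mat_lower_left_zero[OF Bc _ _ is_orthogonalD(1)[OF D]]) auto
  moreover have "det ?Q = 1"
    using det_mult[OF mult_carrier_mat[OF h(1) q(1)] h(2)] det_mult[OF h(1) q(1)] det_transpose[OF h(1)]
      is_orthogonal_det[OF H] det by simp
  ultimately have "det D = 1" using detB by simp
  then obtain Y where "is_skew_log n D Y" using IH[OF D] by blast
  then have "is_skew_log (r + n) ?Q (four_block_mat J (0\<^sub>m r n) (0\<^sub>m n r) Y)"
    unfolding split by (rule is_skew_log_four_block[OF J])
  then show ?thesis using is_skew_log_conj[OF H q(1)] by blast
qed

text \<open>Column \<open>j\<close> of the conjugate is its value at the \<open>j\<close>-th unit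
  vector, which \<open>transpose_mat H\<close> sends back to \<open>v\<close>.\<close>

lemma conj_entry:
  assumes H: "is_orthogonal d H" and Q: "Q \<in> carrier_mat d d" and v: "v \<in> carrier_vec d"
    and Hv: "H *\<^sub>v v = unit_vec d j" and ij: "i < d" "j < d"
  shows "(H * Q * transpose_mat H) $$ (i,j) = (H *\<^sub>v (Q *\<^sub>v v)) $ i"
proof -
  note h = is_orthogonalD[OF H]
  let ?Q = "H * Q * transpose_mat H"
  have c: "?Q \<in> carrier_mat d d" using h(1,2) Q by (simp add: mult_carrier_mat[of _ d d _ d])
  have "?Q *\<^sub>v unit_vec d j = (H * Q) *\<^sub>v (transpose_mat H *\<^sub>v unit_vec d j)"
    by (rule assoc_mult_mat_vec[OF mult_carrier_mat[OF h(1) Q] h(2)]) simp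
  also have "transpose_mat H *\<^sub>v unit_vec d j = v"
    unfolding Hv[symmetric] using assoc_mult_mat_vec[OF h(2,1) v] h(3) v by simp
  also have "(H * Q) *\<^sub>v v = H *\<^sub>v (Q *\<^sub>v v)" by (rule assoc_mult_mat_vec[OF h(1) Q v])
  finally have "?Q *\<^sub>v unit_vec d j = H *\<^sub>v (Q *\<^sub>v v)" .
  moreover have "(?Q *\<^sub>v unit_vec d j) $ i = ?Q $$ (i,j)"
    using mult_vec_entry[OF c _ ij(1), of "unit_vec d j"] ij
    by (simp add: if_distrib[of "\<lambda>x. _ * x"] cong: if_cong del: index_mult_mat_vec index_mult_mat(1))
  ultimately show ?thesis by simp
qed

lemma special_orthogonal_skew_log:
  "is_orthogonal d Q \<Longrightarrow> det Q = 1 \<Longrightarrow> \<exists>Y. is_skew_log d Q Y"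
proof (induction d arbitrary: Q rule: less_induct)
  case (less d)
  note q = is_orthogonalD[OF less.prems(1)]
  show ?case
  proof (cases "d = 0")
    case True
    then have "is_skew_log d Q Q" using q(1) by (auto simp: is_skew_log_def intro!: eq_matI)
    then show ?thesis by blast
  next
    case False
    then have d: "d > 0" by simp
    show ?thesis
    using less.prems(1,2) d
    proof (cases rule: special_orthogonal_invariant_subspace)
      case (fixed v)
      define n where "n = d - 1"
      have dn: "d = 1 + n" using d by (simp add: n_def)
      have "v \<bullet> v = unit_vec d 0 \<bullet> unit_vec d 0" using fixed d by simp
      then obtain H where H: "is_orthogonal d H" "H *\<^sub>v v = unit_vec d 0"
        using householder[OF fixed(1) unit_vec_carrier] by blast
      have ent: "(H * Q * transpose_mat H) $$ (i,0) = (if i = 0 then 1 else 0)" if "i < d" for i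
        using conj_entry[OF H(1) q(1) fixed(1) H(2) that d] fixed(3) H(2) that d by simp
      have B: "mat 1 1 (\<lambda>ij. (H * Q * transpose_mat H) $$ ij) = 1\<^sub>m 1"
        using ent[of 0] d by (intro eq_matI) (auto simp del: index_mult_mat(1))
      have J: "is_skew_log 1 (1\<^sub>m 1) (0\<^sub>m 1 1)"
        by (auto simp: is_skew_log_def mat_exp_zero intro!: eq_matI)
      show ?thesis unfolding dn
      proof (rule special_orthogonal_skew_log_step[OF _ _ less.prems(2) _ _ B _ J])
        show "is_orthogonal (1 + n) Q" "is_orthogonal (1 + n) H" using less.prems(1) H(1) dn by auto
        show "(H * Q * transpose_mat H) $$ (1 + i, j) = 0" if "i < n" "j < 1" for i j
          using ent[of "1 + i"] that dn by (simp del: index_mult_mat(1))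
        show "\<exists>Y. is_skew_log n D Y" if "is_orthogonal n D" "det D = 1" for D
          using less.IH[of n D] that dn by simp
      qed simp
    next
      case (plane u v c s)
      \<comment> \<open>In dimension 1 two unit vectors cannot be orthogonal.\<close>
      have d2: "d \<ge> 2"
      proof (rule ccontr)
        assume "\<not> 2 \<le> d"
        then have "d = 1" using d by simp
        then show False
          using plane(1-5) by (auto simp: scalar_prod_sum[of _ d])
      qed
      define n where "n = d - 2"
      have dn: "d = 2 + n" using d2 by (simp add: n_def)
      have "v \<bullet> v = unit_vec d 0 \<bullet> unit_vec d 0" using plane d by simp
      then obtain H1 where H1: "is_orthogonal d H1" "H1 *\<^sub>v v = unit_vec d 0"
        using householder[OF plane(2) unit_vec_carrier] by blast
      note h1 = is_orthogonalD[OF H1(1)]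
      \<comment> \<open>\<open>u'\<close> stays orthogonal to the image of \<open>v\<close>, the
        unit vector 0. The second reflection, which moves \<open>u'\<close> to the unit vector 1,
        therefore fixes the unit vector 0.\<close>
      define u' where "u' = H1 *\<^sub>v u"
      have u': "u' \<in> carrier_vec d" using h1(1) plane(1) by (simp add: u'_def)
      have "u' \<bullet> u' = unit_vec d 1 \<bullet> unit_vec d 1"
        using is_orthogonal_scalar_prod[OF H1(1) plane(1,1)] plane(3) d2 by (simp add: u'_def)
      then obtain H2 where H2: "is_orthogonal d H2" "H2 *\<^sub>v u' = unit_vec d 1"
        and H2f: "\<And>z. z \<in> carrier_vec d \<Longrightarrow> z \<bullet> (u' - unit_vec d 1) = 0 \<Longrightarrow> H2 *\<^sub>v z = z"
        using householder[OF u' unit_vec_carrier] by blast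
      note h2 = is_orthogonalD[OF H2(1)]
      define H where "H = H2 * H1"
      have H: "is_orthogonal d H" unfolding H_def by (rule is_orthogonal_mult[OF H2(1) H1(1)])
      note h = is_orthogonalD[OF H]
      have "u' $ 0 = 0"
        using is_orthogonal_scalar_prod[OF H1(1) plane(1,2)] plane(5) H1(2) scalar_prod_right_unit[OF d, of u']
        by (simp add: u'_def[symmetric])
      then have "unit_vec d 0 \<bullet> (u' - unit_vec d 1) = 0"
        using d2 u' by (subst scalar_prod_left_unit) auto
      then have "H2 *\<^sub>v unit_vec d 0 = unit_vec d 0" by (intro H2f) auto
      then have Hv: "H *\<^sub>v v = unit_vec d 0"
        unfolding H_def assoc_mult_mat_vec[OF h2(1) h1(1) plane(2)] H1(2) .
      have Hu: "H *\<^sub>v u = unit_vec d 1"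
        unfolding H_def assoc_mult_mat_vec[OF h2(1) h1(1) plane(1)] using H2(2) by (simp add: u'_def)
      have HQv: "H *\<^sub>v (Q *\<^sub>v v) = c \<cdot>\<^sub>v unit_vec d 0 + s \<cdot>\<^sub>v unit_vec d 1"
        unfolding plane(7) using mult_add_distrib_mat_vec[OF h(1), of "c \<cdot>\<^sub>v v" "s \<cdot>\<^sub>v u"]
          mult_mat_vec[OF h(1) plane(2)] mult_mat_vec[OF h(1) plane(1)] plane(1,2) Hv Hu by simp
      have HQu: "H *\<^sub>v (Q *\<^sub>v u) = c \<cdot>\<^sub>v unit_vec d 1 - s \<cdot>\<^sub>v unit_vec d 0"
        unfolding plane(8) using mult_minus_distrib_mat_vec[OF h(1), of "c \<cdot>\<^sub>v u" "s \<cdot>\<^sub>v v"]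
          mult_mat_vec[OF h(1) plane(2)] mult_mat_vec[OF h(1) plane(1)] plane(1,2) Hv Hu by simp
      have ent0: "(H * Q * transpose_mat H) $$ (i,0) = (if i = 0 then c else if i = 1 then s else 0)" if "i < d" for i
        using conj_entry[OF H q(1) plane(2) Hv that d] that d2 unfolding HQv by simp
      have ent1: "(H * Q * transpose_mat H) $$ (i,1) = (if i = 0 then - s else if i = 1 then c else 0)" if "i < d" for i
        using conj_entry[OF H q(1) plane(1) Hu that] that d2 unfolding HQu by simp
      have two: "j = 0 \<or> j = 1" if "j < 2" for j :: nat using that by auto
      have B: "mat 2 2 (\<lambda>ij. (H * Q * transpose_mat H) $$ ij) = rot c s"
      proof (rule eq_matI)
        fix i j assume "i < dim_row (rot c s)" "j < dim_col (rot c s)"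
        then have "i < 2" "j < 2" by (auto simp: rot_def)
        then show "mat 2 2 (\<lambda>ij. (H * Q * transpose_mat H) $$ ij) $$ (i,j) = rot c s $$ (i,j)"
          using ent0[of i] ent1[of i] d2 two[of i] two[of j] by (auto simp: rot_def simp del: index_mult_mat(1))
      qed (auto simp: rot_def)
      obtain t where t: "c = cos t" "s = sin t" using sincos_total_2pi[OF plane(6)] by blast
      have J: "is_skew_log 2 (rot c s) (rot 0 t)"
        by (simp add: is_skew_log_def rot_skew mat_exp_rot t)
      show ?thesis unfolding dn
      proof (rule special_orthogonal_skew_log_step[OF _ _ less.prems(2) _ _ B _ J])
        show "is_orthogonal (2 + n) Q" "is_orthogonal (2 + n) H" using less.prems(1) H dn by auto
        show "(H * Q * transpose_mat H) $$ (2 + i, j) = 0" if "i < n" "j < 2" for i j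
          using ent0[of "2 + i"] ent1[of "2 + i"] two[of j] that dn by (auto simp del: index_mult_mat(1))
        show "\<exists>Y. is_skew_log n D Y" if "is_orthogonal n D" "det D = 1" for D
          using less.IH[of n D] that dn by simp
        show "det (rot c s) = 1" by (rule det_rot[OF plane(6)])
      qed
    qed
  qed
qed

text \<open>The norm of the logarithm becomes \<open>\<alpha>\<close>, which must be positive. A
  zero logarithm occurs only for the identity, and there a full turn by \<open>2 * pi\<close> in the
  first two coordinates has the same exponential.\<close>

lemma special_orthogonal_nonzero_skew_log:
  assumes Q: "is_orthogonal d Q" "det Q = 1" and d2: "d \<ge> 2"
  obtains Y where "is_skew_log d Q Y" "fro_norm Y > 0"
proof -
  obtain Y where Y: "is_skew_log d Q Y" using special_orthogonal_skew_log[OF Q] by blast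
  show ?thesis
  proof (cases "fro_norm Y = 0")
    case False
    then show ?thesis using that[OF Y] fro_norm_nonneg[of Y] by (simp add: less_le)
  next
    case True
    have Yc: "Y \<in> carrier_mat d d" using Y by (simp add: is_skew_log_def)
    have "Y = 0\<^sub>m d d"
      using True abs_entry_le_fro_norm[of _ Y] Yc by (intro eq_matI) fastforce+
    then have Q1: "Q = 1\<^sub>m d" using Y by (simp add: is_skew_log_def mat_exp_zero)
    define n where "n = d - 2"
    have dn: "d = 2 + n" using d2 by (simp add: n_def)
    let ?Z = "four_block_mat (rot 0 (2 * pi)) (0\<^sub>m 2 n) (0\<^sub>m n 2) (0\<^sub>m n n)"
    have "rot 1 0 = 1\<^sub>m 2" by (rule eq_matI) (auto simp: rot_def)
    then have "is_skew_log 2 (1\<^sub>m 2) (rot 0 (2 * pi))"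
      by (simp add: is_skew_log_def rot_skew mat_exp_rot)
    moreover have "is_skew_log n (1\<^sub>m n) (0\<^sub>m n n)"
      by (auto simp: is_skew_log_def mat_exp_zero intro!: eq_matI)
    ultimately have "is_skew_log (2 + n) (four_block_mat (1\<^sub>m 2) (0\<^sub>m 2 n) (0\<^sub>m n 2) (1\<^sub>m n)) ?Z"
      by (rule is_skew_log_four_block)
    then have "is_skew_log d Q ?Z" by (simp add: Q1 dn four_block_one_mat)
    moreover have "fro_norm ?Z > 0"
    proof -
      have "?Z $$ (1,0) = 2 * pi" by (simp add: rot_def)
      then have "2 * pi \<le> fro_norm ?Z"
        using abs_entry_le_fro_norm[of 1 ?Z 0] by (simp add: rot_def)
      then show ?thesis using pi_gt_zero by linarith
    qed
    ultimately show ?thesis by (rule that)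
  qed
qed

lemma exact_joint_triangularizer_exp:
  assumes d2: "d \<ge> 2"
    and V: "V \<in> carrier_mat d d" "Vinv \<in> carrier_mat d d"
    and Vinv: "V * Vinv = 1\<^sub>m d" "Vinv * V = 1\<^sub>m d" and U: "is_orthogonal d U"
  shows "\<exists>U0 X (\<alpha>::real). exact_joint_triangularizer d N (model_M d V Vinv \<Lambda>) U0 \<and> X \<in> carrier_mat d d \<and>
    transpose_mat X = - X \<and> fro_norm X = 1 \<and> \<alpha> > 0 \<and> U = U0 * mat_exp (\<alpha> \<cdot>\<^sub>m X)"
proof -
  note u = is_orthogonalD[OF U]
  obtain U0 where U0: "exact_joint_triangularizer d N (model_M d V Vinv \<Lambda>) U0" and det: "det U0 = det U"
    using exact_joint_triangularizer_det[OF V Vinv _ is_orthogonal_det[OF U]] d2 by auto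
  then have o: "is_orthogonal d U0" by (simp add: exact_joint_triangularizer_def)
  note u0 = is_orthogonalD[OF o]
  have "is_orthogonal d (transpose_mat U0 * U)"
    by (intro is_orthogonal_mult is_orthogonal_transpose o U)
  moreover have "det (transpose_mat U0 * U) = 1"
    unfolding det_mult[OF u0(2) u(1)] det_transpose[OF u0(1)] det by (rule is_orthogonal_det[OF U])
  ultimately obtain Y where Y: "is_skew_log d (transpose_mat U0 * U) Y" and nz: "fro_norm Y > 0"
    using special_orthogonal_nonzero_skew_log d2 by blast
  define \<alpha> where "\<alpha> = fro_norm Y"
  define X where "X = (1 / \<alpha>) \<cdot>\<^sub>m Y"
  have Yc: "Y \<in> carrier_mat d d" and sk: "transpose_mat Y = - Y" and ex: "mat_exp Y = transpose_mat U0 * U"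
    using Y by (auto simp: is_skew_log_def)
  have \<alpha>: "\<alpha> > 0" using nz by (simp add: \<alpha>_def)
  have X: "X \<in> carrier_mat d d" using Yc by (simp add: X_def)
  have "transpose_mat X = (1 / \<alpha>) \<cdot>\<^sub>m transpose_mat Y" unfolding X_def by (intro eq_matI) auto
  also have "\<dots> = - X" unfolding sk X_def by (intro eq_matI) auto
  finally have skX: "transpose_mat X = - X" .
  have nX: "fro_norm X = 1" using \<alpha> by (simp add: X_def \<alpha>_def)
  have "\<alpha> \<cdot>\<^sub>m X = Y" using \<alpha> by (intro eq_matI) (auto simp: X_def)
  then have "U0 * mat_exp (\<alpha> \<cdot>\<^sub>m X) = U0 * transpose_mat U0 * U"
    using ex u0(1,2) u(1) by (simp add: assoc_mult_mat[of _ d d _ d _ d])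
  also have "\<dots> = U" using u0(4) u(1) by simp
  finally show ?thesis using U0 X skX nX \<alpha> by metis
qed

text \<open>The order of the quantifiers gives the O-term its meaning: one pair \<open>C\<close>,
  \<open>\<delta>\<close> serves all noise levels, noise matrices and points \<open>U\<close>.
  Existence of a decomposition is a conjunct of its own; the estimate then covers every
  decomposition with \<open>\<sigma> + \<alpha> < \<delta>\<close>.\<close>

theorem theorem3:
  fixes d N :: nat and V Vinv :: "real mat" and \<Lambda> :: "nat \<Rightarrow> nat \<Rightarrow> real"
    and \<beta> :: "nat \<Rightarrow> real"
  assumes d2: "d \<ge> 2"
    and V: "V \<in> carrier_mat d d" "Vinv \<in> carrier_mat d d"
    and Vinv: "V * Vinv = 1\<^sub>m d" "Vinv * V = 1\<^sub>m d"
    and nondeg: "\<forall>i<d. \<forall>i'<d. i \<noteq> i' \<longrightarrow> (\<exists>n\<in>{1..N}. \<Lambda> n i \<noteq> \<Lambda> n i')"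
  shows "\<exists>C \<delta>. \<delta> > 0 \<and>
    (\<forall>(\<sigma>::real) (W :: nat \<Rightarrow> real mat) (U :: real mat).
       \<sigma> > 0 \<and> (\<forall>n\<in>{1..N}. W n \<in> carrier_mat d d \<and> fro_norm (W n) \<le> 1) \<and> is_orthogonal d U \<longrightarrow>
       (let M = model_M d V Vinv \<Lambda>;
            Mh = (\<lambda>n. M n + \<sigma> \<cdot>\<^sub>m W n);
            T = T_hat d N \<beta> Mh U
        in
         (\<exists>U0 X (\<alpha>::real). exact_joint_triangularizer d N M U0 \<and> X \<in> carrier_mat d d \<and>
             transpose_mat X = - X \<and> fro_norm X = 1 \<and> \<alpha> > 0 \<and> U = U0 * mat_exp (\<alpha> \<cdot>\<^sub>m X)) \<and>
         (\<forall>U0 X (\<alpha>::real). exact_joint_triangularizer d N M U0 \<and> X \<in> carrier_mat d d \<and>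
             transpose_mat X = - X \<and> fro_norm X = 1 \<and> \<alpha> > 0 \<and> U = U0 * mat_exp (\<alpha> \<cdot>\<^sub>m X) \<and>
             \<sigma> + \<alpha> < \<delta> \<and> invertible_mat T \<longrightarrow>
           \<alpha> \<le> sqrt 2 * sqrt (\<Sum>n\<in>{1..N}. (\<beta> n)\<^sup>2) * spec_norm (mat_inv T) *
                  (sqrt (loss N Mh U) + \<sigma> * sqrt (real N)) + C * (\<sigma> + \<alpha>)\<^sup>2)))"
proof (rule triangularizer_distance_bound[OF d2 V Vinv nondeg, of \<beta>])
  fix C \<delta> :: real
  assume \<delta>: "\<delta> > 0" and bound:
    "\<And>\<sigma> \<alpha> W U U0 X Mh. Mh = (\<lambda>n. model_M d V Vinv \<Lambda> n + \<sigma> \<cdot>\<^sub>m W n) \<Longrightarrow>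
      \<sigma> > 0 \<Longrightarrow> (\<And>n. n \<in> {1..N} \<Longrightarrow> W n \<in> carrier_mat d d \<and> fro_norm (W n) \<le> 1) \<Longrightarrow>
      is_orthogonal d U \<Longrightarrow> exact_joint_triangularizer d N (model_M d V Vinv \<Lambda>) U0 \<Longrightarrow>
      X \<in> carrier_mat d d \<Longrightarrow> transpose_mat X = - X \<Longrightarrow> fro_norm X = 1 \<Longrightarrow> \<alpha> > 0 \<Longrightarrow>
      U = U0 * mat_exp (\<alpha> \<cdot>\<^sub>m X) \<Longrightarrow> \<sigma> + \<alpha> < \<delta> \<Longrightarrow> invertible_mat (T_hat d N \<beta> Mh U) \<Longrightarrow>
      \<alpha> \<le> sqrt 2 * sqrt (\<Sum>n\<in>{1..N}. (\<beta> n)\<^sup>2) * spec_norm (mat_inv (T_hat d N \<beta> Mh U)) *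
        (sqrt (loss N Mh U) + \<sigma> * sqrt (real N)) + C * (\<sigma> + \<alpha>)\<^sup>2"
  show ?thesis
    unfolding Let_def
  proof (intro exI[of _ C] exI[of _ \<delta>] conjI allI impI \<delta>; elim conjE)
    fix \<sigma> :: real and W U
    assume "is_orthogonal d U"
    then show "\<exists>U0 X (\<alpha>::real). exact_joint_triangularizer d N (model_M d V Vinv \<Lambda>) U0 \<and> X \<in> carrier_mat d d \<and>
        transpose_mat X = - X \<and> fro_norm X = 1 \<and> \<alpha> > 0 \<and> U = U0 * mat_exp (\<alpha> \<cdot>\<^sub>m X)"
      by (rule exact_joint_triangularizer_exp[OF d2 V Vinv])
  qed (rule bound[OF refl], assumption, blast, assumption+)
qed

end
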